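(* Let $0=a_0<a_1<\ldots<a_k=a$ be integers, let $A=\{a_0,a_1,\ldots,a_k\}$, and let $d:=\mathrm{GCD}(a_1,\ldots,a_k)$. Then the monodromy group $G_A$ of the general polynomial $f(x)=c_0+c_1x^{a_1}+\ldots+c_kx^{a_k}$ supported at $A$ is $G_A=(\mathbb{Z}/d\mathbb{Z})\wr\mathfrak{S}_{a/d}$, i.e. the monodromy group consists of all permutations of the $a$ roots of the equation $f(x)=0$ that preserve the (oriented) necklace structure.
   Context: $\mathbb{C}^A$ is the space of all complex polynomials $f(x)=c_0+c_1x^{a_1}+\ldots+c_kx^{a_k}$. The discriminant is $D=\{f\in\mathbb{C}^A : f \text{ has fewer than } a \text{ (distinct) roots}\}$. As $f$ travels along a loop in $\mathbb{C}^A\setminus D$ (with a fixed base point), the $a$ roots of the base polynomial undergo a permutation; $G_A\subset\mathfrak{S}_a$ is the group of all permutations so obtained. Since $f(x)=\tilde f(x^d)$ for a polynomial $\tilde f$ of degree $a/d$, the roots of $f$ split into $a/d$ necklaces of length $d$: the necklace over a root $y$ of $\tilde f$ is the set of $d$ roots $x$ with $x^d=y$, cyclically oriented by multiplication by $e^{2\pi i/d}$. A permutation of the roots preserves the oriented necklace structure if it maps necklaces to necklaces and commutes with multiplication by $e^{2\pi i/d}$. The wreath product $H\wr G$ of a group $H$ and a subgroup $G\subset\mathfrak{S}(S)$ of the permutation group of a finite set $S$ is the semidirect product of $H^S$ and $G$, with $G$ permuting the factors; $(\mathbb{Z}/d\mathbb{Z})\wr\mathfrak{S}_m$ is the group of permutations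 of $m$ oriented necklaces of length $d$. $\mathfrak{S}_m$ is the symmetric group on $m$ elements. *)

theory Defs
  imports
    "HOL-Analysis.Analysis"
    "HOL-Computational_Algebra.Polynomial"
    "HOL-Algebra.Product_Groups"
    "HOL-Algebra.Sym_Groups"
begin

definition roots :: "complex poly \<Rightarrow> complex set"
  where "roots f = {x. poly f x = 0}"

definition poly_space :: "nat set \<Rightarrow> complex poly set"
  where "poly_space A = {f. \<forall>n. coeff f n \<noteq> 0 \<longrightarrow> n \<in> A}"

text \<open>
  Since \<^term>\<open>card\<close> is 0 on infinite sets, the zero polynomial lies in the
  discriminant when \<^prop>\<open>Max A > 0\<close>, as it should.
\<close>

definition discriminant :: "nat set \<Rightarrow> complex poly set"
  where "discriminant A = {f \<in> poly_space A. card (roots f) < Max A}"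

text \<open>
  The library puts no topology on polynomials. The finite-dimensional space
  \<^term>\<open>poly_space A\<close> (for finite \<^term>\<open>A\<close>) carries the Euclidean topology in its
  coefficients, so continuity is required coefficientwise.
\<close>

definition poly_loop :: "complex poly set \<Rightarrow> complex poly \<Rightarrow> (real \<Rightarrow> complex poly) \<Rightarrow> bool"
  where "poly_loop S f \<gamma> \<longleftrightarrow>
    (\<forall>n. path (\<lambda>t. coeff (\<gamma> t) n)) \<and> \<gamma> ` {0..1} \<subseteq> S \<and> \<gamma> 0 = f \<and> \<gamma> 1 = f"

text \<open>
  \<^term>\<open>\<sigma>\<close> is the permutation of the roots of \<^term>\<open>\<gamma> 0\<close> obtained by following each
  root continuously along \<^term>\<open>\<gamma>\<close>. As usual for \<^const>\<open>permutes\<close>, it is extended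
  by the identity outside the set of roots.
\<close>

definition induces_permutation :: "(real \<Rightarrow> complex poly) \<Rightarrow> (complex \<Rightarrow> complex) \<Rightarrow> bool"
  where "induces_permutation \<gamma> \<sigma> \<longleftrightarrow> \<sigma> permutes roots (\<gamma> 0) \<and>
    (\<forall>x\<in>roots (\<gamma> 0). \<exists>\<rho>. path \<rho> \<and> pathstart \<rho> = x \<and> pathfinish \<rho> = \<sigma> x \<and>
      (\<forall>t\<in>{0..1}. \<rho> t \<in> roots (\<gamma> t)))"

definition monodromy_group :: "nat set \<Rightarrow> complex poly \<Rightarrow> (complex \<Rightarrow> complex) monoid"
  where "monodromy_group A f =
    \<lparr>carrier = {\<sigma>. \<exists>\<gamma>. poly_loop (poly_space A - discriminant A) f \<gamma> \<and> induces_permutation \<gamma> \<sigma>},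
     monoid.mult = (\<circ>), one = id\<rparr>"

text \<open>For \<^prop>\<open>d > 0\<close>, a polynomial \<^term>\<open>g\<close> with \<open>f(x) = g(x^d)\<close> is unique if it exists.\<close>

definition necklaces :: "nat \<Rightarrow> complex poly \<Rightarrow> complex set set"
  where "necklaces d f =
    {N. \<exists>g y. f = pcompose g (monom 1 d) \<and> y \<in> roots g \<and> N = {x. x ^ d = y}}"

definition preserves_necklaces :: "nat \<Rightarrow> complex poly \<Rightarrow> (complex \<Rightarrow> complex) \<Rightarrow> bool"
  where "preserves_necklaces d f \<sigma> \<longleftrightarrow>
    (\<forall>N\<in>necklaces d f. \<sigma> ` N \<in> necklaces d f) \<and>
    (\<forall>x\<in>roots f. \<sigma> (exp (2 * of_real pi * \<i> / of_nat d) * x) =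
                  exp (2 * of_real pi * \<i> / of_nat d) * \<sigma> x)"

definition semidirect_product ::
  "('n, 'p) monoid_scheme \<Rightarrow> ('g, 'q) monoid_scheme \<Rightarrow> ('g \<Rightarrow> 'n \<Rightarrow> 'n) \<Rightarrow> ('n \<times> 'g) monoid"
  where "semidirect_product N G \<phi> =
    \<lparr>carrier = carrier N \<times> carrier G,
     monoid.mult = (\<lambda>(u, g) (v, h). (u \<otimes>\<^bsub>N\<^esub> \<phi> g v, g \<otimes>\<^bsub>G\<^esub> h)),
     one = (\<one>\<^bsub>N\<^esub>, \<one>\<^bsub>G\<^esub>)\<rparr>"

text \<open>\<^term>\<open>G\<close> is meant to be a group of permutations of \<^term>\<open>S\<close> under composition.\<close>

definition wreath_product ::
  "('h, 'p) monoid_scheme \<Rightarrow> 's set \<Rightarrow> ('s \<Rightarrow> 's, 'q) monoid_scheme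
    \<Rightarrow> (('s \<Rightarrow> 'h) \<times> ('s \<Rightarrow> 's)) monoid"
  where "wreath_product H S G =
    semidirect_product (product_group S (\<lambda>_. H)) G (\<lambda>g u. \<lambda>s\<in>S. u (inv' g s))"

end

theory Submission
  imports Defs "HOL-Computational_Algebra.Fundamental_Theorem_Algebra"
begin

text \<open>
  Let \<open>N = a k\<close> be the degree, \<open>n = N / d\<close> the number of necklaces and \<open>S\<close> the complement of the
  discriminant, that is, the polynomials of degree \<open>N\<close> supported at \<open>A\<close> with simple roots. Along a
  path in \<open>S\<close> the roots form a covering of the unit interval, so they can be followed in exactly one
  way (\<open>root_path_exists\<close>, \<open>root_path_unique\<close>). Because all exponents are divisible by \<open>d\<close>, a root path
  multiplied by a \<open>d\<close>-th root of unity is again a root path; by uniqueness the monodromy commutes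
  with the rotation of the necklaces. The point is to realize every permutation with this property.

  The space \<open>S\<close> is path connected (\<open>transport_exists\<close>), so one may choose the base point. A good choice
  is a binomial \<open>\<alpha> x^N + \<beta>\<close> with positive coefficients: turning \<open>\<beta>\<close> once around the origin shifts its
  roots cyclically. Enumerate the roots by the integers modulo \<open>N\<close>. The permutations to be realized
  lift to permutations of the integers that commute with translation by \<open>n\<close>, and these are generated
  by translation by one and, for \<open>n > 1\<close>, the swap of two neighbouring residue classes modulo \<open>n\<close>
  (\<open>all_periodic_perms\<close>). So it remains to swap two neighbouring necklaces and to fix all others.

  For \<open>n > 1\<close> there is an \<open>m\<close> in \<open>A\<close> with \<open>0 < m < N\<close>. Consider the trinomials \<open>m x^N - s N x^m + (N - m)\<close>.
  For \<open>s = 0\<close> this is a binomial, for \<open>0 \<le> s < 1\<close> the roots are simple, and for \<open>s = 1\<close> there are double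
  roots exactly at the common roots of unity \<open>\<xi>^N = \<xi>^m = 1\<close>. As \<open>s\<close> grows to \<open>1\<close>, the two roots of the
  binomial next to the direction of \<open>\<xi>\<close> collide in \<open>\<xi>\<close> (\<open>approach_double_roots\<close>). At \<open>s = 1\<close>, adding a
  small multiple \<open>\<epsilon> q\<close> of a polynomial splits the double root into \<open>\<xi> \<plusminus> sqrt (- \<epsilon> q(\<xi>) / h)\<close>, up to a
  small error, where \<open>h\<close> is half the second derivative at \<open>\<xi>\<close> (\<open>double_root_splits\<close>). If \<open>q(\<xi>)\<close> winds
  once around the origin, then the two roots are swapped; if \<open>q(\<xi>)\<close> stays in the right half-plane, then
  they return. As \<open>q\<close> may use all monomials in \<open>A\<close>, there is a loop of polynomials \<open>q\<close> whose values wind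
  around the origin at those \<open>\<xi>\<close> with \<open>\<xi>^d = 1\<close> only (\<open>swap_realized\<close>). This loop swaps precisely two
  neighbouring necklaces.

  Finally, one representative in each necklace identifies the permutations that commute with the
  rotation with the elements of the wreath product (\<open>commuting_perms_iso_wreath\<close>).
\<close>

section \<open>Polynomials all of whose roots are simple\<close>

lemma card_roots_eq_degree_iff:
  fixes p :: "complex poly"
  assumes "p \<noteq> 0"
  shows "card (roots p) = degree p \<longleftrightarrow> rsquarefree p"
proof -
  have fin: "finite (roots p)"
    using assms by (simp add: roots_def poly_roots_finite)
  have "degree p = size (proots p)"
    by (simp add: size_proots_complex)
  also have "\<dots> = (\<Sum>x\<in>roots p. Polynomial.order x p)"
    using assms by (simp add: size_multiset_overloaded_eq roots_def)
  finally have deg: "degree p = (\<Sum>x\<in>roots p. Polynomial.order x p)" .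
  have pos: "Polynomial.order x p \<ge> 1" if "x \<in> roots p" for x
    using that assms by (simp add: roots_def order_root Suc_le_eq)
  have "card (roots p) = degree p \<longleftrightarrow> (\<forall>x\<in>roots p. Polynomial.order x p = 1)"
  proof
    assume eq: "card (roots p) = degree p"
    have "(\<Sum>x\<in>roots p. Polynomial.order x p - 1) = (\<Sum>x\<in>roots p. Polynomial.order x p) - (\<Sum>x\<in>roots p. 1)"
      using pos by (intro sum_subtractf_nat) auto
    also have "\<dots> = 0" using eq deg by simp
    finally have "\<forall>x\<in>roots p. Polynomial.order x p - 1 = 0" using fin by simp
    then show "\<forall>x\<in>roots p. Polynomial.order x p = 1" using pos by (metis diff_is_0_eq le_antisym)
  qed (simp add: deg)
  also have "\<dots> \<longleftrightarrow> rsquarefree p"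
  proof -
    have "x \<in> roots p \<longleftrightarrow> Polynomial.order x p \<noteq> 0" for x
      using assms order_root[of p x] by (simp add: roots_def)
    then show ?thesis
      using assms unfolding rsquarefree_def by blast
  qed
  finally show ?thesis .
qed

definition simple_polys :: "nat \<Rightarrow> complex poly set"
  where "simple_polys N = {f. degree f = N \<and> rsquarefree f}"

lemma simple_polys_iff:
  "f \<in> simple_polys N \<longleftrightarrow>
     degree f = N \<and> (\<forall>x. poly f x = 0 \<longrightarrow> poly (pderiv f) x \<noteq> 0)"
  by (auto simp: simple_polys_def rsquarefree_roots)

lemma simple_polys_nonzero: "f \<in> simple_polys N \<Longrightarrow> f \<noteq> 0"
  by (auto simp: simple_polys_def rsquarefree_def)

lemma finite_roots: "f \<noteq> 0 \<Longrightarrow> finite (roots f)"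
  by (simp add: roots_def poly_roots_finite)

lemma card_roots_simple: "f \<in> simple_polys N \<Longrightarrow> card (roots f) = N"
  using card_roots_eq_degree_iff by (auto simp: simple_polys_def rsquarefree_def)

lemma degree_poly_space:
  assumes "finite A" "A \<noteq> {}" "f \<in> poly_space A"
  shows "degree f \<le> Max A"
proof (rule degree_le, intro allI impI)
  fix i assume "Max A < i"
  then have "i \<notin> A" using assms Max_ge by fastforce
  then show "coeff f i = 0" using assms(3) by (auto simp: poly_space_def)
qed

lemma compl_discriminant:
  assumes "finite A" "A \<noteq> {}" "0 < Max A"
  shows "poly_space A - discriminant A = poly_space A \<inter> simple_polys (Max A)"
proof -
  have "\<not> card (roots f) < Max A \<longleftrightarrow> f \<in> simple_polys (Max A)" if f: "f \<in> poly_space A" for f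
  proof (cases "f = 0")
    case True
    then have "card (roots f) = 0" by (simp add: roots_def infinite_UNIV_char_0)
    then show ?thesis using assms(3) True by (auto simp: simple_polys_def)
  next
    case False
    have le: "card (roots f) \<le> degree f" "degree f \<le> Max A"
      using card_poly_roots_bound[OF False] degree_poly_space[OF assms(1,2) f] by (auto simp: roots_def)
    show ?thesis
    proof
      assume "\<not> card (roots f) < Max A"
      then have "card (roots f) = degree f" "degree f = Max A" using le by auto
      then show "f \<in> simple_polys (Max A)"
        using card_roots_eq_degree_iff[OF False] by (simp add: simple_polys_def)
    next
      assume "f \<in> simple_polys (Max A)"
      then show "\<not> card (roots f) < Max A" by (simp add: card_roots_simple)
    qed
  qed
  then show ?thesis by (auto simp: discriminant_def)
qed

text \<open>
  The absolute value of a polynomial is the product of that of its leading coefficient and the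
  distances to its roots, so a value that is small compared with the leading coefficient forces a
  root nearby.
\<close>

lemma root_within_distance:
  assumes f: "f \<in> simple_polys N" and N: "0 < N" and r: "0 < r"
    and small: "norm (poly f x) < norm (coeff f N) * r ^ N"
  shows "\<exists>y\<in>roots f. dist x y < r"
proof (rule ccontr)
  assume "\<not> ?thesis"
  then have far: "r \<le> norm (x - y)" if "y \<in> roots f" for y
    using that by (auto simp: dist_norm not_less)
  have sq: "rsquarefree f" and deg: "degree f = N" using f by (auto simp: simple_polys_def)
  have "poly f x = poly (smult (lead_coeff f) (\<Prod>z\<in>roots f. [:-z, 1:])) x"
    using complex_poly_decompose_rsquarefree[OF sq] by (simp add: roots_def)
  also have "norm \<dots> = norm (coeff f N) * (\<Prod>z\<in>roots f. norm (x - z))"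
    by (simp add: poly_prod norm_mult prod_norm deg)
  finally have "norm (poly f x) = norm (coeff f N) * (\<Prod>z\<in>roots f. norm (x - z))" .
  moreover have "(\<Prod>z\<in>roots f. r) \<le> (\<Prod>z\<in>roots f. norm (x - z))"
    using far r by (intro prod_mono) auto
  then have "r ^ N \<le> (\<Prod>z\<in>roots f. norm (x - z))"
    using card_roots_simple[OF f] by simp
  ultimately have "norm (coeff f N) * r ^ N \<le> norm (poly f x)"
    by (simp add: mult_left_mono)
  then show False using small by simp
qed

text \<open>
  The divided difference of \<open>p\<close>, written as a polynomial in both arguments so that it extends
  continuously to the diagonal, where it is the derivative.
\<close>

definition ddiff :: "complex poly \<Rightarrow> complex \<Rightarrow> complex \<Rightarrow> complex"
  where "ddiff p x y = (\<Sum>i\<le>degree p. coeff p i * (\<Sum>j<i. y ^ (i - Suc j) * x ^ j))"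

lemma poly_diff_eq_ddiff: "poly p x - poly p y = (x - y) * ddiff p x y"
proof -
  have "poly p x - poly p y = (\<Sum>i\<le>degree p. coeff p i * (x ^ i - y ^ i))"
    by (simp add: poly_altdef sum_subtractf right_diff_distrib)
  also have "\<dots> = (\<Sum>i\<le>degree p. (x - y) * (coeff p i * (\<Sum>j<i. y ^ (i - Suc j) * x ^ j)))"
    by (simp add: power_diff_sumr2 mult_ac)
  finally show ?thesis by (simp add: ddiff_def sum_distrib_left)
qed

lemma continuous_ddiff [continuous_intros]:
  assumes "continuous_on S f" "continuous_on S g"
  shows "continuous_on S (\<lambda>t. ddiff p (f t) (g t))"
  unfolding ddiff_def by (intro continuous_intros assms)

lemma ddiff_self: "ddiff p x x = poly (pderiv p) x"
proof -
  have "((\<lambda>y. ddiff p y x) \<longlongrightarrow> ddiff p x x) (at x)"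
    using continuous_ddiff[of UNIV "\<lambda>y. y" "\<lambda>_. x" p]
    by (simp add: continuous_on_def)
  moreover have "\<forall>\<^sub>F y in at x. ddiff p y x = (poly p y - poly p x) / (y - x)"
    by (auto simp: eventually_at_filter poly_diff_eq_ddiff)
  ultimately have "((\<lambda>y. (poly p y - poly p x) / (y - x)) \<longlongrightarrow> ddiff p x x) (at x)"
    using tendsto_cong by fast
  moreover have "((\<lambda>y. (poly p y - poly p x) / (y - x)) \<longlongrightarrow> poly (pderiv p) x) (at x)"
    using poly_DERIV[of p x] by (simp add: has_field_derivative_iff)
  ultimately show ?thesis using tendsto_unique by (metis at_neq_bot)
qed

section \<open>Following roots along paths of polynomials\<close>

definition poly_path :: "complex poly set \<Rightarrow> (real \<Rightarrow> complex poly) \<Rightarrow> bool"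
  where "poly_path S \<gamma> \<longleftrightarrow> (\<forall>n. path (\<lambda>t. coeff (\<gamma> t) n)) \<and> \<gamma> ` {0..1} \<subseteq> S"

definition root_path :: "(real \<Rightarrow> complex poly) \<Rightarrow> (real \<Rightarrow> complex) \<Rightarrow> bool"
  where "root_path \<gamma> \<rho> \<longleftrightarrow> path \<rho> \<and> (\<forall>t\<in>{0..1}. \<rho> t \<in> roots (\<gamma> t))"

lemma poly_path_mono: "poly_path S \<gamma> \<Longrightarrow> S \<subseteq> T \<Longrightarrow> poly_path T \<gamma>"
  by (auto simp: poly_path_def)

lemma poly_path_mem: "poly_path S \<gamma> \<Longrightarrow> t \<in> {0..1} \<Longrightarrow> \<gamma> t \<in> S"
  by (auto simp: poly_path_def)

lemma continuous_on_poly_path: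
  assumes "poly_path (simple_polys N) \<gamma>"
  shows "continuous_on {0..1} (\<lambda>t. poly (\<gamma> t) x)"
proof -
  have "poly (\<gamma> t) x = (\<Sum>i\<le>N. coeff (\<gamma> t) i * x ^ i)" if "t \<in> {0..1}" for t
    using poly_path_mem[OF assms that] by (simp add: simple_polys_def poly_altdef)
  moreover have "continuous_on {0..1} (\<lambda>t. \<Sum>i\<le>N. coeff (\<gamma> t) i * x ^ i)"
    using assms by (intro continuous_intros) (auto simp: poly_path_def path_def)
  ultimately show ?thesis using continuous_on_cong by (metis (no_types, lifting))
qed

lemma finite_separated:
  fixes X :: "complex set"
  assumes "finite X"
  shows "\<exists>r>0. \<forall>x\<in>X. \<forall>y\<in>X. x \<noteq> y \<longrightarrow> 2 * r \<le> dist x y"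
proof -
  have "uniform_discrete X" using assms uniform_discrete_finite_iff by blast
  then obtain e where "0 < e" "\<forall>x\<in>X. \<forall>y\<in>X. dist x y < e \<longrightarrow> x = y"
    by (auto simp: uniform_discrete_def)
  then show ?thesis by (intro exI[of _ "e / 2"]) (auto simp: not_less[symmetric])
qed

text \<open>
  Along a path of polynomials with simple roots, the set of pairs (time, root) covers the unit
  interval: near a time \<open>t0\<close> every small disc around a root of \<open>\<gamma> t0\<close> keeps at least one root, and by
  counting exactly one. Existence and uniqueness of root paths are then instances of path lifting.
\<close>

lemma covering_space_root_paths:
  assumes \<gamma>: "poly_path (simple_polys N) \<gamma>" and N: "0 < N"
  shows "covering_space {(t, x). t \<in> {0..1} \<and> x \<in> roots (\<gamma> t)} fst {0..1}"
    (is "covering_space ?E fst _")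
proof
  show "continuous_on ?E fst" by (intro continuous_intros)
  have ex: "roots (\<gamma> t) \<noteq> {}" if "t \<in> {0..1}" for t
    using card_roots_simple[OF poly_path_mem[OF \<gamma> that]] N by auto
  show "fst ` ?E = {0..1}" 
  proof
    show "{0..1} \<subseteq> fst ` ?E"
    proof
      fix t :: real assume t: "t \<in> {0..1}"
      then obtain x where "x \<in> roots (\<gamma> t)" using ex by blast
      then show "t \<in> fst ` ?E" using t by (intro image_eqI[of _ _ "(t,x)"]) auto
    qed
  qed auto
  fix t0 :: real assume t0: "t0 \<in> {0..1}"
  define R where "R = roots (\<gamma> t0)"
  have R: "finite R" "card R = N"
    using card_roots_simple[OF poly_path_mem[OF \<gamma> t0]]
      finite_roots[OF simple_polys_nonzero[OF poly_path_mem[OF \<gamma> t0]]] by (auto simp: R_def)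
  obtain r where r: "0 < r" and sep: "\<And>x y. x \<in> R \<Longrightarrow> y \<in> R \<Longrightarrow> x \<noteq> y \<Longrightarrow> 2 * r \<le> dist x y"
    using finite_separated[OF R(1)] by blast
  define T where
    "T = {0..1} \<inter> (\<Inter>x\<in>R. {t \<in> {0..1}. norm (poly (\<gamma> t) x) < norm (coeff (\<gamma> t) N) * r ^ N})"
  have clc: "continuous_on {0..1} (\<lambda>t. coeff (\<gamma> t) N)"
    using \<gamma> by (auto simp: poly_path_def path_def)
  have "openin (top_of_set {0..1})
      {t \<in> {0..1}. norm (poly (\<gamma> t) x) < norm (coeff (\<gamma> t) N) * r ^ N}" for x
  proof -
    have "continuous_on {0..1} (\<lambda>t. norm (coeff (\<gamma> t) N) * r ^ N - norm (poly (\<gamma> t) x))"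
      by (intro continuous_intros clc continuous_on_poly_path[OF \<gamma>])
    from continuous_openin_preimage_gen[OF this open_greaterThan[of 0]]
    show ?thesis by (rule back_subst[of "openin _"]) auto
  qed
  then have openT: "openin (top_of_set {0..1}) T"
    unfolding T_def Inter_insert[symmetric] using R(1)
    by (intro openin_Inter) (auto simp del: Inter_insert)
  have lc: "coeff (\<gamma> t) N \<noteq> 0" if "t \<in> {0..1}" for t
    using poly_path_mem[OF \<gamma> that] by (auto simp: simple_polys_def rsquarefree_def)
  have t0T: "t0 \<in> T"
    using t0 lc[OF t0] r by (auto simp: T_def R_def roots_def)
  have T01: "T \<subseteq> {0..1}" by (auto simp: T_def)
  \<comment> \<open>By counting, the \<open>N\<close> disjoint discs contain one root each and no root lies outside them.\<close>
  have main: "(\<forall>x\<in>R. \<exists>!y. y \<in> roots (\<gamma> t) \<and> dist x y < r) \<and> (\<forall>y\<in>roots (\<gamma> t). \<exists>x\<in>R. dist x y < r)"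
    if t: "t \<in> T" for t
  proof -
    have s: "\<gamma> t \<in> simple_polys N" using poly_path_mem[OF \<gamma>] T01 t by auto
    have "\<exists>y\<in>roots (\<gamma> t). dist x y < r" if "x \<in> R" for x
      using root_within_distance[OF s N r] that t by (auto simp: T_def)
    then obtain q where q: "\<And>x. x \<in> R \<Longrightarrow> q x \<in> roots (\<gamma> t) \<and> dist x (q x) < r"
      by metis
    have same: "x = x'" if "x \<in> R" "x' \<in> R" "dist x y < r" "dist x' y < r" for x x' y
      using sep[of x x'] that dist_triangle2[of x x' y] by fastforce
    have "inj_on q R" using q same by (intro inj_onI) metis
    then have "card (q ` R) = card (roots (\<gamma> t))"
      by (simp add: card_image R(2) card_roots_simple[OF s])
    then have im: "q ` R = roots (\<gamma> t)"
      using q finite_roots[OF simple_polys_nonzero[OF s]] by (intro card_subset_eq) auto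
    show ?thesis
    proof (intro conjI ballI)
      fix x assume x: "x \<in> R"
      show "\<exists>!y. y \<in> roots (\<gamma> t) \<and> dist x y < r"
      proof (rule ex1I[of _ "q x"])
        fix y assume y: "y \<in> roots (\<gamma> t) \<and> dist x y < r"
        then obtain x' where "x' \<in> R" "y = q x'" using im by auto
        then show "y = q x" using same[OF x, of x' y] q[of x'] y by auto
      qed (use q x in auto)
    next
      fix y assume "y \<in> roots (\<gamma> t)"
      then obtain x where "x \<in> R" "y = q x" unfolding im[symmetric] by blast
      then show "\<exists>x\<in>R. dist x y < r" using q by blast
    qed
  qed
  have one: "\<exists>!y. y \<in> roots (\<gamma> t) \<and> dist x y < r" if "x \<in> R" "t \<in> T" for x t
    using main that by blast
  have cover: "\<exists>x\<in>R. dist x y < r" if "y \<in> roots (\<gamma> t)" "t \<in> T" for y t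
    using main that by blast
  define q where "q x t = (THE y. y \<in> roots (\<gamma> t) \<and> dist x y < r)" for x t
  have q: "q x t \<in> roots (\<gamma> t)" "dist x (q x t) < r" if "x \<in> R" "t \<in> T" for x t
    using theI'[OF one[OF that]] by (auto simp: q_def)
  have q_eq: "q x t = y" if "x \<in> R" "t \<in> T" "y \<in> roots (\<gamma> t)" "dist x y < r" for x t y
    using one[OF that(1,2)] q[OF that(1,2)] that(3,4) by blast
  have cont_q: "continuous_on T (q x)" if x: "x \<in> R" for x
  proof (subst continuous_on_iff, intro ballI allI impI)
    fix t1 and \<epsilon> :: real assume t1: "t1 \<in> T" and \<epsilon>: "0 < \<epsilon>"
    define \<rho> where "\<rho> = min \<epsilon> (r - dist x (q x t1))"
    have \<rho>: "0 < \<rho>" using \<epsilon> q(2)[OF x t1] by (simp add: \<rho>_def)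
    define \<phi> where "\<phi> t = norm (coeff (\<gamma> t) N) * \<rho> ^ N - norm (poly (\<gamma> t) (q x t1))" for t
    have "continuous_on T \<phi>"
      unfolding \<phi>_def by (intro continuous_intros continuous_on_subset[OF clc T01]
          continuous_on_subset[OF continuous_on_poly_path[OF \<gamma>] T01])
    then have "(\<phi> \<longlongrightarrow> \<phi> t1) (at t1 within T)"
      using t1 by (simp add: continuous_on_def)
    moreover have "0 < \<phi> t1"
      using q(1)[OF x t1] lc[of t1] t1 T01 \<rho> by (auto simp: roots_def \<phi>_def)
    ultimately have "\<forall>\<^sub>F t in at t1 within T. 0 < \<phi> t"
      by (rule order_tendstoD(1))
    then obtain \<delta> where \<delta>: "0 < \<delta>" "\<And>t. t \<in> T \<Longrightarrow> t \<noteq> t1 \<Longrightarrow> dist t t1 < \<delta> \<Longrightarrow>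
        norm (poly (\<gamma> t) (q x t1)) < norm (coeff (\<gamma> t) N) * \<rho> ^ N"
      unfolding eventually_at \<phi>_def by fastforce
    have "dist (q x t) (q x t1) < \<epsilon>" if t: "t \<in> T" "dist t t1 < \<delta>" for t
    proof (cases "t = t1")
      case False
      have "\<gamma> t \<in> simple_polys N" using poly_path_mem[OF \<gamma>] T01 t(1) by auto
      from root_within_distance[OF this N \<rho> \<delta>(2)[OF t(1) False t(2)]]
      obtain y where y: "y \<in> roots (\<gamma> t)" "dist (q x t1) y < \<rho>" by blast
      have "dist x y < r"
        using dist_triangle[of x y "q x t1"] y(2) by (simp add: \<rho>_def)
      then have "q x t = y" using q_eq x t(1) y(1) by blast
      then show ?thesis using y(2) by (simp add: \<rho>_def dist_commute)
    qed (use \<epsilon> in simp)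
    then show "\<exists>\<delta>>0. \<forall>t\<in>T. dist t t1 < \<delta> \<longrightarrow> dist (q x t) (q x t1) < \<epsilon>"
      using \<delta>(1) by blast
  qed
  define u where "u x = {(t, y). t \<in> T \<and> y \<in> roots (\<gamma> t) \<and> dist x y < r}" for x
  show "\<exists>T. t0 \<in> T \<and> openin (top_of_set {0..1}) T \<and>
      (\<exists>v. \<Union> v = ?E \<inter> fst -` T \<and> (\<forall>u\<in>v. openin (top_of_set ?E) u) \<and>
           pairwise disjnt v \<and> (\<forall>u\<in>v. \<exists>q. homeomorphism u T fst q))"
  proof (intro exI[of _ T] conjI t0T openT exI[of _ "u ` R"])
    show "\<Union> (u ` R) = ?E \<inter> fst -` T"
      using T01 cover by (fastforce simp: u_def)
    show "\<forall>w\<in>u ` R. openin (top_of_set ?E) w"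
    proof (clarify)
      fix x assume "x \<in> R"
      obtain W where W: "open W" "T = {0..1} \<inter> W" using openT by (auto simp: openin_open)
      have "u x = ?E \<inter> (W \<times> ball x r)" using W(2) by (auto simp: u_def)
      then show "openin (top_of_set ?E) (u x)"
        using W(1) by (auto simp: openin_open intro!: open_Times)
    qed
    show "pairwise disjnt (u ` R)"
    proof (clarsimp simp: pairwise_def)
      fix x x' assume *: "x \<in> R" "x' \<in> R" "u x \<noteq> u x'"
      show "disjnt (u x) (u x')"
      proof (rule ccontr)
        assume "\<not> disjnt (u x) (u x')"
        then obtain y where "dist x y < r" "dist x' y < r" by (auto simp: disjnt_def u_def)
        then have "dist x x' < 2 * r" using dist_triangle2[of x x' y] by simp
        then show False using sep[of x x'] * by force
      qed
    qed
    show "\<forall>w\<in>u ` R. \<exists>q. homeomorphism w T fst q"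
    proof clarify
      fix x assume x: "x \<in> R"
      have "homeomorphism (u x) T fst (\<lambda>t. (t, q x t))"
      proof
        show "continuous_on (u x) fst" by (intro continuous_intros)
        show "continuous_on T (\<lambda>t. (t, q x t))" by (intro continuous_intros cont_q x)
      qed (use q x q_eq in \<open>auto simp: u_def\<close>)
      then show "\<exists>q. homeomorphism (u x) T fst q" by blast
    qed
  qed
qed

lemma root_path_exists:
  assumes \<gamma>: "poly_path (simple_polys N) \<gamma>" and N: "0 < N" and x: "x \<in> roots (\<gamma> 0)"
  shows "\<exists>\<rho>. root_path \<gamma> \<rho> \<and> \<rho> 0 = x"
proof -
  let ?E = "{(t, x). t \<in> {0..1} \<and> x \<in> roots (\<gamma> t)}"
  have "path (\<lambda>t::real. t)" "path_image (\<lambda>t::real. t) \<subseteq> {0..1}" "pathstart (\<lambda>t::real. t) = fst (0, x)"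
    by (auto simp: path_def path_image_def pathstart_def)
  from covering_space_lift_path_strong[OF covering_space_root_paths[OF \<gamma> N] _ this]
  obtain h where h: "path h" "path_image h \<subseteq> ?E" "pathstart h = (0, x)"
      "\<And>t. t \<in> {0..1} \<Longrightarrow> fst (h t) = t"
    using x by (metis (no_types, lifting) atLeastAtMost_iff case_prodI mem_Collect_eq order_refl zero_le_one)
  have "root_path \<gamma> (\<lambda>t. snd (h t))"
    unfolding root_path_def
  proof (intro conjI ballI)
    show "path (\<lambda>t. snd (h t))" using h(1) unfolding path_def by (rule continuous_on_snd)
    fix t :: real assume t: "t \<in> {0..1}"
    then have "h t \<in> path_image h" by (simp add: path_image_def)
    then have "h t \<in> ?E" using h(2) by (rule rev_subsetD)
    then show "snd (h t) \<in> roots (\<gamma> t)" using h(4)[OF t] by (simp add: case_prod_beta)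
  qed
  moreover have "snd (h 0) = x" using h(3) by (simp add: pathstart_def)
  ultimately show ?thesis by blast
qed

lemma root_path_unique:
  assumes \<gamma>: "poly_path (simple_polys N) \<gamma>" and N: "0 < N"
    and \<rho>: "root_path \<gamma> \<rho>" "root_path \<gamma> \<rho>'" and eq: "\<rho> s = \<rho>' s" and s: "s \<in> {0..1}" and t: "t \<in> {0..1}"
  shows "\<rho> t = \<rho>' t"
proof -
  have "(t, \<rho> t) = (t, \<rho>' t)"
  proof (rule covering_space_lift_unique[OF covering_space_root_paths[OF \<gamma> N], where a = s
          and f = "\<lambda>t. t" and T = "{0..1}" and ?g1.0 = "\<lambda>t. (t, \<rho> t)" and ?g2.0 = "\<lambda>t. (t, \<rho>' t)"])
    show "continuous_on {0..1} (\<lambda>t. (t, \<rho> t))" "continuous_on {0..1} (\<lambda>t. (t, \<rho>' t))"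
      using \<rho> by (auto simp: root_path_def path_def intro!: continuous_on_Pair continuous_on_id)
  qed (use \<rho> eq s t in \<open>auto simp: root_path_def\<close>)
  then show ?thesis by simp
qed

definition follows :: "(real \<Rightarrow> complex poly) \<Rightarrow> complex \<Rightarrow> complex \<Rightarrow> bool"
  where "follows \<gamma> x y \<longleftrightarrow> (\<exists>\<rho>. root_path \<gamma> \<rho> \<and> \<rho> 0 = x \<and> \<rho> 1 = y)"

lemma follows_unique:
  assumes "poly_path (simple_polys N) \<gamma>" "0 < N" "follows \<gamma> x y" "follows \<gamma> x y'"
  shows "y = y'"
  using assms root_path_unique[of N \<gamma> _ _ 0 1] unfolding follows_def by fastforce

lemma follows_unique_source:
  assumes "poly_path (simple_polys N) \<gamma>" "0 < N" "follows \<gamma> x y" "follows \<gamma> x' y"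
  shows "x = x'"
  using assms root_path_unique[of N \<gamma> _ _ 1 0] unfolding follows_def by fastforce

lemma poly_path_reverse: "poly_path S \<gamma> \<Longrightarrow> poly_path S (\<lambda>t. \<gamma> (1 - t))"
  using path_reversepath[of "\<lambda>t. coeff (\<gamma> t) _"]
  by (fastforce simp: poly_path_def reversepath_def)

lemma follows_reverse: "follows \<gamma> x y \<Longrightarrow> follows (\<lambda>t. \<gamma> (1 - t)) y x"
  unfolding follows_def root_path_def
proof (elim exE conjE)
  fix \<rho> assume \<rho>: "path \<rho>" "\<forall>t\<in>{0..1}. \<rho> t \<in> roots (\<gamma> t)" "\<rho> 0 = x" "\<rho> 1 = y"
  show "\<exists>\<rho>. (path \<rho> \<and> (\<forall>t\<in>{0..1}. \<rho> t \<in> roots (\<gamma> (1 - t)))) \<and> \<rho> 0 = y \<and> \<rho> 1 = x"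
    by (rule exI[of _ "reversepath \<rho>"])
      (use \<rho> path_reversepath[of \<rho>] in \<open>auto simp: reversepath_def\<close>)
qed

text \<open>On each coefficient this is \<open>+++\<close>.\<close>

definition join_polys :: "(real \<Rightarrow> complex poly) \<Rightarrow> (real \<Rightarrow> complex poly) \<Rightarrow> real \<Rightarrow> complex poly"
  where "join_polys \<gamma> \<delta> t = (if t \<le> 1/2 then \<gamma> (2 * t) else \<delta> (2 * t - 1))"

lemma poly_path_join:
  assumes "poly_path S \<gamma>" "poly_path S \<delta>" "\<gamma> 1 = \<delta> 0"
  shows "poly_path S (join_polys \<gamma> \<delta>)"
  unfolding poly_path_def
proof (intro conjI allI)
  fix n
  have "(\<lambda>t. coeff (join_polys \<gamma> \<delta> t) n) = (\<lambda>t. coeff (\<gamma> t) n) +++ (\<lambda>t. coeff (\<delta> t) n)"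
    by (auto simp: join_polys_def joinpaths_def fun_eq_iff)
  moreover have "path ((\<lambda>t. coeff (\<gamma> t) n) +++ (\<lambda>t. coeff (\<delta> t) n))"
    using assms by (intro path_join_imp) (auto simp: poly_path_def pathfinish_def pathstart_def)
  ultimately show "path (\<lambda>t. coeff (join_polys \<gamma> \<delta> t) n)" by simp
  show "join_polys \<gamma> \<delta> ` {0..1} \<subseteq> S"
    using assms(1,2) by (auto simp: poly_path_def join_polys_def)
qed

lemma follows_join:
  assumes "follows \<gamma> x y" "follows \<delta> y z"
  shows "follows (join_polys \<gamma> \<delta>) x z"
proof -
  obtain \<rho> \<tau> where \<rho>: "root_path \<gamma> \<rho>" "\<rho> 0 = x" "\<rho> 1 = y"
    and \<tau>: "root_path \<delta> \<tau>" "\<tau> 0 = y" "\<tau> 1 = z"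
    using assms unfolding follows_def by blast
  have "path (\<rho> +++ \<tau>)"
    using \<rho> \<tau> by (intro path_join_imp) (auto simp: root_path_def pathfinish_def pathstart_def)
  then have "root_path (join_polys \<gamma> \<delta>) (\<rho> +++ \<tau>)"
    using \<rho> \<tau> by (auto simp: root_path_def joinpaths_def join_polys_def)
  then show ?thesis
    unfolding follows_def using \<rho> \<tau> by (intro exI[of _ "\<rho> +++ \<tau>"]) (auto simp: joinpaths_def)
qed

lemma follows_in_roots:
  assumes "follows \<gamma> x y"
  shows "x \<in> roots (\<gamma> 0)" "y \<in> roots (\<gamma> 1)"
  using assms by (auto simp: follows_def root_path_def)

section \<open>Transport of roots\<close>

definition transport ::
  "complex poly set \<Rightarrow> complex poly \<Rightarrow> complex poly \<Rightarrow> (complex \<Rightarrow> complex) \<Rightarrow> bool"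
  where "transport S f g \<sigma> \<longleftrightarrow>
    (\<exists>\<gamma>. poly_path S \<gamma> \<and> \<gamma> 0 = f \<and> \<gamma> 1 = g \<and> (\<forall>x\<in>roots f. follows \<gamma> x (\<sigma> x)))"

lemma transport_cong:
  "transport S f g \<sigma> \<Longrightarrow> (\<And>x. x \<in> roots f \<Longrightarrow> \<tau> x = \<sigma> x) \<Longrightarrow> transport S f g \<tau>"
  by (auto simp: transport_def)

lemma monodromy_carrier:
  "carrier (monodromy_group A f) =
     {\<sigma>. \<sigma> permutes roots f \<and> transport (poly_space A - discriminant A) f f \<sigma>}"
  unfolding monodromy_group_def transport_def poly_loop_def induces_permutation_def
    poly_path_def follows_def root_path_def pathstart_def pathfinish_def
  by auto blast+

lemma transport_along:
  assumes "poly_path S \<gamma>" "S \<subseteq> simple_polys N" "0 < N"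
  shows "\<exists>\<sigma>. transport S (\<gamma> 0) (\<gamma> 1) \<sigma> \<and> (\<forall>x\<in>roots (\<gamma> 0). follows \<gamma> x (\<sigma> x))"
proof -
  have "\<forall>x\<in>roots (\<gamma> 0). \<exists>y. follows \<gamma> x y"
    using root_path_exists[OF poly_path_mono[OF assms(1,2)] assms(3)] by (auto simp: follows_def)
  then obtain \<sigma> where "\<forall>x\<in>roots (\<gamma> 0). follows \<gamma> x (\<sigma> x)" by metis
  then show ?thesis using assms(1) by (auto simp: transport_def)
qed

lemma transport_ends:
  "transport S f g \<sigma> \<Longrightarrow> f \<in> S \<and> g \<in> S"
  by (auto simp: transport_def poly_path_def)

lemma transport_bij:
  assumes tr: "transport S f g \<sigma>" and S: "S \<subseteq> simple_polys N" and N: "0 < N"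
  shows "bij_betw \<sigma> (roots f) (roots g)"
proof -
  obtain \<gamma> where \<gamma>: "poly_path (simple_polys N) \<gamma>" "\<gamma> 0 = f" "\<gamma> 1 = g"
      "\<And>x. x \<in> roots f \<Longrightarrow> follows \<gamma> x (\<sigma> x)"
    using tr poly_path_mono[OF _ S] unfolding transport_def by blast
  have fg: "f \<in> simple_polys N" "g \<in> simple_polys N" using transport_ends[OF tr] S by auto
  have inj: "inj_on \<sigma> (roots f)"
    using follows_unique_source[OF \<gamma>(1) N] \<gamma>(4) by (intro inj_onI) metis
  have "\<sigma> ` roots f \<subseteq> roots g" using \<gamma>(3,4) follows_in_roots(2) by auto
  then have "\<sigma> ` roots f = roots g"
    using inj fg by (intro card_subset_eq finite_roots simple_polys_nonzero[OF fg(2)])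
      (auto simp: card_image card_roots_simple)
  then show ?thesis using inj by (simp add: bij_betw_def)
qed

lemma transport_comp:
  assumes "transport S f g \<sigma>" "transport S g h \<tau>"
  shows "transport S f h (\<tau> \<circ> \<sigma>)"
proof -
  obtain \<gamma> \<delta> where \<gamma>: "poly_path S \<gamma>" "\<gamma> 0 = f" "\<gamma> 1 = g" "\<forall>x\<in>roots f. follows \<gamma> x (\<sigma> x)"
    and \<delta>: "poly_path S \<delta>" "\<delta> 0 = g" "\<delta> 1 = h" "\<forall>x\<in>roots g. follows \<delta> x (\<tau> x)"
    using assms unfolding transport_def by blast
  have "follows (join_polys \<gamma> \<delta>) x (\<tau> (\<sigma> x))" if "x \<in> roots f" for x
    using \<gamma> \<delta> that follows_in_roots(2) by (intro follows_join[of _ _ "\<sigma> x"]) blast+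
  then show ?thesis
    unfolding transport_def using \<gamma> \<delta> poly_path_join[OF \<gamma>(1) \<delta>(1)]
    by (intro exI[of _ "join_polys \<gamma> \<delta>"]) (auto simp: join_polys_def)
qed

lemma transport_inverse:
  assumes tr: "transport S f g \<sigma>" and S: "S \<subseteq> simple_polys N" and N: "0 < N"
    and inv: "\<And>x. x \<in> roots f \<Longrightarrow> \<tau> (\<sigma> x) = x"
  shows "transport S g f \<tau>"
proof -
  obtain \<gamma> where \<gamma>: "poly_path S \<gamma>" "\<gamma> 0 = f" "\<gamma> 1 = g" "\<forall>x\<in>roots f. follows \<gamma> x (\<sigma> x)"
    using tr unfolding transport_def by blast
  have "follows (\<lambda>t. \<gamma> (1 - t)) y (\<tau> y)" if "y \<in> roots g" for y
  proof -
    have "y \<in> \<sigma> ` roots f"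
      using transport_bij[OF tr S N] that by (simp add: bij_betw_def)
    then obtain x where "x \<in> roots f" "y = \<sigma> x" by blast
    then show ?thesis using follows_reverse[of \<gamma> x "\<sigma> x"] \<gamma>(4) inv by auto
  qed
  then show ?thesis
    unfolding transport_def using poly_path_reverse[OF \<gamma>(1)] \<gamma>
    by (intro exI[of _ "\<lambda>t. \<gamma> (1 - t)"]) auto
qed

text \<open>
  A symmetry of the root sets of all polynomials in \<open>S\<close> carries root paths to root paths, so by
  uniqueness it commutes with transport.
\<close>

lemma transport_commutes_mult:
  assumes tr: "transport S f g \<sigma>" and S: "S \<subseteq> simple_polys N" and N: "0 < N"
    and sym: "\<And>h x. h \<in> S \<Longrightarrow> x \<in> roots h \<Longrightarrow> c * x \<in> roots h"
    and x: "x \<in> roots f"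
  shows "\<sigma> (c * x) = c * \<sigma> x"
proof -
  obtain \<gamma> where \<gamma>: "poly_path S \<gamma>" "\<gamma> 0 = f" "\<gamma> 1 = g" "\<forall>x\<in>roots f. follows \<gamma> x (\<sigma> x)"
    using tr unfolding transport_def by blast
  obtain \<rho> where \<rho>: "root_path \<gamma> \<rho>" "\<rho> 0 = x" "\<rho> 1 = \<sigma> x"
    using \<gamma>(4) x unfolding follows_def by blast
  have "root_path \<gamma> (\<lambda>t. c * \<rho> t)"
    using \<rho>(1) sym poly_path_mem[OF \<gamma>(1)]
    by (auto simp: root_path_def path_def intro: continuous_on_mult_left)
  then have "follows \<gamma> (c * x) (c * \<sigma> x)"
    using \<rho> unfolding follows_def by (intro exI[of _ "\<lambda>t. c * \<rho> t"]) auto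
  moreover have "follows \<gamma> (c * x) (\<sigma> (c * x))"
    using \<gamma>(4) sym[of f x] transport_ends[OF tr] x by blast
  ultimately show ?thesis
    using follows_unique[OF poly_path_mono[OF \<gamma>(1) S] N] by blast
qed

section \<open>Connectedness of the space of polynomials with simple roots\<close>

text \<open>
  If \<open>x\<close> is a multiple root of \<open>f + z x^m\<close>, then eliminating \<open>z\<close> gives \<open>x f'(x) = m f(x)\<close>, an equation
  with finitely many solutions, and each solution determines \<open>z\<close>. So on a line parallel to a
  coordinate axis only finitely many polynomials are degenerate. For \<open>m > 0\<close> a root at \<open>0\<close> has to be
  excluded, as it would be a root for all \<open>z\<close>.
\<close>

lemma finite_degenerate_on_line:
  assumes deg: "degree f = N" and N: "0 < N" and m: "m \<le> N" and c0: "m = 0 \<or> coeff f 0 \<noteq> 0"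
  shows "finite {z. f + monom z m \<notin> simple_polys N}"
proof -
  define W where "W = pCons 0 (pderiv f) - smult (of_nat m) f"
  have coeffW: "coeff W i = (of_nat i - of_nat m) * coeff f i" for i
    by (cases i) (simp_all add: W_def coeff_pderiv algebra_simps)
  have "coeff W (if m = 0 then N else 0) \<noteq> 0"
    using c0 deg N by (auto simp: coeffW)
  then have "W \<noteq> 0" by auto
  then have fin: "finite {x. poly W x = 0}" by (rule poly_roots_finite)
  have "z \<in> insert (- coeff f N) ((\<lambda>x. - poly f x / x ^ m) ` {x. poly W x = 0})"
    if z: "f + monom z m \<notin> simple_polys N" for z
  proof (cases "coeff (f + monom z m) N = 0")
    case True
    moreover have "coeff f N \<noteq> 0" using deg N by auto
    ultimately have "z = - coeff f N" by (auto simp: add_eq_0_iff split: if_splits)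
    then show ?thesis by simp
  next
    case False
    have "degree (f + monom z m) \<le> N"
      using deg m degree_monom_le[of z m] by (intro degree_add_le) auto
    then have "degree (f + monom z m) = N" using False by (intro antisym le_degree)
    then obtain x where "poly (f + monom z m) x = 0" "poly (pderiv (f + monom z m)) x = 0"
      using z unfolding simple_polys_iff by blast
    then have x: "poly f x + z * x ^ m = 0" "poly (pderiv f) x + z * of_nat m * x ^ (m - 1) = 0"
      by (simp_all add: poly_monom pderiv_add pderiv_monom mult_ac)
    have "x * poly (pderiv f) x + of_nat m * (z * x ^ m) =
        x * (poly (pderiv f) x + z * of_nat m * x ^ (m - 1))"
      by (cases m) (simp_all add: algebra_simps)
    moreover have "z * x ^ m = - poly f x" using x(1) by (simp add: eq_neg_iff_add_eq_0 add.commute)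
    ultimately have "poly W x = 0" using x(2) by (simp add: W_def)
    moreover have "x ^ m \<noteq> 0" using c0 x(1) by (cases "m = 0") (auto simp: poly_0_coeff_0 zero_power)
    then have "z = - poly f x / x ^ m" using \<open>z * x ^ m = - poly f x\<close> by (simp add: field_simps)
    ultimately show ?thesis by blast
  qed
  then have "{z. f + monom z m \<notin> simple_polys N} \<subseteq>
      insert (- coeff f N) ((\<lambda>x. - poly f x / x ^ m) ` {x. poly W x = 0})" by blast
  then show ?thesis using fin finite_subset by fastforce
qed

lemma simple_polys_lead_coeff: "f \<in> simple_polys N \<Longrightarrow> coeff f N \<noteq> 0"
  by (auto simp: simple_polys_def rsquarefree_def)

lemma poly_space_add_monom:
  "f \<in> poly_space A \<Longrightarrow> m \<in> A \<Longrightarrow> f + monom z m \<in> poly_space A"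
  by (auto simp: poly_space_def)

lemma transport_line:
  assumes f: "f \<in> poly_space A \<inter> simple_polys N" and N: "0 < N"
    and g: "f + monom z m \<in> poly_space A \<inter> simple_polys N"
    and m: "m \<in> A" "m \<le> N" "m = 0 \<or> coeff f 0 \<noteq> 0"
  shows "\<exists>\<sigma>. transport (poly_space A \<inter> simple_polys N) f (f + monom z m) \<sigma>"
proof -
  let ?S = "poly_space A \<inter> simple_polys N"
  define B where "B = {z. f + monom z m \<notin> simple_polys N}"
  have "finite B"
    using finite_degenerate_on_line[OF _ N m(2,3)] f by (auto simp: B_def simple_polys_def)
  then have "path_connected (- B)"
    by (intro path_connected_complement_countable countable_finite) auto
  moreover have "0 \<in> - B" "z \<in> - B" using f g by (auto simp: B_def)
  ultimately obtain c where c: "path c" "path_image c \<subseteq> - B" "pathstart c = 0" "pathfinish c = z"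
    unfolding path_connected_def by blast
  define \<gamma> where "\<gamma> t = f + monom (c t) m" for t
  have "poly_path ?S \<gamma>"
    unfolding poly_path_def
  proof (intro conjI allI)
    fix i
    have "(\<lambda>t. coeff (\<gamma> t) i) = (\<lambda>t. coeff f i + (if i = m then c t else 0))"
      by (auto simp: \<gamma>_def)
    moreover have "continuous_on {0..1} (\<lambda>t. coeff f i + (if i = m then c t else 0))"
      using c(1) by (cases "i = m") (auto simp: path_def intro: continuous_on_add)
    ultimately show "path (\<lambda>t. coeff (\<gamma> t) i)" by (simp add: path_def)
    have "c t \<notin> B" if "t \<in> {0..1}" for t
      using c(2) that unfolding path_image_def by blast
    then show "\<gamma> ` {0..1} \<subseteq> ?S"
      using f m(1) poly_space_add_monom by (auto simp: \<gamma>_def B_def)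
  qed
  then obtain \<sigma> where "transport ?S (\<gamma> 0) (\<gamma> 1) \<sigma>"
    using transport_along[of ?S \<gamma> N] N by blast
  moreover have "\<gamma> 0 = f" "\<gamma> 1 = f + monom z m"
    using c by (auto simp: \<gamma>_def pathstart_def pathfinish_def)
  ultimately show ?thesis by auto
qed

text \<open>
  Coefficients are changed one at a time. Before each change of a non-constant coefficient the
  constant term is moved to a value at which the polynomials before and after the change are
  both non-degenerate and do not vanish at \<open>0\<close>.
\<close>

lemma transport_exists:
  assumes A: "finite A" "0 \<in> A" and N: "Max A = N" "0 < N"
    and f: "f \<in> poly_space A \<inter> simple_polys N" and g: "g \<in> poly_space A \<inter> simple_polys N"
  shows "\<exists>\<sigma>. transport (poly_space A \<inter> simple_polys N) f g \<sigma>"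
  using f
proof (induction "card {i. 0 < i \<and> coeff f i \<noteq> coeff g i}" arbitrary: f rule: less_induct)
  case less
  let ?S = "poly_space A \<inter> simple_polys N"
  let ?D = "\<lambda>f. {i. 0 < i \<and> coeff f i \<noteq> coeff g i}"
  have subA: "?D h \<subseteq> A" if "h \<in> poly_space A" for h
    using that g by (auto simp: poly_space_def) metis
  have leN: "i \<le> N" if "i \<in> A" for i using A N that by auto
  have deg_le: "degree h \<le> N" if "h \<in> poly_space A" for h
    using degree_poly_space[OF A(1) _ that] A(2) N by auto
  show ?case
  proof (cases "?D f = {}")
    case True
    have "g = f + monom (coeff g 0 - coeff f 0) 0"
    proof (rule poly_eqI)
      fix i show "coeff g i = coeff (f + monom (coeff g 0 - coeff f 0) 0) i"
        using True by (cases "i = 0") (auto dest: spec[of _ i])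
    qed
    then show ?thesis
      using transport_line[OF less.prems N(2), of "coeff g 0 - coeff f 0" 0] g A(2) by simp
  next
    case False
    then obtain m where m: "0 < m" "coeff f m \<noteq> coeff g m" by blast
    then have mA: "m \<in> A" using subA[of f] less.prems by blast
    define h where "h = f + monom (coeff g m - coeff f m) m"
    have hA: "h \<in> poly_space A" unfolding h_def using less.prems mA by (intro poly_space_add_monom) auto
    have "coeff g N \<noteq> 0" "coeff f N \<noteq> 0"
      using less.prems g simple_polys_lead_coeff by blast+
    then have "coeff h N \<noteq> 0" by (auto simp: h_def)
    then have degh: "degree h = N" using deg_le[OF hA] le_degree[of h N] by simp
    have degf: "degree f = N" using less.prems by (auto simp: simple_polys_def)
    define B where "B = {z. f + monom z 0 \<notin> simple_polys N} \<union> {z. h + monom z 0 \<notin> simple_polys N}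
      \<union> {- coeff f 0}"
    have "finite B"
      unfolding B_def using finite_degenerate_on_line[OF degf N(2), of 0]
        finite_degenerate_on_line[OF degh N(2), of 0] by simp
    then obtain z where z: "z \<notin> B" using ex_new_if_finite[OF infinite_UNIV_char_0] by blast
    have fz: "f + monom z 0 \<in> ?S" using z less.prems A(2) poly_space_add_monom by (auto simp: B_def)
    have hz: "h + monom z 0 \<in> ?S" using z hA A(2) poly_space_add_monom by (auto simp: B_def)
    have c0: "coeff (f + monom z 0) 0 \<noteq> 0" using z by (auto simp: B_def eq_neg_iff_add_eq_0 add.commute)
    obtain \<sigma>1 where 1: "transport ?S f (f + monom z 0) \<sigma>1"
      using transport_line[OF less.prems N(2) fz A(2)] by auto
    have eq: "h + monom z 0 = (f + monom z 0) + monom (coeff g m - coeff f m) m"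
      by (simp add: h_def)
    obtain \<sigma>2 where 2: "transport ?S (f + monom z 0) (h + monom z 0) \<sigma>2"
      using transport_line[OF fz N(2) _ mA leN[OF mA] disjI2[OF c0]] hz eq by metis
    have "?D (h + monom z 0) \<subset> ?D f"
      using m by (auto simp: h_def split: if_splits)
    moreover have "finite (?D f)" using subA[of f] less.prems A(1) finite_subset by blast
    ultimately have "card (?D (h + monom z 0)) < card (?D f)" by (rule psubset_card_mono[rotated])
    then obtain \<sigma>3 where 3: "transport ?S (h + monom z 0) g \<sigma>3"
      using less.hyps[OF _ hz] by blast
    show ?thesis using transport_comp[OF transport_comp[OF 1 2] 3] by blast
  qed
qed

section \<open>Roots of small perturbations\<close>

lemma norm_poly_le:
  fixes q :: "complex poly"
  assumes "degree q \<le> N"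
  shows "norm (poly q x) \<le> (\<Sum>i\<le>degree q. norm (coeff q i)) * (1 + norm x) ^ N"
proof -
  have "norm (poly q x) \<le> (\<Sum>i\<le>degree q. norm (coeff q i) * norm x ^ i)"
    unfolding poly_altdef by (rule order_trans[OF norm_sum]) (simp add: norm_mult norm_power)
  also have "\<dots> \<le> (\<Sum>i\<le>degree q. norm (coeff q i) * (1 + norm x) ^ N)"
  proof (intro sum_mono mult_left_mono)
    fix i assume "i \<in> {..degree q}"
    have "norm x ^ i \<le> (1 + norm x) ^ i" by (intro power_mono) auto
    also have "\<dots> \<le> (1 + norm x) ^ N"
      using \<open>i \<in> _\<close> assms by (intro power_increasing) auto
    finally show "norm x ^ i \<le> (1 + norm x) ^ N" .
  qed simp
  finally show ?thesis by (simp add: sum_distrib_right)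
qed

text \<open>
  Away from its roots, \<open>f\<close> dominates every polynomial of at most the same degree, uniformly on the
  plane, since each linear factor of \<open>f\<close> dominates \<open>1 + |x|\<close>.
\<close>

lemma dominates_away_from_roots:
  fixes f q :: "complex poly"
  assumes f: "f \<noteq> 0" and deg: "degree q \<le> degree f" and r: "0 < r"
  shows "\<exists>C>0. \<forall>x. (\<forall>y\<in>roots f. r \<le> dist x y) \<longrightarrow> norm (poly q x) \<le> C * norm (poly f x)"
proof -
  obtain z where z: "smult (lead_coeff f) (\<Prod>i<degree f. [:- z i, 1:]) = f"
    using complex_poly_decompose' by blast
  have root: "z i \<in> roots f" if "i < degree f" for i
    by (subst z[symmetric]) (use that in \<open>auto simp: roots_def poly_prod\<close>)
  define R where "R = (\<Sum>i<degree f. norm (z i))"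
  define K where "K = (1 + R) / r + 1"
  define c where "c = (\<Sum>i\<le>degree q. norm (coeff q i))"
  have nonneg: "0 \<le> R" "0 \<le> c" by (auto simp: R_def c_def intro: sum_nonneg)
  then have K: "0 < K" using r by (simp add: K_def add_nonneg_pos)
  have lc: "0 < norm (lead_coeff f)" using f by simp
  have bound: "norm (poly q x) \<le> c * K ^ degree f / norm (lead_coeff f) * norm (poly f x)"
    if far: "\<forall>y\<in>roots f. r \<le> dist x y" for x
  proof -
    have factor: "1 + norm x \<le> K * norm (x - z i)" if i: "i < degree f" for i
    proof -
      have d: "r \<le> norm (x - z i)" using far root[OF i] by (simp add: dist_norm)
      have "norm (z i) \<le> R" unfolding R_def using i by (intro member_le_sum) auto
      moreover have "norm x \<le> norm (z i) + norm (x - z i)" by (rule norm_triangle_sub)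
      moreover have "(1 + R) / r * r \<le> (1 + R) / r * norm (x - z i)"
        using d r nonneg by (intro mult_left_mono) auto
      moreover have "(1 + R) / r * r = 1 + R" using r by simp
      ultimately show ?thesis unfolding K_def distrib_right mult_1 by linarith
    qed
    have "(1 + norm x) ^ degree f = (\<Prod>i<degree f. 1 + norm x)" by simp
    also have "\<dots> \<le> (\<Prod>i<degree f. K * norm (x - z i))"
      using factor by (intro prod_mono) auto
    also have "\<dots> = K ^ degree f * (\<Prod>i<degree f. norm (x - z i))" by (simp add: prod.distrib)
    finally have pow: "(1 + norm x) ^ degree f \<le> K ^ degree f * (\<Prod>i<degree f. norm (x - z i))" .
    have "norm (poly f x) = norm (poly (smult (lead_coeff f) (\<Prod>i<degree f. [:- z i, 1:])) x)"
      using z by simp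
    also have "\<dots> = norm (lead_coeff f) * (\<Prod>i<degree f. norm (x - z i))"
      by (simp add: poly_prod norm_mult prod_norm)
    finally have val: "norm (poly f x) = norm (lead_coeff f) * (\<Prod>i<degree f. norm (x - z i))" .
    have "norm (poly q x) \<le> c * (1 + norm x) ^ degree f"
      unfolding c_def by (rule norm_poly_le[OF deg])
    also have "\<dots> \<le> c * (K ^ degree f * (\<Prod>i<degree f. norm (x - z i)))"
      using pow nonneg by (intro mult_left_mono) auto
    also have "\<dots> = c * K ^ degree f / norm (lead_coeff f) * norm (poly f x)"
      using lc by (simp add: val)
    finally show ?thesis .
  qed
  have "norm (poly q x) \<le> (c * K ^ degree f / norm (lead_coeff f) + 1) * norm (poly f x)"
    if "\<forall>y\<in>roots f. r \<le> dist x y" for x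
    using bound[OF that] norm_ge_zero[of "poly f x"] unfolding distrib_right mult_1 by linarith
  moreover have "0 < c * K ^ degree f / norm (lead_coeff f) + 1"
    using nonneg K lc by (intro add_nonneg_pos divide_nonneg_pos mult_nonneg_nonneg) auto
  ultimately show ?thesis by blast
qed

lemma roots_of_perturbation_near:
  fixes f q1 q2 :: "complex poly"
  assumes f: "f \<noteq> 0" and deg: "degree q1 \<le> degree f" "degree q2 \<le> degree f" and r: "0 < r"
  shows "\<exists>\<epsilon>>0. \<forall>U V x. norm U \<le> \<epsilon> \<longrightarrow> norm V \<le> \<epsilon> \<longrightarrow> poly (f + smult U q1 + smult V q2) x = 0
    \<longrightarrow> (\<exists>y\<in>roots f. dist x y < r)"
proof -
  obtain C1 where C1: "0 < C1" "\<And>x. \<forall>y\<in>roots f. r \<le> dist x y \<Longrightarrow> norm (poly q1 x) \<le> C1 * norm (poly f x)"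
    using dominates_away_from_roots[OF f deg(1) r] by blast
  obtain C2 where C2: "0 < C2" "\<And>x. \<forall>y\<in>roots f. r \<le> dist x y \<Longrightarrow> norm (poly q2 x) \<le> C2 * norm (poly f x)"
    using dominates_away_from_roots[OF f deg(2) r] by blast
  define \<epsilon> where "\<epsilon> = 1 / (2 * (C1 + C2))"
  have \<epsilon>: "0 < \<epsilon>" and half: "\<epsilon> * (C1 + C2) = 1 / 2" using C1(1) C2(1) by (auto simp: \<epsilon>_def)
  have "\<exists>y\<in>roots f. dist x y < r"
    if small: "norm U \<le> \<epsilon>" "norm V \<le> \<epsilon>" and root: "poly (f + smult U q1 + smult V q2) x = 0" for U V x
  proof (rule ccontr)
    assume "\<not> ?thesis"
    then have far: "\<forall>y\<in>roots f. r \<le> dist x y" by (auto simp: not_less)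
    then have "0 < norm (poly f x)" using r by (fastforce simp: roots_def)
    have "poly f x = - (U * poly q1 x + V * poly q2 x)"
      using root unfolding eq_neg_iff_add_eq_0 by (simp add: add.assoc)
    then have "norm (poly f x) \<le> norm U * norm (poly q1 x) + norm V * norm (poly q2 x)"
      by (metis norm_minus_cancel norm_mult norm_triangle_ineq)
    also have "\<dots> \<le> \<epsilon> * (C1 * norm (poly f x)) + \<epsilon> * (C2 * norm (poly f x))"
      using small C1(2)[OF far] C2(2)[OF far] \<epsilon> by (intro add_mono mult_mono) auto
    also have "\<dots> = (\<epsilon> * (C1 + C2)) * norm (poly f x)" by (simp add: algebra_simps)
    also have "\<dots> = norm (poly f x) / 2" unfolding half by simp
    finally show False using \<open>0 < norm (poly f x)\<close> by simp
  qed
  then show ?thesis using \<epsilon> by blast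
qed

lemma ddiff_bounded:
  "\<exists>C>0. \<forall>x\<in>cball \<xi> 1. \<forall>y\<in>cball \<xi> 1. norm (ddiff p x y) \<le> C"
proof -
  have "continuous_on (cball \<xi> 1 \<times> cball \<xi> 1) (\<lambda>z. ddiff p (fst z) (snd z))"
    by (intro continuous_ddiff continuous_on_fst continuous_on_snd continuous_on_id)
  then have "compact ((\<lambda>z. ddiff p (fst z) (snd z)) ` (cball \<xi> 1 \<times> cball \<xi> 1))"
    by (intro compact_continuous_image compact_Times compact_cball)
  then have "bounded ((\<lambda>z. ddiff p (fst z) (snd z)) ` (cball \<xi> 1 \<times> cball \<xi> 1))"
    by (rule compact_imp_bounded)
  then obtain C where C: "0 < C" "\<And>z. z \<in> cball \<xi> 1 \<times> cball \<xi> 1 \<Longrightarrow> norm (ddiff p (fst z) (snd z)) \<le> C"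
    unfolding bounded_pos by blast
  have "norm (ddiff p x y) \<le> C" if "x \<in> cball \<xi> 1" "y \<in> cball \<xi> 1" for x y
    using C(2)[of "(x, y)"] that by simp
  then show ?thesis using C(1) by blast
qed

lemma poly_close:
  fixes p :: "complex poly"
  assumes "0 < \<delta>"
  shows "\<exists>r>0. \<forall>x\<in>ball \<xi> r. norm (poly p x - poly p \<xi>) < \<delta>"
proof -
  have "isCont (poly p) \<xi>" by simp
  then obtain r where "0 < r" "\<forall>x. dist x \<xi> < r \<longrightarrow> dist (poly p x) (poly p \<xi>) < \<delta>"
    using assms unfolding continuous_at_eps_delta by (metis dist_norm)
  then show ?thesis by (auto simp: dist_norm norm_minus_commute intro!: exI[of _ r])
qed

definition univalent_on :: "complex poly \<Rightarrow> complex set \<Rightarrow> bool"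
  where "univalent_on F B \<longleftrightarrow> inj_on (poly F) B \<and> (\<forall>x\<in>B. poly (pderiv F) x \<noteq> 0)"

lemma univalent_on_subset: "univalent_on F B \<Longrightarrow> C \<subseteq> B \<Longrightarrow> univalent_on F C"
  unfolding univalent_on_def using inj_on_subset by blast

text \<open>
  Near a simple root the divided difference of \<open>f\<close> is bounded away from zero, and this persists under
  small perturbations. It excludes both a second root and a multiple root.
\<close>

lemma simple_root_persists:
  fixes f q1 q2 :: "complex poly"
  assumes simple: "poly (pderiv f) y \<noteq> 0"
  shows "\<exists>r>0. \<exists>\<epsilon>>0. \<forall>U V. norm U \<le> \<epsilon> \<longrightarrow> norm V \<le> \<epsilon> \<longrightarrow>
    univalent_on (f + smult U q1 + smult V q2) (ball y r)"
proof -
  define c where "c = norm (ddiff f y y)"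
  have c: "0 < c" using simple by (simp add: c_def ddiff_self)
  have "continuous_on UNIV (\<lambda>z. ddiff f (fst z) (snd z))"
    by (intro continuous_ddiff continuous_on_fst continuous_on_snd continuous_on_id)
  then have "isCont (\<lambda>z. ddiff f (fst z) (snd z)) (y, y)"
    by (simp add: continuous_on_eq_continuous_at)
  then obtain s where s: "0 < s" "\<And>z. dist z (y, y) < s \<Longrightarrow>
      dist (ddiff f (fst z) (snd z)) (ddiff f y y) < c / 2"
    using c unfolding continuous_at_eps_delta by (metis fst_conv half_gt_zero snd_conv)
  obtain C1 where C1: "0 < C1" "\<And>x x'. x \<in> cball y 1 \<Longrightarrow> x' \<in> cball y 1 \<Longrightarrow> norm (ddiff q1 x x') \<le> C1"
    using ddiff_bounded by blast
  obtain C2 where C2: "0 < C2" "\<And>x x'. x \<in> cball y 1 \<Longrightarrow> x' \<in> cball y 1 \<Longrightarrow> norm (ddiff q2 x x') \<le> C2"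
    using ddiff_bounded by blast
  define r where "r = min 1 (s / 2)"
  define \<epsilon> where "\<epsilon> = c / (4 * (C1 + C2))"
  have r: "0 < r" using s(1) by (simp add: r_def)
  have "c / (4 * S) * S = c / 4" if "0 < S" for S using that by simp
  moreover have S: "0 < C1 + C2" using C1(1) C2(1) by simp
  ultimately have quarter: "\<epsilon> * (C1 + C2) = c / 4" by (simp only: \<epsilon>_def)
  have \<epsilon>: "0 < \<epsilon>" unfolding \<epsilon>_def using c S by (intro divide_pos_pos) auto
  have "univalent_on (f + smult U q1 + smult V q2) (ball y r)"
    if small: "norm U \<le> \<epsilon>" "norm V \<le> \<epsilon>" for U V
  proof -
    let ?D = "\<lambda>x x'. ddiff f x x' + U * ddiff q1 x x' + V * ddiff q2 x x'"
    have nonzero: "?D x x' \<noteq> 0" if "x \<in> ball y r" "x' \<in> ball y r" for x x'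
    proof
      assume zero: "?D x x' = 0"
      have "dist (x, x') (y, y) \<le> dist x y + dist x' y"
        by (simp add: dist_Pair_Pair sqrt_sum_squares_le_sum)
      also have "\<dots> < s" using that by (simp add: r_def dist_commute)
      finally have "norm (ddiff f y y) - norm (ddiff f x x') < c / 2"
        using s(2)[of "(x, x')"] norm_triangle_ineq2[of "ddiff f y y" "ddiff f x x'"]
        by (simp add: dist_norm norm_minus_commute)
      then have "c / 2 < norm (ddiff f x x')" by (simp add: c_def)
      also have "ddiff f x x' = - (U * ddiff q1 x x' + V * ddiff q2 x x')"
        using zero unfolding eq_neg_iff_add_eq_0 by (simp add: add.assoc)
      also have "norm \<dots> \<le> norm U * norm (ddiff q1 x x') + norm V * norm (ddiff q2 x x')"
        by (metis norm_minus_cancel norm_mult norm_triangle_ineq)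
      also have "\<dots> \<le> \<epsilon> * C1 + \<epsilon> * C2"
        using small \<epsilon> C1(2)[of x x'] C2(2)[of x x'] that by (intro add_mono mult_mono) (auto simp: r_def)
      also have "\<dots> = \<epsilon> * (C1 + C2)" by (simp add: algebra_simps)
      also have "\<dots> = c / 4" by (rule quarter)
      finally show False using c by simp
    qed
    let ?F = "f + smult U q1 + smult V q2"
    have "poly ?F x - poly ?F x' = (x - x') * ?D x x'" for x x'
    proof -
      have "poly ?F x - poly ?F x' = (poly f x - poly f x') + U * (poly q1 x - poly q1 x') + V * (poly q2 x - poly q2 x')"
        by (simp add: algebra_simps)
      also have "\<dots> = (x - x') * ?D x x'"
        unfolding poly_diff_eq_ddiff by (simp add: algebra_simps)
      finally show ?thesis .
    qed
    then have "inj_on (poly ?F) (ball y r)"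
      using nonzero by (intro inj_onI) (metis eq_iff_diff_eq_0 mult_eq_0_iff)
    moreover have "poly (pderiv ?F) x = ?D x x" for x
      by (simp add: pderiv_add pderiv_smult ddiff_self)
    ultimately show ?thesis using nonzero by (simp add: univalent_on_def)
  qed
  then show ?thesis using r \<epsilon> by blast
qed

lemma norm_le_norm_add:
  assumes "0 \<le> Re (a * cnj b)"
  shows "norm b \<le> norm (a + b)"
proof -
  have "norm (a + b) ^ 2 = norm b ^ 2 + (Re a * Re a + Im a * Im a) + 2 * Re (a * cnj b)"
    by (simp add: cmod_power2) algebra
  moreover have "0 \<le> Re a * Re a" "0 \<le> Im a * Im a" by simp_all
  ultimately have "norm b ^ 2 \<le> norm (a + b) ^ 2" using assms by linarith
  then show ?thesis by (rule power2_le_imp_le) simp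
qed

text \<open>
  In the disc of radius \<open>r\<close> around \<open>\<xi>\<close> the roots of \<open>F\<close> are simple, lie close to the two points
  \<open>\<xi> \<plusminus> sqrt (- \<epsilon> c / h)\<close>, and are determined by their direction from \<open>\<xi>\<close> up to a right angle.
\<close>

definition splits :: "complex \<Rightarrow> complex \<Rightarrow> real \<Rightarrow> real \<Rightarrow> real \<Rightarrow> complex \<Rightarrow> complex poly \<Rightarrow> bool"
  where "splits \<xi> h r \<epsilon> \<eta> c F \<longleftrightarrow> (\<forall>x\<in>roots F \<inter> ball \<xi> r.
    norm (h * (x - \<xi>)\<^sup>2 + of_real \<epsilon> * c) \<le> \<epsilon> * \<eta> \<and> poly (pderiv F) x \<noteq> 0 \<and>
    (\<forall>x'\<in>roots F \<inter> ball \<xi> r. 0 \<le> Re ((x - \<xi>) * cnj (x' - \<xi>)) \<longrightarrow> x = x'))"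

lemma splits_mono: "splits \<xi> h r \<epsilon> \<eta> c F \<Longrightarrow> r' \<le> r \<Longrightarrow> splits \<xi> h r' \<epsilon> \<eta> c F"
  unfolding splits_def by auto

text \<open>
  Near a double root \<open>\<xi>\<close> one has \<open>f = (x - \<xi>)^2 K\<close> with \<open>h = K(\<xi>) \<noteq> 0\<close>, so the roots of \<open>f + \<epsilon> q\<close> satisfy
  \<open>(x - \<xi>)^2 \<approx> -\<epsilon> q(\<xi>) / h\<close>. If two roots satisfy this with displacements from \<open>\<xi>\<close> that enclose at
  most a right angle, the divided difference at the two roots is dominated by \<open>K\<close> times the sum of
  the displacements, hence nonzero, and so the roots coincide. The same estimate shows that the
  roots are simple. The constants depend only on bounds for \<open>u\<close>, \<open>v\<close> and \<open>1/q(\<xi>)\<close>.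
\<close>

lemma double_root_splits:
  fixes f K q1 q2 :: "complex poly"
  assumes f: "f = [:- \<xi>, 1:]\<^sup>2 * K" and h: "poly K \<xi> \<noteq> 0"
    and M: "0 < M" and \<mu>: "0 < \<mu>" and \<eta>: "0 < \<eta>"
  shows "\<exists>r>0. \<forall>u v \<epsilon>. norm u \<le> M \<longrightarrow> norm v \<le> M \<longrightarrow> 0 < \<epsilon> \<longrightarrow>
    \<mu> \<le> norm (u * poly q1 \<xi> + v * poly q2 \<xi>) \<longrightarrow>
    splits \<xi> (poly K \<xi>) r \<epsilon> \<eta> (u * poly q1 \<xi> + v * poly q2 \<xi>)
      (f + smult (of_real \<epsilon> * u) q1 + smult (of_real \<epsilon> * v) q2)"
proof -
  define h where "h = poly K \<xi>"
  have h: "0 < norm h" using h by (simp add: h_def)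
  define \<eta>' where "\<eta>' = min \<eta> (\<mu> / 2)"
  have \<eta>': "0 < \<eta>'" "\<eta>' \<le> \<eta>" "\<eta>' \<le> \<mu> / 2" using \<eta> \<mu> by (auto simp: \<eta>'_def)
  define Q where "Q = M * (norm (poly q1 \<xi>) + norm (poly q2 \<xi>) + 2)"
  have Q: "0 < Q" using M by (simp add: Q_def add_nonneg_pos)
  define \<delta>1 where "\<delta>1 = min (1/2) (\<eta>' / (4 * Q)) * norm h"
  define \<delta>2 where "\<delta>2 = min 1 (\<eta>' / (4 * M))"
  have \<delta>: "0 < \<delta>1" "0 < \<delta>2" "\<delta>1 \<le> norm h / 2" "\<delta>1 \<le> \<eta>' / (4 * Q) * norm h"
      "\<delta>2 \<le> 1" "\<delta>2 \<le> \<eta>' / (4 * M)"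
    using h \<eta>' Q M by (auto simp: \<delta>1_def \<delta>2_def min_mult_distrib_right)
  obtain CK where CK: "0 < CK" "\<And>x x'. x \<in> cball \<xi> 1 \<Longrightarrow> x' \<in> cball \<xi> 1 \<Longrightarrow> norm (ddiff K x x') \<le> CK"
    using ddiff_bounded by blast
  obtain C1 where C1: "0 < C1" "\<And>x x'. x \<in> cball \<xi> 1 \<Longrightarrow> x' \<in> cball \<xi> 1 \<Longrightarrow> norm (ddiff q1 x x') \<le> C1"
    using ddiff_bounded by blast
  obtain C2 where C2: "0 < C2" "\<And>x x'. x \<in> cball \<xi> 1 \<Longrightarrow> x' \<in> cball \<xi> 1 \<Longrightarrow> norm (ddiff q2 x x') \<le> C2"
    using ddiff_bounded by blast
  define C where "C = CK + 2 * norm h / \<mu> * (M * (C1 + C2))"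
  have C: "0 < C" using CK(1) C1(1) C2(1) h \<mu> M by (simp add: C_def add_pos_nonneg)
  obtain rK where rK: "0 < rK" "\<And>x. x \<in> ball \<xi> rK \<Longrightarrow> norm (poly K x - h) < \<delta>1"
    using poly_close[OF \<delta>(1)] unfolding h_def by blast
  obtain r1 where r1: "0 < r1" "\<And>x. x \<in> ball \<xi> r1 \<Longrightarrow> norm (poly q1 x - poly q1 \<xi>) < \<delta>2"
    using poly_close[OF \<delta>(2)] by blast
  obtain r2 where r2: "0 < r2" "\<And>x. x \<in> ball \<xi> r2 \<Longrightarrow> norm (poly q2 x - poly q2 \<xi>) < \<delta>2"
    using poly_close[OF \<delta>(2)] by blast
  define r where "r = min (min rK (min r1 r2)) (min 1 (norm h / (4 * C)))"
  have r: "0 < r" using rK(1) r1(1) r2(1) h C by (simp add: r_def)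
  have r_le: "r \<le> rK" "r \<le> r1" "r \<le> r2" "r \<le> 1" "r \<le> norm h / (4 * C)"
    unfolding r_def by linarith+
  have sub: "x \<in> ball \<xi> rK" "x \<in> ball \<xi> r1" "x \<in> ball \<xi> r2" "x \<in> cball \<xi> 1" if "x \<in> ball \<xi> r" for x
    using that r_le by auto
  have main: "splits \<xi> h r \<epsilon> \<eta> (u * poly q1 \<xi> + v * poly q2 \<xi>)
      (f + smult (of_real \<epsilon> * u) q1 + smult (of_real \<epsilon> * v) q2)"
    if u: "norm u \<le> M" and v: "norm v \<le> M" and \<epsilon>: "0 < \<epsilon>"
      and c\<mu>: "\<mu> \<le> norm (u * poly q1 \<xi> + v * poly q2 \<xi>)" for u v \<epsilon>
  proof -
    define F where "F = f + smult (of_real \<epsilon> * u) q1 + smult (of_real \<epsilon> * v) q2"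
    define c where "c = u * poly q1 \<xi> + v * poly q2 \<xi>"
    define q where "q x = u * poly q1 x + v * poly q2 x" for x
    have polyF: "poly F x = (x - \<xi>)\<^sup>2 * poly K x + of_real \<epsilon> * q x" for x
      by (simp add: F_def f q_def algebra_simps power2_eq_square)
    have Kx: "norm h / 2 \<le> norm (poly K x)" if "x \<in> ball \<xi> r" for x
      using rK(2)[OF sub(1)[OF that]] \<delta>(3) norm_triangle_ineq2[of h "poly K x"]
      by (simp add: norm_minus_commute)
    have qc: "norm (q x - c) \<le> 2 * M * \<delta>2" if "x \<in> ball \<xi> r" for x
    proof -
      have "q x - c = u * (poly q1 x - poly q1 \<xi>) + v * (poly q2 x - poly q2 \<xi>)"
        by (simp add: q_def c_def algebra_simps)
      also have "norm \<dots> \<le> M * \<delta>2 + M * \<delta>2"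
        using u v M r1(2)[OF sub(2)[OF that]] r2(2)[OF sub(3)[OF that]]
        by (intro order_trans[OF norm_triangle_ineq] add_mono) (auto simp: norm_mult intro!: mult_mono)
      finally show ?thesis by simp
    qed
    have qQ: "norm (q x) \<le> Q" if "x \<in> ball \<xi> r" for x
    proof -
      have "norm (poly q1 x) \<le> norm (poly q1 \<xi>) + 1" "norm (poly q2 x) \<le> norm (poly q2 \<xi>) + 1"
        using r1(2)[OF sub(2)[OF that]] r2(2)[OF sub(3)[OF that]] \<delta>(5)
          norm_triangle_ineq2[of "poly q1 x" "poly q1 \<xi>"] norm_triangle_ineq2[of "poly q2 x" "poly q2 \<xi>"]
        by linarith+
      then have "norm (q x) \<le> M * (norm (poly q1 \<xi>) + 1) + M * (norm (poly q2 \<xi>) + 1)"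
        unfolding q_def using u v M
        by (intro order_trans[OF norm_triangle_ineq] add_mono) (auto simp: norm_mult intro!: mult_mono)
      then show ?thesis by (simp add: Q_def algebra_simps)
    qed
    have approx: "norm (h * (x - \<xi>)\<^sup>2 + of_real \<epsilon> * c) \<le> \<epsilon> * \<eta>'"
      if x: "x \<in> ball \<xi> r" "poly F x = 0" for x
    proof -
      have eq: "(x - \<xi>)\<^sup>2 * poly K x = - (of_real \<epsilon> * q x)"
        using x(2) unfolding eq_neg_iff_add_eq_0 polyF .
      have "norm (x - \<xi>) ^ 2 * norm (poly K x) = \<epsilon> * norm (q x)"
        using arg_cong[OF eq, of norm] \<epsilon> by (simp add: norm_mult norm_power)
      also have "\<dots> \<le> \<epsilon> * Q" using qQ[OF x(1)] \<epsilon> by (intro mult_left_mono) auto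
      finally have "norm (x - \<xi>) ^ 2 * (norm h / 2) \<le> \<epsilon> * Q"
        using mult_left_mono[OF Kx[OF x(1)] zero_le_power2[of "norm (x - \<xi>)"]] by linarith
      then have w: "norm h * norm (x - \<xi>) ^ 2 \<le> 2 * \<epsilon> * Q" by (simp add: algebra_simps)
      have "h * (x - \<xi>)\<^sup>2 + of_real \<epsilon> * c =
          - ((poly K x - h) * (x - \<xi>)\<^sup>2) - of_real \<epsilon> * (q x - c)"
        using eq by (simp add: algebra_simps)
      also have "norm \<dots> \<le> norm (poly K x - h) * norm (x - \<xi>) ^ 2 + \<epsilon> * norm (q x - c)"
        using \<epsilon> by (intro order_trans[OF norm_triangle_ineq4]) (simp add: norm_mult norm_power)
      also have "\<dots> \<le> (\<eta>' / (4 * Q) * norm h) * norm (x - \<xi>) ^ 2 + \<epsilon> * (2 * M * \<delta>2)"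
        using rK(2)[OF sub(1)[OF x(1)]] \<delta>(4) qc[OF x(1)] \<epsilon>
        by (intro add_mono mult_right_mono mult_left_mono) auto
      also have "\<dots> \<le> \<epsilon> * \<eta>' / 2 + \<epsilon> * \<eta>' / 2"
      proof (rule add_mono)
        have "(\<eta>' / (4 * Q) * norm h) * norm (x - \<xi>) ^ 2 = \<eta>' / (4 * Q) * (norm h * norm (x - \<xi>) ^ 2)"
          by simp
        also have "\<dots> \<le> \<eta>' / (4 * Q) * (2 * \<epsilon> * Q)"
          using w \<eta>'(1) Q by (intro mult_left_mono) auto
        also have "\<dots> = \<epsilon> * \<eta>' / 2" using Q by simp
        finally show "(\<eta>' / (4 * Q) * norm h) * norm (x - \<xi>) ^ 2 \<le> \<epsilon> * \<eta>' / 2" .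
        have "\<epsilon> * (2 * M * \<delta>2) \<le> \<epsilon> * (2 * M * (\<eta>' / (4 * M)))"
          using \<delta>(6) \<epsilon> M by (intro mult_left_mono) auto
        also have "\<dots> = \<epsilon> * \<eta>' / 2" using M by simp
        finally show "\<epsilon> * (2 * M * \<delta>2) \<le> \<epsilon> * \<eta>' / 2" .
      qed
      finally show ?thesis by simp
    qed
    have eps_le: "\<epsilon> \<le> 2 * norm h / \<mu> * norm (x - \<xi>) ^ 2"
      if x: "x \<in> ball \<xi> r" "poly F x = 0" for x
    proof -
      have "\<epsilon> * \<mu> \<le> \<epsilon> * norm c" using c\<mu> \<epsilon> by (simp add: c_def)
      also have "\<dots> = norm (of_real \<epsilon> * c)" using \<epsilon> by (simp add: norm_mult)
      also have "\<dots> \<le> norm (h * (x - \<xi>)\<^sup>2 + of_real \<epsilon> * c) + norm (h * (x - \<xi>)\<^sup>2)"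
        by (metis add_diff_cancel_left' norm_triangle_ineq4)
      also have "\<dots> \<le> \<epsilon> * (\<mu> / 2) + norm h * norm (x - \<xi>) ^ 2"
      proof (intro add_mono)
        show "norm (h * (x - \<xi>)\<^sup>2 + of_real \<epsilon> * c) \<le> \<epsilon> * (\<mu> / 2)"
          using order_trans[OF approx[OF x] mult_left_mono[OF \<eta>'(3), of \<epsilon>]] \<epsilon> by simp
      qed (simp add: norm_mult norm_power)
      finally show ?thesis using \<mu> by (simp add: field_simps)
    qed
    define D where "D x x' = ((x - \<xi>) + (x' - \<xi>)) * poly K x + (x' - \<xi>)\<^sup>2 * ddiff K x x' +
        of_real \<epsilon> * (u * ddiff q1 x x' + v * ddiff q2 x x')" for x x'
    have D: "poly F x - poly F x' = (x - x') * D x x'" for x x'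
    proof -
      have "poly F x - poly F x' = ((x - \<xi>)\<^sup>2 - (x' - \<xi>)\<^sup>2) * poly K x +
          (x' - \<xi>)\<^sup>2 * (poly K x - poly K x') +
          of_real \<epsilon> * (u * (poly q1 x - poly q1 x') + v * (poly q2 x - poly q2 x'))"
        by (simp add: polyF q_def algebra_simps)
      also have "(x - \<xi>)\<^sup>2 - (x' - \<xi>)\<^sup>2 = (x - x') * ((x - \<xi>) + (x' - \<xi>))"
        by (simp add: power2_eq_square algebra_simps)
      finally show ?thesis unfolding poly_diff_eq_ddiff D_def by (simp add: algebra_simps)
    qed
    have D_self: "poly (pderiv F) x = D x x" for x
    proof -
      have "pderiv [:- \<xi>, 1:] = 1" by (simp add: pderiv_pCons one_pCons)
      then have "poly (pderiv f) x = ((x - \<xi>) + (x - \<xi>)) * poly K x + (x - \<xi>)\<^sup>2 * poly (pderiv K) x"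
        unfolding f power2_eq_square pderiv_mult by (simp add: algebra_simps)
      then show ?thesis
        by (simp add: F_def D_def ddiff_self pderiv_add pderiv_smult algebra_simps)
    qed
    have nonzero: "D x x' \<noteq> 0"
      if x: "x \<in> ball \<xi> r" and x': "x' \<in> ball \<xi> r" "poly F x' = 0"
        and angle: "norm (x' - \<xi>) \<le> norm ((x - \<xi>) + (x' - \<xi>))" for x x'
    proof
      assume zero: "D x x' = 0"
      define w where "w = norm (x' - \<xi>)"
      have "0 < 2 * norm h / \<mu> * w ^ 2" using eps_le[OF x'] \<epsilon> by (simp add: w_def)
      then have w: "0 < w" using w_def by (metis norm_ge_zero less_le mult_zero_right power_zero_numeral)
      have wr: "w < r" using x'(1) by (simp add: w_def dist_norm norm_minus_commute)
      have "w * (norm h / 2) \<le> norm ((x - \<xi>) + (x' - \<xi>)) * norm (poly K x)"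
        using angle Kx[OF x] h by (intro mult_mono) (auto simp: w_def)
      also have "\<dots> = norm (((x - \<xi>) + (x' - \<xi>)) * poly K x)" by (simp add: norm_mult)
      also have "((x - \<xi>) + (x' - \<xi>)) * poly K x =
          - ((x' - \<xi>)\<^sup>2 * ddiff K x x' + of_real \<epsilon> * (u * ddiff q1 x x' + v * ddiff q2 x x'))"
        using zero unfolding eq_neg_iff_add_eq_0 D_def by (simp only: add.assoc)
      also have "norm \<dots> \<le> w ^ 2 * norm (ddiff K x x') +
          \<epsilon> * (norm u * norm (ddiff q1 x x') + norm v * norm (ddiff q2 x x'))"
        unfolding norm_minus_cancel using \<epsilon>
        by (intro order_trans[OF norm_triangle_ineq] add_mono)
          (auto simp: norm_mult norm_power w_def intro!: mult_left_mono order_trans[OF norm_triangle_ineq])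
      also have "\<dots> \<le> w ^ 2 * CK + \<epsilon> * (M * C1 + M * C2)"
        using CK(2)[of x x'] C1(2)[of x x'] C2(2)[of x x'] sub(4)[OF x] sub(4)[OF x'(1)] u v M \<epsilon>
        by (intro add_mono mult_left_mono mult_mono) auto
      also have "\<dots> \<le> w ^ 2 * CK + (2 * norm h / \<mu> * w ^ 2) * (M * C1 + M * C2)"
        using eps_le[OF x'] M C1(1) C2(1) by (intro add_left_mono mult_right_mono) (auto simp: w_def)
      also have "\<dots> = w * (w * C)" by (simp add: C_def algebra_simps power2_eq_square)
      finally have "norm h / 2 \<le> w * C" using w by simp
      also have "\<dots> < r * C" using wr C by simp
      also have "\<dots> \<le> norm h / 4" using r_le(5) C by (simp add: field_simps)
      finally show False using h by simp
    qed
    show ?thesis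
      unfolding splits_def c_def[symmetric] F_def[symmetric]
    proof (intro ballI conjI impI)
      fix x assume "x \<in> roots F \<inter> ball \<xi> r"
      then have x: "x \<in> ball \<xi> r" "poly F x = 0" by (auto simp: roots_def)
      show "norm (h * (x - \<xi>)\<^sup>2 + of_real \<epsilon> * c) \<le> \<epsilon> * \<eta>"
        using order_trans[OF approx[OF x] mult_left_mono[OF \<eta>'(2), of \<epsilon>]] \<epsilon> by simp
      have "norm ((x - \<xi>) + (x - \<xi>)) = 2 * norm (x - \<xi>)" by (metis mult_2 norm_mult norm_numeral)
      then show "poly (pderiv F) x \<noteq> 0" unfolding D_self using x by (intro nonzero) auto
      fix x' assume "x' \<in> roots F \<inter> ball \<xi> r" and side: "0 \<le> Re ((x - \<xi>) * cnj (x' - \<xi>))"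
      then have x': "x' \<in> ball \<xi> r" "poly F x' = 0" by (auto simp: roots_def)
      have "D x x' \<noteq> 0" using nonzero[OF x(1) x' norm_le_norm_add[OF side]] .
      moreover have "(x - x') * D x x' = 0" using D[of x x'] x(2) x'(2) by simp
      ultimately show "x = x'" by simp
    qed
  qed
  show ?thesis
    using main r unfolding h_def by (intro exI[of _ r]) blast
qed

section \<open>Monodromy around a polynomial with double roots\<close>

lemma Re_nonzero_if_square:
  assumes "0 < Re (W\<^sup>2)"
  shows "Re W \<noteq> 0"
  using assms by (auto simp: power2_eq_square)

lemma same_half_plane:
  assumes W: "0 < Re (W\<^sup>2)" and W': "0 < Re (W'\<^sup>2)" and same: "0 < Re W * Re W'"
  shows "0 \<le> Re (W * cnj W')"
proof -
  have "\<bar>Im W\<bar> \<le> \<bar>Re W\<bar>" "\<bar>Im W'\<bar> \<le> \<bar>Re W'\<bar>"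
    using W W' by (auto simp: abs_le_square_iff power2_eq_square)
  then have "\<bar>Im W * Im W'\<bar> \<le> \<bar>Re W * Re W'\<bar>" unfolding abs_mult by (intro mult_mono) auto
  then show ?thesis using same by simp
qed

lemma nonzero_same_sign:
  fixes g :: "real \<Rightarrow> real"
  assumes cont: "continuous_on {0..1} g" and nz: "\<And>t. t \<in> {0..1} \<Longrightarrow> g t \<noteq> 0"
  shows "0 < g 0 * g 1"
proof (rule ccontr)
  assume "\<not> 0 < g 0 * g 1"
  then have "(g 0 \<le> 0 \<and> 0 \<le> g 1) \<or> (g 1 \<le> 0 \<and> 0 \<le> g 0)"
    by (auto simp: zero_less_mult_iff not_less)
  then obtain t where "0 \<le> t" "t \<le> 1" "g t = 0"
    using IVT'[OF _ _ _ cont, of 0] IVT2'[OF _ _ _ cont, of 0] by auto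
  then show False using nz[of t] by simp
qed

lemma path_stays_in_ball:
  fixes \<rho> :: "real \<Rightarrow> complex"
  assumes \<rho>: "path \<rho>" and cover: "\<And>t. t \<in> {0..1} \<Longrightarrow> \<exists>y\<in>Y. \<rho> t \<in> ball y r"
    and sep: "\<And>y y'. y \<in> Y \<Longrightarrow> y' \<in> Y \<Longrightarrow> y \<noteq> y' \<Longrightarrow> 2 * r \<le> dist y y'"
    and y: "y \<in> Y" "\<rho> 0 \<in> ball y r" and t: "t \<in> {0..1}"
  shows "\<rho> t \<in> ball y r"
proof (rule ccontr)
  assume out: "\<rho> t \<notin> ball y r"
  let ?B = "\<Union>y'\<in>Y - {y}. ball y' r"
  have conn: "connected (path_image \<rho>)" using \<rho> by (rule connected_path_image)
  have disj: "ball y r \<inter> ?B = {}"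
  proof -
    have False if "x \<in> ball y r" "y' \<in> Y - {y}" "x \<in> ball y' r" for x y'
      using sep[of y y'] that y(1) dist_triangle2[of y y' x] by auto
    then show ?thesis by blast
  qed
  have sub: "path_image \<rho> \<subseteq> ball y r \<union> ?B"
  proof
    fix x assume "x \<in> path_image \<rho>"
    then obtain s where "s \<in> {0..1}" "x = \<rho> s" by (auto simp: path_image_def)
    then show "x \<in> ball y r \<union> ?B" using cover[of s] by blast
  qed
  have pts: "\<rho> 0 \<in> path_image \<rho>" "\<rho> t \<in> path_image \<rho>" using t by (auto simp: path_image_def)
  have "ball y r \<inter> path_image \<rho> = {} \<or> ?B \<inter> path_image \<rho> = {}"
    using connectedD[OF conn _ _ _ sub] disj by (metis (no_types, lifting) inf_bot_left open_UN open_ball)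
  then show False using pts y(2) out sub by blast
qed

text \<open>
  A loop \<open>f + \<epsilon> (u q1 + v q2)\<close> around a polynomial \<open>f\<close> whose roots are simple, except for the double
  roots in \<open>\<Xi>\<close>. The value of \<open>u q1 + v q2\<close> at a double root winds once around the origin for the
  double roots in \<open>\<Xi>\<^sub>0\<close> and stays in a right half-plane for the others.
\<close>

locale double_root_loop =
  fixes f q1 q2 :: "complex poly" and N :: nat and K :: "complex \<Rightarrow> complex poly"
    and \<Xi> \<Xi>\<^sub>0 :: "complex set" and u v :: "real \<Rightarrow> complex" and M \<mu> :: real
  assumes N: "0 < N" and deg: "degree f = N" "degree q1 \<le> N" "degree q2 \<le> N"
    and simple: "\<And>y. y \<in> roots f \<Longrightarrow> y \<notin> \<Xi> \<Longrightarrow> poly (pderiv f) y \<noteq> 0"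
    and double: "\<And>\<xi>. \<xi> \<in> \<Xi> \<Longrightarrow> f = [:- \<xi>, 1:]\<^sup>2 * K \<xi> \<and> poly (K \<xi>) \<xi> \<noteq> 0"
    and sub: "\<Xi>\<^sub>0 \<subseteq> \<Xi>"
    and cont: "continuous_on {0..1} u" "continuous_on {0..1} v"
    and M: "0 < M" "\<And>t. t \<in> {0..1} \<Longrightarrow> norm (u t) \<le> M" "\<And>t. t \<in> {0..1} \<Longrightarrow> norm (v t) \<le> M"
    and ends: "u 0 = 1" "u 1 = 1" "v 0 = 0" "v 1 = 0"
    and start: "\<And>\<xi>. \<xi> \<in> \<Xi> \<Longrightarrow> poly q1 \<xi> = 1"
    and turn: "\<And>\<xi> t. \<xi> \<in> \<Xi>\<^sub>0 \<Longrightarrow> t \<in> {0..1} \<Longrightarrow> u t * poly q1 \<xi> + v t * poly q2 \<xi> = cis (2 * pi * t)"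
    and \<mu>: "0 < \<mu>" "\<mu> \<le> 1"
    and straight: "\<And>\<xi> t. \<xi> \<in> \<Xi> - \<Xi>\<^sub>0 \<Longrightarrow> t \<in> {0..1} \<Longrightarrow> \<mu> \<le> Re (u t * poly q1 \<xi> + v t * poly q2 \<xi>)"
begin

definition loop :: "real \<Rightarrow> real \<Rightarrow> complex poly"
  where "loop \<epsilon> t = f + smult (of_real \<epsilon> * u t) q1 + smult (of_real \<epsilon> * v t) q2"

lemma f_nonzero: "f \<noteq> 0"
  using deg N by auto

lemma Xi_roots: "\<Xi> \<subseteq> roots f"
proof
  fix \<xi> assume "\<xi> \<in> \<Xi>"
  then have "f = [:- \<xi>, 1:]\<^sup>2 * K \<xi>" using double by blast
  then have "poly f \<xi> = poly ([:- \<xi>, 1:]\<^sup>2 * K \<xi>) \<xi>" by (rule arg_cong)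
  then show "\<xi> \<in> roots f" by (simp add: roots_def)
qed

definition val :: "real \<Rightarrow> complex \<Rightarrow> complex"
  where "val t \<xi> = u t * poly q1 \<xi> + v t * poly q2 \<xi>"

text \<open>
  The conclusions about the perturbation at time \<open>t\<close> from the two preceding local analyses, at simple
  and at double roots, for one radius \<open>r\<close> that serves all roots of \<open>f\<close>.
\<close>

definition loop_ok :: "real \<Rightarrow> real \<Rightarrow> real \<Rightarrow> bool"
  where "loop_ok r \<epsilon> t \<longleftrightarrow> degree (loop \<epsilon> t) = N \<and>
    (\<forall>x\<in>roots (loop \<epsilon> t). \<exists>y\<in>roots f. x \<in> ball y r) \<and>
    (\<forall>y\<in>roots f - \<Xi>. univalent_on (loop \<epsilon> t) (ball y r)) \<and>
    (\<forall>\<xi>\<in>\<Xi>. splits \<xi> (poly (K \<xi>) \<xi>) r \<epsilon> (\<mu> / 2) (val t \<xi>) (loop \<epsilon> t))"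

definition radius_ok :: "real \<Rightarrow> real \<Rightarrow> bool"
  where "radius_ok r \<epsilon>\<^sub>0 \<longleftrightarrow> 0 < r \<and> 0 < \<epsilon>\<^sub>0 \<and>
    (\<forall>y\<in>roots f. \<forall>y'\<in>roots f. y \<noteq> y' \<longrightarrow> 2 * r \<le> dist y y') \<and>
    (\<forall>\<epsilon> t. 0 < \<epsilon> \<longrightarrow> \<epsilon> \<le> \<epsilon>\<^sub>0 \<longrightarrow> t \<in> {0..1} \<longrightarrow> loop_ok r \<epsilon> t)"

lemma val_bound:
  assumes "\<xi> \<in> \<Xi>" "t \<in> {0..1}"
  shows "\<mu> \<le> norm (val t \<xi>)"
proof (cases "\<xi> \<in> \<Xi>\<^sub>0")
  case True
  then show ?thesis using turn[OF True assms(2)] \<mu> by (simp add: val_def)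
next
  case False
  then have "\<mu> \<le> Re (val t \<xi>)" using straight assms unfolding val_def by blast
  then show ?thesis using complex_Re_le_cmod order_trans by blast
qed

lemma radius_exists: "\<exists>r \<epsilon>\<^sub>0. radius_ok r \<epsilon>\<^sub>0"
proof -
  have fin: "finite (roots f)" using f_nonzero by (rule finite_roots)
  obtain s where s: "0 < s" and sep: "\<And>y y'. y \<in> roots f \<Longrightarrow> y' \<in> roots f \<Longrightarrow> y \<noteq> y' \<Longrightarrow> 2 * s \<le> dist y y'"
    using finite_separated[OF fin] by blast
  have "\<exists>r>0. \<exists>\<epsilon>>0. \<forall>U V. norm U \<le> \<epsilon> \<longrightarrow> norm V \<le> \<epsilon> \<longrightarrow>
      univalent_on (f + smult U q1 + smult V q2) (ball y r)" if "y \<in> roots f - \<Xi>" for y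
    using simple_root_persists simple that by blast
  then obtain R E where RE: "\<And>y. y \<in> roots f - \<Xi> \<Longrightarrow> 0 < R y \<and> 0 < E y \<and>
      (\<forall>U V. norm U \<le> E y \<longrightarrow> norm V \<le> E y \<longrightarrow> univalent_on (f + smult U q1 + smult V q2) (ball y (R y)))"
    by metis
  have "\<exists>r>0. \<forall>\<epsilon> t. 0 < \<epsilon> \<longrightarrow> t \<in> {0..1} \<longrightarrow>
      splits \<xi> (poly (K \<xi>) \<xi>) r \<epsilon> (\<mu> / 2) (val t \<xi>) (loop \<epsilon> t)" if \<xi>: "\<xi> \<in> \<Xi>" for \<xi>
  proof -
    obtain r where r: "0 < r" "\<And>u v \<epsilon>. norm u \<le> M \<Longrightarrow> norm v \<le> M \<Longrightarrow> 0 < \<epsilon> \<Longrightarrow>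
        \<mu> \<le> norm (u * poly q1 \<xi> + v * poly q2 \<xi>) \<Longrightarrow>
        splits \<xi> (poly (K \<xi>) \<xi>) r \<epsilon> (\<mu> / 2) (u * poly q1 \<xi> + v * poly q2 \<xi>)
          (f + smult (of_real \<epsilon> * u) q1 + smult (of_real \<epsilon> * v) q2)"
      using double_root_splits[of f \<xi> "K \<xi>" M \<mu> "\<mu> / 2" q1 q2] double[OF \<xi>] M(1) \<mu>(1) by auto
    show ?thesis
      using r(1) r(2)[OF M(2,3)] val_bound[OF \<xi>] unfolding val_def loop_def by blast
  qed
  then obtain R' where R': "\<And>\<xi>. \<xi> \<in> \<Xi> \<Longrightarrow> 0 < R' \<xi> \<and> (\<forall>\<epsilon> t. 0 < \<epsilon> \<longrightarrow> t \<in> {0..1} \<longrightarrow>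
      splits \<xi> (poly (K \<xi>) \<xi>) (R' \<xi>) \<epsilon> (\<mu> / 2) (val t \<xi>) (loop \<epsilon> t))"
    by metis
  have finXi: "finite \<Xi>" using Xi_roots fin finite_subset by blast
  define r where "r = Min (insert s (R ` (roots f - \<Xi>) \<union> R' ` \<Xi>))"
  have r: "0 < r" using s RE R' fin finXi by (auto simp: r_def)
  have r_le: "r \<le> s" "\<And>y. y \<in> roots f - \<Xi> \<Longrightarrow> r \<le> R y" "\<And>\<xi>. \<xi> \<in> \<Xi> \<Longrightarrow> r \<le> R' \<xi>"
    unfolding r_def using fin finXi by (auto intro!: Min_le)
  define e1 where "e1 = Min (insert 1 (E ` (roots f - \<Xi>)))"
  have e1: "0 < e1" using RE fin by (auto simp: e1_def)
  have e1_le: "e1 \<le> E y" if "y \<in> roots f - \<Xi>" for y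
    unfolding e1_def using fin that by (auto intro!: Min_le)
  obtain e2 where e2: "0 < e2" "\<And>U V x. norm U \<le> e2 \<Longrightarrow> norm V \<le> e2 \<Longrightarrow>
      poly (f + smult U q1 + smult V q2) x = 0 \<Longrightarrow> \<exists>y\<in>roots f. dist x y < r"
    using roots_of_perturbation_near[OF f_nonzero _ _ r, of q1 q2] deg by auto
  define e3 where "e3 = norm (coeff f N) / (2 * (norm (coeff q1 N) + norm (coeff q2 N) + 1))"
  have lc: "0 < norm (coeff f N)" using f_nonzero deg(1) by auto
  have S: "0 < norm (coeff q1 N) + norm (coeff q2 N) + 1" by (simp add: add_nonneg_pos)
  have "c / (2 * S) * S = c / 2" if "0 < S" for c S :: real using that by simp
  from this[OF S] have half: "e3 * (norm (coeff q1 N) + norm (coeff q2 N) + 1) = norm (coeff f N) / 2"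
    unfolding e3_def .
  have e3: "0 < e3" unfolding e3_def using lc S by simp
  define \<epsilon>\<^sub>0 where "\<epsilon>\<^sub>0 = min e1 (min e2 e3) / M"
  have \<epsilon>\<^sub>0: "0 < \<epsilon>\<^sub>0" using e1 e2(1) e3 M(1) by (simp add: \<epsilon>\<^sub>0_def)
  have "loop_ok r \<epsilon> t"
    if \<epsilon>: "0 < \<epsilon>" "\<epsilon> \<le> \<epsilon>\<^sub>0" and t: "t \<in> {0..1}" for \<epsilon> t
    unfolding loop_ok_def
  proof (intro conjI)
    define U where "U = of_real \<epsilon> * u t"
    define V where "V = of_real \<epsilon> * v t"
    have loop: "loop \<epsilon> t = f + smult U q1 + smult V q2" by (simp add: loop_def U_def V_def)
    have "\<epsilon> * M \<le> min e1 (min e2 e3)" using \<epsilon>(2) M(1) by (simp add: \<epsilon>\<^sub>0_def field_simps)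
    moreover have "norm U \<le> \<epsilon> * M" "norm V \<le> \<epsilon> * M"
      using \<epsilon>(1) M(2,3)[OF t] by (auto simp: U_def V_def norm_mult)
    ultimately have U: "norm U \<le> e1" "norm U \<le> e2" "norm U \<le> e3" and V: "norm V \<le> e1" "norm V \<le> e2" "norm V \<le> e3"
      by linarith+
    show "degree (loop \<epsilon> t) = N"
    proof (rule antisym)
      show "degree (loop \<epsilon> t) \<le> N"
        unfolding loop using deg by (intro degree_add_le order_trans[OF degree_smult_le]) auto
      have "norm (U * coeff q1 N + V * coeff q2 N) \<le> e3 * norm (coeff q1 N) + e3 * norm (coeff q2 N)"
        using U(3) V(3) by (intro order_trans[OF norm_triangle_ineq] add_mono) (auto simp: norm_mult intro: mult_right_mono)
      also have "\<dots> \<le> e3 * (norm (coeff q1 N) + norm (coeff q2 N) + 1)" using e3 by (simp add: algebra_simps)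
      also have "\<dots> = norm (coeff f N) / 2" by (rule half)
      also have "\<dots> < norm (coeff f N)" using lc by simp
      finally have "coeff f N + (U * coeff q1 N + V * coeff q2 N) \<noteq> 0"
        by (metis add_eq_0_iff less_irrefl norm_minus_cancel)
      then show "N \<le> degree (loop \<epsilon> t)" by (intro le_degree) (simp add: loop add.assoc)
    qed
    show "\<forall>x\<in>roots (loop \<epsilon> t). \<exists>y\<in>roots f. x \<in> ball y r"
      using e2(2)[OF U(2) V(2)] by (auto simp: loop roots_def dist_commute)
    show "\<forall>y\<in>roots f - \<Xi>. univalent_on (loop \<epsilon> t) (ball y r)"
    proof
      fix y assume y: "y \<in> roots f - \<Xi>"
      have "univalent_on (loop \<epsilon> t) (ball y (R y))"
        unfolding loop using RE[OF y] U(1) V(1) e1_le[OF y] order_trans by blast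
      moreover have "ball y r \<subseteq> ball y (R y)" using r_le(2)[OF y] by auto
      ultimately show "univalent_on (loop \<epsilon> t) (ball y r)" by (rule univalent_on_subset)
    qed
    show "\<forall>\<xi>\<in>\<Xi>. splits \<xi> (poly (K \<xi>) \<xi>) r \<epsilon> (\<mu> / 2) (val t \<xi>) (loop \<epsilon> t)"
      using R' \<epsilon>(1) t r_le(3) splits_mono by blast
  qed
  moreover have "2 * r \<le> dist y y'" if "y \<in> roots f" "y' \<in> roots f" "y \<noteq> y'" for y y'
    using sep[OF that] r_le(1) by simp
  ultimately show ?thesis using r \<epsilon>\<^sub>0 unfolding radius_ok_def by blast
qed

context
  fixes r \<epsilon>\<^sub>0 \<epsilon> :: real
  assumes ok: "radius_ok r \<epsilon>\<^sub>0" and \<epsilon>: "0 < \<epsilon>" "\<epsilon> \<le> \<epsilon>\<^sub>0"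
begin

lemma loop_ok: "t \<in> {0..1} \<Longrightarrow> loop_ok r \<epsilon> t"
  using ok \<epsilon> unfolding radius_ok_def by blast

lemma loop_near: "t \<in> {0..1} \<Longrightarrow> x \<in> roots (loop \<epsilon> t) \<Longrightarrow> \<exists>y\<in>roots f. x \<in> ball y r"
  using loop_ok[of t] unfolding loop_ok_def by blast

lemma loop_simple:
  assumes "t \<in> {0..1}"
  shows "loop \<epsilon> t \<in> simple_polys N"
  unfolding simple_polys_iff
proof (intro conjI allI impI)
  show "degree (loop \<epsilon> t) = N" using loop_ok[OF assms] unfolding loop_ok_def by blast
  fix x assume "poly (loop \<epsilon> t) x = 0"
  then have x: "x \<in> roots (loop \<epsilon> t)" by (simp add: roots_def)
  then obtain y where y: "y \<in> roots f" "x \<in> ball y r" using loop_near[OF assms] by blast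
  show "poly (pderiv (loop \<epsilon> t)) x \<noteq> 0"
  proof (cases "y \<in> \<Xi>")
    case True
    then show ?thesis using loop_ok[OF assms] x y unfolding loop_ok_def splits_def by blast
  next
    case False
    then show ?thesis using loop_ok[OF assms] y unfolding loop_ok_def univalent_on_def by blast
  qed
qed

lemma loop_path: "poly_path (simple_polys N) (loop \<epsilon>)"
  unfolding poly_path_def
proof (intro conjI allI)
  fix n
  show "path (\<lambda>t. coeff (loop \<epsilon> t) n)"
    unfolding path_def loop_def coeff_add coeff_smult
    by (intro continuous_on_add continuous_on_mult continuous_on_const cont)
qed (use loop_simple in blast)

lemma loop_closed: "loop \<epsilon> 1 = loop \<epsilon> 0"
  by (simp add: loop_def ends)

lemma separated: "y \<in> roots f \<Longrightarrow> y' \<in> roots f \<Longrightarrow> y \<noteq> y' \<Longrightarrow> 2 * r \<le> dist y y'"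
  using ok unfolding radius_ok_def by blast

lemma loop_splits:
  "\<xi> \<in> \<Xi> \<Longrightarrow> t \<in> {0..1} \<Longrightarrow> splits \<xi> (poly (K \<xi>) \<xi>) r \<epsilon> (\<mu> / 2) (val t \<xi>) (loop \<epsilon> t)"
  using loop_ok[of t] unfolding loop_ok_def by blast

text \<open>
  The displacement of a root from \<open>\<xi>\<close>, scaled so that its square is close to the value of
  \<open>u q1 + v q2\<close> at \<open>\<xi>\<close>.
\<close>

definition disp :: "complex \<Rightarrow> complex \<Rightarrow> complex"
  where "disp \<xi> x = csqrt (- poly (K \<xi>) \<xi> / of_real \<epsilon>) * (x - \<xi>)"

lemma disp_square:
  assumes "\<xi> \<in> \<Xi>" "t \<in> {0..1}" "x \<in> roots (loop \<epsilon> t) \<inter> ball \<xi> r"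
  shows "norm ((disp \<xi> x)\<^sup>2 - val t \<xi>) \<le> \<mu> / 2"
proof -
  let ?c = "val t \<xi>"
  let ?w = "poly (K \<xi>) \<xi> * (x - \<xi>)\<^sup>2 + of_real \<epsilon> * ?c"
  have "(disp \<xi> x)\<^sup>2 = - poly (K \<xi>) \<xi> / of_real \<epsilon> * (x - \<xi>)\<^sup>2"
    unfolding disp_def power_mult_distrib by simp
  then have "(disp \<xi> x)\<^sup>2 - ?c = - ?w / of_real \<epsilon>"
    using \<epsilon>(1) by (simp add: field_simps)
  then have "norm ((disp \<xi> x)\<^sup>2 - ?c) = norm ?w / \<epsilon>"
    using \<epsilon>(1) by (simp only: norm_divide norm_minus_cancel norm_of_real abs_of_pos)
  moreover have "norm ?w \<le> \<epsilon> * (\<mu> / 2)"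
    using loop_splits[OF assms(1,2)] assms(3) unfolding splits_def by blast
  ultimately show ?thesis
    using divide_right_mono[of "norm ?w" "\<epsilon> * (\<mu> / 2)" \<epsilon>] \<epsilon>(1) by simp
qed

lemma Re_of_real_mult: "Re (of_real a * z) = a * Re z"
  by simp

lemma disp_same_side:
  assumes \<xi>: "\<xi> \<in> \<Xi>" and t: "t \<in> {0..1}"
    and x: "x \<in> roots (loop \<epsilon> t) \<inter> ball \<xi> r" "x' \<in> roots (loop \<epsilon> t) \<inter> ball \<xi> r"
    and side: "0 \<le> Re (disp \<xi> x * cnj (disp \<xi> x'))"
  shows "x = x'"
proof -
  let ?s = "csqrt (- poly (K \<xi>) \<xi> / of_real \<epsilon>)"
  have "disp \<xi> x * cnj (disp \<xi> x') = (?s * cnj ?s) * ((x - \<xi>) * cnj (x' - \<xi>))"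
    by (simp add: disp_def)
  also have "?s * cnj ?s = of_real ((norm ?s)\<^sup>2)" by (simp only: complex_norm_square)
  finally have "0 \<le> (norm ?s)\<^sup>2 * Re ((x - \<xi>) * cnj (x' - \<xi>))"
    using side by (simp only: Re_of_real_mult)
  moreover have "0 < (norm ?s)\<^sup>2" using double[OF \<xi>] \<epsilon>(1) by simp
  ultimately have "0 \<le> Re ((x - \<xi>) * cnj (x' - \<xi>))" by (simp only: zero_le_mult_iff) auto
  then show ?thesis using loop_splits[OF \<xi> t] x unfolding splits_def by blast
qed

lemma disp_start:
  assumes "\<xi> \<in> \<Xi>" "x \<in> roots (loop \<epsilon> 0) \<inter> ball \<xi> r"
  shows "0 < Re ((disp \<xi> x)\<^sup>2)"
proof -
  have "norm ((disp \<xi> x)\<^sup>2 - 1) \<le> \<mu> / 2"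
    using disp_square[OF assms(1) _ assms(2)] start[OF assms(1)] ends by (simp add: val_def)
  then have "norm ((disp \<xi> x)\<^sup>2 - 1) < 1" using \<mu> by simp
  then show ?thesis using abs_Re_le_cmod[of "(disp \<xi> x)\<^sup>2 - 1"] by simp
qed

lemma opposite_sides:
  assumes \<xi>: "\<xi> \<in> \<Xi>" and x: "x \<in> roots (loop \<epsilon> 0) \<inter> ball \<xi> r" "x' \<in> roots (loop \<epsilon> 0) \<inter> ball \<xi> r"
  shows "0 < Re (disp \<xi> x) * Re (disp \<xi> x') \<longleftrightarrow> x = x'"
proof
  assume "0 < Re (disp \<xi> x) * Re (disp \<xi> x')"
  then show "x = x'"
    using disp_same_side[OF \<xi> _ x] same_half_plane[OF disp_start[OF \<xi> x(1)] disp_start[OF \<xi> x(2)]] by simp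
next
  assume "x = x'"
  then show "0 < Re (disp \<xi> x) * Re (disp \<xi> x')"
    using Re_nonzero_if_square[OF disp_start[OF \<xi> x(1)]] by (auto simp: zero_less_mult_iff)
qed

text \<open>
  The imaginary axis separates the possible scaled displacements at time \<open>0\<close> into two sectors, and each
  sector contains at most one.
\<close>

lemma at_most_two:
  assumes \<xi>: "\<xi> \<in> \<Xi>" and x: "x \<in> roots (loop \<epsilon> 0) \<inter> ball \<xi> r" "x' \<in> roots (loop \<epsilon> 0) \<inter> ball \<xi> r"
      "x'' \<in> roots (loop \<epsilon> 0) \<inter> ball \<xi> r"
    and ne: "x \<noteq> x'" "x \<noteq> x''"
  shows "x' = x''"
proof -
  have nz: "Re (disp \<xi> x) \<noteq> 0" "Re (disp \<xi> x') \<noteq> 0" "Re (disp \<xi> x'') \<noteq> 0"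
    using Re_nonzero_if_square[OF disp_start[OF \<xi>]] x by blast+
  have "\<not> 0 < Re (disp \<xi> x) * Re (disp \<xi> x')" "\<not> 0 < Re (disp \<xi> x) * Re (disp \<xi> x'')"
    using opposite_sides[OF \<xi>] x ne by blast+
  then have "0 < Re (disp \<xi> x') * Re (disp \<xi> x'')"
    using nz by (auto simp: zero_less_mult_iff not_less linorder_neq_iff)
  then show ?thesis using opposite_sides[OF \<xi> x(2,3)] by simp
qed

lemma root_path_ball:
  assumes \<rho>: "root_path (loop \<epsilon>) \<rho>" and y: "y \<in> roots f" "\<rho> 0 \<in> ball y r" and t: "t \<in> {0..1}"
  shows "\<rho> t \<in> ball y r"
proof (rule path_stays_in_ball[where Y = "roots f" and y = y and t = t])
  show "path \<rho>" using \<rho> by (simp add: root_path_def)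
  fix t :: real assume t: "t \<in> {0..1}"
  then have "\<rho> t \<in> roots (loop \<epsilon> t)" using \<rho> by (simp add: root_path_def)
  then show "\<exists>y\<in>roots f. \<rho> t \<in> ball y r" using loop_near[OF t] by blast
next
  show "2 * r \<le> dist y y'" if "y \<in> roots f" "y' \<in> roots f" "y \<noteq> y'" for y y'
    using that by (rule separated)
qed (use y t in blast)+

lemma loop_fixes_simple:
  assumes "follows (loop \<epsilon>) x x'" "y \<in> roots f - \<Xi>" "x \<in> ball y r"
  shows "x' = x"
proof -
  obtain \<rho> where \<rho>: "root_path (loop \<epsilon>) \<rho>" "\<rho> 0 = x" "\<rho> 1 = x'"
    using assms(1) by (auto simp: follows_def)
  have "x' \<in> ball y r" using root_path_ball[OF \<rho>(1), of y 1] assms \<rho> by auto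
  moreover have "x \<in> roots (loop \<epsilon> 0)" "x' \<in> roots (loop \<epsilon> 1)"
    using follows_in_roots[OF assms(1)] by auto
  then have "poly (loop \<epsilon> 0) x = 0" "poly (loop \<epsilon> 0) x' = 0"
    unfolding loop_closed by (auto simp: roots_def)
  moreover have "inj_on (poly (loop \<epsilon> 0)) (ball y r)"
    using loop_ok[of 0] assms(2) unfolding loop_ok_def univalent_on_def by simp
  ultimately show ?thesis using assms(3) by (metis inj_onD)
qed

lemma continuous_disp:
  assumes "path \<rho>"
  shows "continuous_on {0..1} (\<lambda>t. disp \<xi> (\<rho> t))"
  using assms unfolding disp_def path_def
  by (intro continuous_on_mult continuous_on_diff continuous_on_const)

lemma loop_fixes_straight:
  assumes fol: "follows (loop \<epsilon>) x x'" and \<xi>: "\<xi> \<in> \<Xi> - \<Xi>\<^sub>0" and x: "x \<in> ball \<xi> r"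
  shows "x' = x"
proof -
  obtain \<rho> where \<rho>: "root_path (loop \<epsilon>) \<rho>" "\<rho> 0 = x" "\<rho> 1 = x'"
    using fol by (auto simp: follows_def)
  have in_ball: "\<rho> t \<in> roots (loop \<epsilon> t) \<inter> ball \<xi> r" if "t \<in> {0..1}" for t
    using root_path_ball[OF \<rho>(1), of \<xi> t] Xi_roots \<xi> x \<rho> that by (auto simp: root_path_def)
  have "0 < Re ((disp \<xi> (\<rho> t))\<^sup>2)" if t: "t \<in> {0..1}" for t
  proof -
    let ?c = "val t \<xi>"
    have "norm ((disp \<xi> (\<rho> t))\<^sup>2 - ?c) \<le> \<mu> / 2" using disp_square[OF _ t in_ball[OF t]] \<xi> by blast
    then have "\<bar>Re ((disp \<xi> (\<rho> t))\<^sup>2 - ?c)\<bar> \<le> \<mu> / 2" using abs_Re_le_cmod order_trans by blast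
    then have "\<bar>Re ((disp \<xi> (\<rho> t))\<^sup>2) - Re ?c\<bar> \<le> \<mu> / 2" by (simp only: minus_complex.simps)
    then show ?thesis using straight[OF \<xi> t] \<mu>(1) unfolding val_def by linarith
  qed
  then have "Re (disp \<xi> (\<rho> t)) \<noteq> 0" if "t \<in> {0..1}" for t using Re_nonzero_if_square that by blast
  moreover have "continuous_on {0..1} (\<lambda>t. Re (disp \<xi> (\<rho> t)))"
    using \<rho>(1) by (intro continuous_on_Re continuous_disp) (simp add: root_path_def)
  ultimately have "0 < Re (disp \<xi> (\<rho> 0)) * Re (disp \<xi> (\<rho> 1))" by (intro nonzero_same_sign)
  then show ?thesis
    using opposite_sides[of \<xi> x x'] \<xi> in_ball[of 0] in_ball[of 1] \<rho> loop_closed by auto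
qed

lemma loop_swaps_turning:
  assumes fol: "follows (loop \<epsilon>) x x'" and \<xi>: "\<xi> \<in> \<Xi>\<^sub>0" and x: "x \<in> ball \<xi> r"
  shows "x' \<noteq> x" "x' \<in> ball \<xi> r"
proof -
  obtain \<rho> where \<rho>: "root_path (loop \<epsilon>) \<rho>" "\<rho> 0 = x" "\<rho> 1 = x'"
    using fol by (auto simp: follows_def)
  have in_ball: "\<rho> t \<in> roots (loop \<epsilon> t) \<inter> ball \<xi> r" if "t \<in> {0..1}" for t
    using root_path_ball[OF \<rho>(1), of \<xi> t] Xi_roots \<xi> sub x \<rho> that by (auto simp: root_path_def)
  show "x' \<in> ball \<xi> r" using in_ball[of 1] \<rho> by simp
  \<comment> \<open>In the frame that turns by half a revolution the root stays on its side, so it changes sides.\<close>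
  define V where "V t = disp \<xi> (\<rho> t) * cis (- pi * t)" for t
  have "0 < Re ((V t)\<^sup>2)" if t: "t \<in> {0..1}" for t
  proof -
    have "(V t)\<^sup>2 - 1 = ((disp \<xi> (\<rho> t))\<^sup>2 - cis (2 * pi * t)) * cis (- (2 * pi * t))"
      by (simp add: V_def power_mult_distrib Complex.DeMoivre left_diff_distrib cis_mult mult.assoc)
    then have "norm ((V t)\<^sup>2 - 1) = norm ((disp \<xi> (\<rho> t))\<^sup>2 - cis (2 * pi * t))"
      by (simp add: norm_mult)
    also have "\<dots> \<le> \<mu> / 2"
      using disp_square[OF _ t in_ball[OF t]] \<xi> sub turn[OF \<xi> t] unfolding val_def by auto
    finally have "norm ((V t)\<^sup>2 - 1) < 1" using \<mu> by simp
    then show ?thesis using abs_Re_le_cmod[of "(V t)\<^sup>2 - 1"] by simp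
  qed
  then have "Re (V t) \<noteq> 0" if "t \<in> {0..1}" for t using Re_nonzero_if_square that by blast
  moreover have "continuous_on {0..1} (\<lambda>t. Re (V t))"
    unfolding V_def using \<rho>(1)
    by (intro continuous_on_Re continuous_on_mult continuous_disp continuous_on_cis continuous_intros)
      (simp add: root_path_def)
  ultimately have "0 < Re (V 0) * Re (V 1)" by (intro nonzero_same_sign)
  then have "\<not> 0 < Re (disp \<xi> (\<rho> 0)) * Re (disp \<xi> (\<rho> 1))" by (simp add: V_def)
  then show "x' \<noteq> x"
    using opposite_sides[of \<xi> x x] \<xi> sub in_ball[of 0] \<rho> by auto
qed

end

end

section \<open>Permutations of the integers that commute with a translation\<close>

definition periodic_perms :: "int \<Rightarrow> (int \<Rightarrow> int) set"
  where "periodic_perms n = {p. bij p \<and> (\<forall>j. p (j + n) = p j + n)}"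

text \<open>For \<open>n \<ge> 2\<close> these are the simple reflections of the affine symmetric group.\<close>

definition adjacent_swap :: "int \<Rightarrow> int \<Rightarrow> int \<Rightarrow> int"
  where "adjacent_swap n c x =
    (if x mod n = c mod n then x + 1 else if x mod n = (c + 1) mod n then x - 1 else x)"

lemma periodic_perms_add_mult:
  assumes "p \<in> periodic_perms n"
  shows "p (j + n * i) = p j + n * i"
proof (induction i rule: int_induct[where k = 0])
  case (step1 i)
  have "p (j + n * i + n) = p (j + n * i) + n" using assms by (simp add: periodic_perms_def)
  then show ?case using step1 by (simp add: algebra_simps)
next
  case (step2 i)
  have "p (j + n * (i - 1) + n) = p (j + n * (i - 1)) + n" using assms by (simp add: periodic_perms_def)
  then show ?case using step2 by (simp add: algebra_simps)
qed simp

lemma mod_add_no_wrap: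
  fixes x k n :: int
  assumes "0 \<le> x mod n + k" "x mod n + k < n"
  shows "(x + k) mod n = x mod n + k"
  using assms by (metis mod_add_left_eq mod_pos_pos_trivial)

lemma adjacent_swap_periodic:
  assumes n: "2 \<le> n"
  shows "adjacent_swap n c \<in> periodic_perms n"
proof -
  have ne: "(c + 1) mod n \<noteq> c mod n"
    using n by (simp add: mod_eq_dvd_iff zdvd1_eq)
  have "adjacent_swap n c (adjacent_swap n c x) = x" for x
  proof -
    consider "x mod n = c mod n" | "x mod n = (c + 1) mod n"
      | "x mod n \<noteq> c mod n" "x mod n \<noteq> (c + 1) mod n" by blast
    then show ?thesis
    proof cases
      case 1
      then have "(x + 1) mod n = (c + 1) mod n" by (metis mod_add_left_eq)
      then show ?thesis using 1 ne by (simp add: adjacent_swap_def)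
    next
      case 2
      then have "(x - 1) mod n = (c + 1 - 1) mod n" by (metis mod_diff_left_eq)
      then show ?thesis using 2 ne by (simp add: adjacent_swap_def)
    qed (simp add: adjacent_swap_def)
  qed
  then have "bij (adjacent_swap n c)" by (intro involuntory_imp_bij)
  then show ?thesis by (simp add: periodic_perms_def adjacent_swap_def)
qed

text \<open>
  The permutations commuting with translation by \<open>n\<close> form the extended affine symmetric group. It
  is generated by the translation by one and a single swap of two neighbouring residue classes.
\<close>

locale periodic_perm_group =
  fixes n :: int and \<Gamma> :: "(int \<Rightarrow> int) set"
  assumes n: "0 < n"
    and periodic: "\<Gamma> \<subseteq> periodic_perms n"
    and comp: "p \<in> \<Gamma> \<Longrightarrow> q \<in> \<Gamma> \<Longrightarrow> p \<circ> q \<in> \<Gamma>"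
    and inverse: "p \<in> \<Gamma> \<Longrightarrow> inv' p \<in> \<Gamma>"
    and succ: "(\<lambda>j. j + 1) \<in> \<Gamma>"
    and swap: "2 \<le> n \<Longrightarrow> adjacent_swap n (-1) \<in> \<Gamma>"
begin

lemma bij: "p \<in> \<Gamma> \<Longrightarrow> bij p"
  using periodic by (auto simp: periodic_perms_def)

lemma left_cancel:
  assumes "p \<in> \<Gamma>" "p \<circ> q \<in> \<Gamma>"
  shows "q \<in> \<Gamma>"
proof -
  have "inv' p \<circ> (p \<circ> q) = q"
    using bij[OF assms(1)] by (simp add: o_assoc[symmetric] bij_is_inj o_assoc)
  then show ?thesis using comp[OF inverse[OF assms(1)] assms(2)] by simp
qed

lemma translation: "(\<lambda>j. j + i) \<in> \<Gamma>"
proof (induction i rule: int_induct[where k = 0])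
  case base
  show ?case
  proof (rule left_cancel[OF succ])
    show "(\<lambda>j. j + 1) \<circ> (\<lambda>j. j + 0) \<in> \<Gamma>" using succ by (simp add: o_def)
  qed
next
  case (step1 i)
  show ?case using comp[OF succ step1(2)] by (simp add: o_def algebra_simps)
next
  case (step2 i)
  show ?case
  proof (rule left_cancel[OF succ])
    show "(\<lambda>j. j + 1) \<circ> (\<lambda>j. j + (i - 1)) \<in> \<Gamma>" using step2 by (simp add: o_def)
  qed
qed

lemma conj_translation:
  assumes "p \<in> \<Gamma>"
  shows "(\<lambda>j. p (j - i) + i) \<in> \<Gamma>"
  using comp[OF translation[of i] comp[OF assms translation[of "-i"]]] by (simp add: o_def)

lemma adjacent_swap_in: "2 \<le> n \<Longrightarrow> adjacent_swap n c \<in> \<Gamma>"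
proof -
  assume "2 \<le> n"
  have *: "(j - (c + 1)) mod n = (-1) mod n \<longleftrightarrow> j mod n = c mod n"
      "(j - (c + 1)) mod n = 0 mod n \<longleftrightarrow> j mod n = (c + 1) mod n" for j
    by (simp_all only: mod_eq_dvd_iff) (simp_all add: algebra_simps)
  have "(\<lambda>j. adjacent_swap n (-1) (j - (c + 1)) + (c + 1)) = adjacent_swap n c"
    using * by (auto simp: adjacent_swap_def fun_eq_iff)
  then show ?thesis using conj_translation[OF swap[OF \<open>2 \<le> n\<close>], of "c + 1"] by simp
qed

text \<open>The cycle of the residues \<open>0, ..., j\<close>, lifted so that it does not move to another period.\<close>

lemma residue_cycle_in:
  "int j < n \<Longrightarrow>
    (\<lambda>x. if x mod n < int j then x + 1 else if x mod n = int j then x - int j else x) \<in> \<Gamma>"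
proof (induction j)
  case 0
  have "(\<lambda>x. if x mod n < int 0 then x + 1 else if x mod n = int 0 then x - int 0 else x) = (\<lambda>x. x + 0)"
    using n by (auto simp: fun_eq_iff not_less)
  then show ?case using translation[of 0] by simp
next
  case (Suc j)
  let ?B = "\<lambda>j x. if x mod n < int j then x + 1 else if x mod n = int j then x - int j else x"
  have "?B (Suc j) = ?B j \<circ> adjacent_swap n (int j)"
  proof
    fix x
    have j: "int j mod n = int j" "(int j + 1) mod n = int j + 1" using Suc.prems by auto
    consider "x mod n = int j" | "x mod n = int j + 1" | "x mod n \<noteq> int j" "x mod n \<noteq> int j + 1" by blast
    then show "?B (Suc j) x = (?B j \<circ> adjacent_swap n (int j)) x"
    proof cases
      case 1
      then have "(x + 1) mod n = int j + 1" using Suc.prems mod_add_no_wrap[of x n 1] by simp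
      then show ?thesis using 1 j by (simp add: adjacent_swap_def)
    next
      case 2
      then have "(x - 1) mod n = int j" using Suc.prems mod_add_no_wrap[of x n "-1"] by simp
      then show ?thesis using 2 j by (simp add: adjacent_swap_def)
    next
      case 3
      then show ?thesis using j by (simp add: adjacent_swap_def)
    qed
  qed
  moreover have "adjacent_swap n (int j) \<in> \<Gamma>" using Suc.prems by (intro adjacent_swap_in) simp
  ultimately show ?case using comp[OF Suc.IH] Suc.prems by simp
qed

text \<open>
  Translation by one differs from the cycle of all residues only in that it moves the last class
  to the next period; so the quotient of the two shifts one residue class by a period.
\<close>

lemma class_shift_in: "(\<lambda>x. if x mod n = v mod n then x + n * i else x) \<in> \<Gamma>"
proof -
  let ?B = "\<lambda>x. if x mod n < int (nat (n - 1)) then x + 1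
    else if x mod n = int (nat (n - 1)) then x - int (nat (n - 1)) else x"
  let ?D = "\<lambda>v i x. if x mod n = v mod n then x + n * i else x"
  let ?L = "\<lambda>x. if x mod n = n - 1 then x + n else x"
  have B: "?B \<in> \<Gamma>" by (rule residue_cycle_in) (use n in simp)
  have nat_n: "int (nat (n - 1)) = n - 1" using n by simp
  have BL: "?B \<circ> ?L = (\<lambda>x. x + 1)"
  proof
    fix x
    consider "x mod n = n - 1" | "x mod n < n - 1" using pos_mod_bound[OF n, of x] by linarith
    then show "(?B \<circ> ?L) x = x + 1"
      unfolding nat_n o_apply by cases simp_all
  qed
  have D: "?L \<in> \<Gamma>" by (rule left_cancel[OF B]) (unfold BL, rule succ)
  have *: "(x - (v + 1)) mod n = n - 1 \<longleftrightarrow> x mod n = v mod n" for x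
  proof -
    have "n - 1 = (n - 1) mod n" using n by (intro mod_pos_pos_trivial[symmetric]) auto
    then have "(x - (v + 1)) mod n = n - 1 \<longleftrightarrow> n dvd (x - (v + 1)) - (n - 1)"
      by (metis mod_eq_dvd_iff)
    also have "(x - (v + 1)) - (n - 1) = (x - v) - n" by simp
    also have "n dvd (x - v) - n \<longleftrightarrow> n dvd x - v" by (metis dvd_diff_left_iff dvd_refl)
    finally show ?thesis by (simp add: mod_eq_dvd_iff)
  qed
  have "(\<lambda>x. ?L (x - (v + 1)) + (v + 1)) = ?D v 1"
    using * by (auto simp: fun_eq_iff)
  then have D1: "?D v 1 \<in> \<Gamma>" using conj_translation[OF D, of "v + 1"] by simp
  show ?thesis
  proof (induction i rule: int_induct[where k = 0])
    case base
    have "?D v 0 = (\<lambda>x. x + 0)" by auto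
    then show ?case using translation[of 0] by (simp only:)
  next
    case (step1 i)
    have "?D v 1 \<circ> ?D v i = ?D v (i + 1)" by (auto simp: fun_eq_iff algebra_simps)
    then show ?case using comp[OF D1 step1(2)] by simp
  next
    case (step2 i)
    have "?D v 1 \<circ> ?D v (i - 1) = ?D v i" by (auto simp: fun_eq_iff algebra_simps)
    then have "?D v 1 \<circ> ?D v (i - 1) \<in> \<Gamma>" using step2(2) by (simp only:)
    then show ?case by (rule left_cancel[OF D1])
  qed
qed

text \<open>A class moves down to \<open>j\<close> by swaps with its lower neighbours, all of them at least \<open>j\<close>.\<close>

lemma class_move_in:
  assumes "0 \<le> j" "j \<le> v"
  shows "v < n \<Longrightarrow> \<exists>g\<in>\<Gamma>. g v = j \<and> (\<forall>x. x mod n < j \<longrightarrow> g x = x)"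
  using assms(2)
proof (induction v rule: int_ge_induct)
  case base
  then show ?case using translation[of 0] by (intro bexI[of _ "\<lambda>x. x + 0"]) auto
next
  case (step v)
  obtain g where g: "g \<in> \<Gamma>" "g v = j" "\<And>x. x mod n < j \<Longrightarrow> g x = x" using step by auto
  have v: "v mod n = v" "(v + 1) mod n = v + 1" using step assms(1) by auto
  have "adjacent_swap n v \<in> \<Gamma>" using step assms(1) by (intro adjacent_swap_in) simp
  moreover have "(g \<circ> adjacent_swap n v) (v + 1) = j" using v g(2) by (simp add: adjacent_swap_def)
  moreover have "(g \<circ> adjacent_swap n v) x = x" if "x mod n < j" for x
    using v g(3)[OF that] that step(1) by (simp add: adjacent_swap_def)
  ultimately show ?case using comp[OF g(1)] by blast
qed

text \<open>
  One residue class after the other is brought into place: if \<open>p\<close> fixes the first \<open>j\<close> classes, then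
  it can be composed with elements of \<open>\<Gamma>\<close> so that it also fixes the next one.
\<close>

lemma fixing_classes_in:
  assumes "k \<le> nat n" "p \<in> periodic_perms n" "\<And>x. x mod n < n - int k \<Longrightarrow> p x = x"
  shows "p \<in> \<Gamma>"
  using assms
proof (induction k arbitrary: p)
  case 0
  have "p = (\<lambda>x. x + 0)" using 0 n by (auto simp: fun_eq_iff)
  then show ?case using translation[of 0] by simp
next
  case (Suc k)
  define j where "j = n - int (Suc k)"
  have j: "0 \<le> j" "j < n" using Suc.prems(1) by (auto simp: j_def)
  define v where "v = p j mod n"
  define i where "i = p j div n"
  have pj: "p j = v + n * i" by (simp add: v_def i_def)
  have v: "0 \<le> v" "v < n" using n by (auto simp: v_def)
  have fixed: "p x = x" if "x mod n < j" for x using Suc.prems(3) that by (simp add: j_def)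
  have "j \<le> v"
  proof (rule ccontr)
    assume "\<not> j \<le> v"
    then have "p v = v" using fixed[of v] v by simp
    then have "p (v + n * i) = p j" using periodic_perms_add_mult[OF Suc.prems(2)] pj by simp
    then have "j = v + n * i"
      using Suc.prems(2) by (auto simp: periodic_perms_def dest: bij_is_inj[THEN injD])
    then have "j mod n = v" using v by simp
    then show False using j \<open>\<not> j \<le> v\<close> by simp
  qed
  then obtain g where g: "g \<in> \<Gamma>" "g v = j" "\<And>x. x mod n < j \<Longrightarrow> g x = x"
    using class_move_in[of j v] j v by auto
  let ?D = "\<lambda>i x. if x mod n = v mod n then x + n * i else x"
  let ?q = "g \<circ> ?D (- i) \<circ> p"
  have gD: "g \<circ> ?D (- i) \<in> \<Gamma>" by (rule comp[OF g(1) class_shift_in])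
  have per: "?q \<in> periodic_perms n"
  proof -
    have "g \<circ> ?D (- i) \<in> periodic_perms n" using gD periodic by blast
    then show ?thesis using Suc.prems(2) by (auto simp: periodic_perms_def intro: bij_comp)
  qed
  have "?q \<in> \<Gamma>"
  proof (rule Suc.IH[OF _ per])
    fix x assume "x mod n < n - int k"
    then consider "x mod n < j" | "x mod n = j" by (fastforce simp: j_def)
    then show "?q x = x"
    proof cases
      case 1
      then show ?thesis using fixed[OF 1] g(3)[OF 1] v \<open>j \<le> v\<close> by simp
    next
      case 2
      have x: "x = j + n * (x div n)" using 2 by (metis mult_div_mod_eq add.commute)
      have "?q j = j" using pj g(2) v by simp
      then show ?thesis using periodic_perms_add_mult[OF per, of j "x div n"] x by metis
    qed
  qed (use Suc.prems in simp)
  then show ?case using left_cancel[OF gD] by (simp add: o_assoc)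
qed

lemma all_periodic_perms: "\<Gamma> = periodic_perms n"
proof
  show "periodic_perms n \<subseteq> \<Gamma>"
  proof
    fix p assume p: "p \<in> periodic_perms n"
    show "p \<in> \<Gamma>"
    proof (rule fixing_classes_in[of "nat n", OF _ p])
      fix x assume "x mod n < n - int (nat n)"
      moreover have "int (nat n) = n" using n by simp
      ultimately have False using pos_mod_sign[OF n, of x] by linarith
      then show "p x = x" ..
    qed simp
  qed
qed (rule periodic)

end

section \<open>The monodromy of a binomial\<close>

lemma cis_turn_eq_1_iff:
  assumes "0 < N"
  shows "cis (2 * pi * of_int k / of_nat N) = 1 \<longleftrightarrow> int N dvd k"
proof -
  have "cis (2 * pi * of_int k / of_nat N) = 1 \<longleftrightarrow>
      (\<exists>i::int. 2 * pi * of_int k / of_nat N = of_int (2 * i) * pi)"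
    unfolding cis_conv_exp exp_eq_1 by simp
  also have "\<dots> \<longleftrightarrow> (\<exists>i::int. (of_int k :: real) = of_int (int N * i))"
    using assms by (intro ex_cong1) (simp add: field_simps)
  also have "\<dots> \<longleftrightarrow> int N dvd k" by (simp only: of_int_eq_iff dvd_def)
  finally show ?thesis .
qed

lemma root_of_unity_cases:
  fixes w :: complex
  assumes "0 < N" "w ^ N = 1"
  obtains i where "i < N" "w = cis (2 * pi * of_nat i / of_nat N)"
  using bij_betw_imp_surj_on[OF Complex.bij_betw_roots_unity[OF assms(1)]] assms(2) by fastforce

locale support =
  fixes A :: "nat set" and N d n :: nat
  assumes A: "finite A" "0 \<in> A" "N \<in> A" "Max A = N" and N: "0 < N"
    and d: "d = Gcd A" and n: "N = n * d"
begin

abbreviation S :: "complex poly set"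
  where "S \<equiv> poly_space A \<inter> simple_polys N"

lemma pos: "0 < d" "0 < n"
  using N n by auto

lemma S_simple: "S \<subseteq> simple_polys N"
  by blast

lemma poly_rotate:
  assumes "h \<in> poly_space A" and c: "\<And>i. i \<in> A \<Longrightarrow> c ^ i = 1"
  shows "poly h (c * x) = poly h x"
proof -
  have "coeff h i * (c * x) ^ i = coeff h i * x ^ i" for i
    using assms by (cases "coeff h i = 0") (auto simp: poly_space_def power_mult_distrib)
  then show ?thesis by (simp only: poly_altdef)
qed

lemma rotation_power:
  assumes "i \<in> A"
  shows "cis (2 * pi / d) ^ i = 1"
proof -
  have "d dvd i" using assms d Gcd_dvd by blast
  then show ?thesis using cis_turn_eq_1_iff[OF pos(1), of "int i"] by (simp add: Complex.DeMoivre mult_ac)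
qed

lemma rotation_roots:
  assumes "h \<in> S" "x \<in> roots h"
  shows "cis (2 * pi / d) * x \<in> roots h"
  using poly_rotate[of h "cis (2 * pi / d)" x] rotation_power assms by (simp add: roots_def)

lemma transport_rotation:
  assumes "transport S f g \<sigma>" "x \<in> roots f"
  shows "\<sigma> (cis (2 * pi / d) * x) = cis (2 * pi / d) * \<sigma> x"
  using transport_commutes_mult[OF assms(1) S_simple N _ assms(2)] rotation_roots by blast

end

locale binomial = support +
  fixes \<alpha> \<beta> :: real
  assumes \<alpha>: "0 < \<alpha>" and \<beta>: "0 < \<beta>"
begin

definition b :: "complex poly"
  where "b = monom (of_real \<alpha>) N + [:of_real \<beta>:]"

text \<open>The roots, enumerated periodically and counterclockwise by the integers.\<close>

definition z :: "int \<Rightarrow> complex"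
  where "z j = of_real (root N (\<beta> / \<alpha>)) * cis (pi * (2 * of_int j + 1) / N)"

lemma z_shift: "z (j + i) = cis (2 * pi * of_int i / N) * z j"
proof -
  have "pi * (2 * of_int (j + i) + 1) / N = 2 * pi * of_int i / N + pi * (2 * of_int j + 1) / N"
    by (simp add: add_divide_distrib algebra_simps)
  then show ?thesis by (simp add: z_def flip: cis_mult)
qed

lemma z_nonzero: "z j \<noteq> 0"
  using \<alpha> \<beta> N by (simp add: z_def)

lemma z_eq_iff: "z i = z j \<longleftrightarrow> int N dvd i - j"
proof -
  have "z i = cis (2 * pi * of_int (i - j) / N) * z j" using z_shift[of j "i - j"] by simp
  then have "z i = z j \<longleftrightarrow> cis (2 * pi * of_int (i - j) / N) = 1" using z_nonzero[of j] by simp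
  then show ?thesis by (simp only: cis_turn_eq_1_iff[OF N])
qed

lemma z_power: "z j ^ N = - of_real (\<beta> / \<alpha>)"
proof -
  have "of_nat N * (pi * (2 * of_int j + 1) / N) = 2 * pi * of_int j + pi"
    using N by (simp add: field_simps)
  then have "cis (pi * (2 * of_int j + 1) / N) ^ N = cis (2 * pi * of_int j) * cis pi"
    by (simp only: Complex.DeMoivre cis_mult)
  also have "\<dots> = - 1" by simp
  finally have "cis (pi * (2 * of_int j + 1) / N) ^ N = - 1" .
  moreover have "of_real (root N (\<beta> / \<alpha>)) ^ N = (of_real (\<beta> / \<alpha>) :: complex)"
    using \<alpha> \<beta> N by (simp flip: of_real_power)
  ultimately show ?thesis by (simp add: z_def power_mult_distrib)
qed

lemma poly_b: "poly b x = of_real \<alpha> * x ^ N + of_real \<beta>"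
  by (simp add: b_def poly_monom)

lemma roots_b: "roots b = range z"
proof -
  have "x ^ N = z 0 ^ N \<longleftrightarrow> poly b x = 0" for x
  proof -
    have "poly b x = of_real \<alpha> * (x ^ N + of_real (\<beta> / \<alpha>))"
      using \<alpha> by (simp add: poly_b algebra_simps)
    then show ?thesis using \<alpha> by (simp add: z_power eq_neg_iff_add_eq_0)
  qed
  moreover have "x \<in> range z" if "x ^ N = z 0 ^ N" for x
  proof -
    have "(x / z 0) ^ N = 1" using that z_nonzero[of 0] by (simp add: power_divide)
    then obtain i where "x / z 0 = cis (2 * pi * of_nat i / N)" using root_of_unity_cases[OF N] by blast
    then have "x = z (int i)" using z_shift[of 0 "int i"] z_nonzero[of 0] by (simp add: field_simps)
    then show ?thesis by blast
  qed
  moreover have "z j ^ N = z 0 ^ N" for j by (simp only: z_power)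
  ultimately show ?thesis by (auto simp: roots_def)
qed

lemma b_S: "b \<in> S"
proof -
  have "b \<in> poly_space A" using A by (auto simp: b_def poly_space_def coeff_pCons split: nat.splits)
  moreover have "degree b = N"
    unfolding b_def using \<alpha> N by (subst degree_add_eq_left) (auto simp: degree_monom_eq)
  moreover have "poly (pderiv b) x \<noteq> 0" if "poly b x = 0" for x
  proof -
    have "x \<in> roots b" using that by (simp add: roots_def)
    then have "x \<noteq> 0" using z_nonzero unfolding roots_b by auto
    then show ?thesis using \<alpha> N by (simp add: b_def pderiv_add pderiv_monom pderiv_pCons poly_monom)
  qed
  ultimately show ?thesis by (simp add: simple_polys_iff)
qed

text \<open>Turning the constant term once around the origin moves every root to the next one.\<close>

lemma transport_succ: "transport S b b (\<lambda>x. cis (2 * pi / N) * x)"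
proof -
  define \<gamma> where "\<gamma> t = monom (of_real \<alpha>) N + [:of_real \<beta> * cis (2 * pi * t):]" for t
  have rot: "poly (\<gamma> t) (cis (2 * pi * t / N) * x) = cis (2 * pi * t) * poly b x" for t x
    using N by (simp add: \<gamma>_def poly_b poly_monom power_mult_distrib Complex.DeMoivre algebra_simps)
  have "\<gamma> t \<in> S" for t
  proof -
    have "\<gamma> t \<in> poly_space A" using A by (auto simp: \<gamma>_def poly_space_def coeff_pCons split: nat.splits)
    moreover have "degree (\<gamma> t) = N"
      unfolding \<gamma>_def using \<alpha> N by (subst degree_add_eq_left) (auto simp: degree_monom_eq)
    moreover have "poly (pderiv (\<gamma> t)) x \<noteq> 0" if "poly (\<gamma> t) x = 0" for x
    proof -
      have "x \<noteq> 0" using that \<beta> N by (auto simp: \<gamma>_def poly_monom power_0_left)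
      then show ?thesis using \<alpha> N by (simp add: \<gamma>_def pderiv_add pderiv_monom pderiv_pCons poly_monom)
    qed
    ultimately show ?thesis by (simp add: simple_polys_iff)
  qed
  moreover have "path (\<lambda>t. coeff (\<gamma> t) i)" for i
  proof -
    have "continuous_on {0..1} (\<lambda>t. coeff [:of_real \<beta> * cis (2 * pi * t):] i)"
      by (cases i) (auto intro!: continuous_on_mult continuous_on_cis)
    then show ?thesis
      unfolding \<gamma>_def path_def coeff_add by (intro continuous_on_add continuous_on_const)
  qed
  ultimately have "poly_path S \<gamma>" by (auto simp: poly_path_def)
  moreover have "\<gamma> 0 = b" "\<gamma> 1 = b" by (simp_all add: \<gamma>_def b_def)
  moreover have "follows \<gamma> x (cis (2 * pi / N) * x)" if "x \<in> roots b" for x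
    unfolding follows_def root_path_def
  proof (intro exI conjI ballI)
    show "path (\<lambda>t. cis (2 * pi * t / N) * x)"
      unfolding path_def by (intro continuous_intros) (use N in auto)
    show "cis (2 * pi * t / N) * x \<in> roots (\<gamma> t)" for t
      using that rot[of t x] by (simp add: roots_def)
  qed auto
  ultimately show ?thesis unfolding transport_def by blast
qed

text \<open>
  Lifting permutations of the roots to permutations of the integers turns the condition to commute
  with the rotation by \<open>2 \<pi> / d\<close> into periodicity, for which generators were determined above.
\<close>

definition realized :: "(int \<Rightarrow> int) set"
  where "realized = {p \<in> periodic_perms (int n). \<exists>\<sigma>. transport S b b \<sigma> \<and> (\<forall>j. \<sigma> (z j) = z (p j))}"

lemma realized_group:
  assumes swap: "2 \<le> n \<Longrightarrow> adjacent_swap (int n) (-1) \<in> realized"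
  shows "periodic_perm_group (int n) realized"
proof
  show "0 < int n" using pos by simp
  show "realized \<subseteq> periodic_perms (int n)" by (auto simp: realized_def)
  show "adjacent_swap (int n) (-1) \<in> realized" if "2 \<le> int n" using swap that by simp
  show "p \<circ> q \<in> realized" if p: "p \<in> realized" and q: "q \<in> realized" for p q
  proof -
    obtain \<sigma> \<tau> where "transport S b b \<sigma>" "\<And>j. \<sigma> (z j) = z (p j)"
        and "transport S b b \<tau>" "\<And>j. \<tau> (z j) = z (q j)"
      using p q unfolding realized_def by blast
    then have "transport S b b (\<sigma> \<circ> \<tau>) \<and> (\<forall>j. (\<sigma> \<circ> \<tau>) (z j) = z ((p \<circ> q) j))"
      using transport_comp by simp
    moreover have "p \<circ> q \<in> periodic_perms (int n)"
      using p q by (auto simp: realized_def periodic_perms_def intro: bij_comp)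
    ultimately show ?thesis unfolding realized_def by blast
  qed
  show "inv' p \<in> realized" if p: "p \<in> realized" for p
  proof -
    obtain \<sigma> where \<sigma>: "transport S b b \<sigma>" "\<And>j. \<sigma> (z j) = z (p j)"
      using p unfolding realized_def by blast
    have bp: "bij p" and per: "\<And>j. p (j + int n) = p j + int n"
      using p by (auto simp: realized_def periodic_perms_def)
    have inj: "inj_on \<sigma> (roots b)" using transport_bij[OF \<sigma>(1) S_simple N] by (simp add: bij_betw_def)
    let ?\<tau> = "inv_into (roots b) \<sigma>"
    have "transport S b b ?\<tau>"
      using transport_inverse[OF \<sigma>(1) S_simple N] inj by simp
    moreover have "?\<tau> (z j) = z (inv' p j)" for j
    proof -
      have "\<sigma> (z (inv' p j)) = z j" using \<sigma>(2) bp by (simp add: bij_is_surj surj_f_inv_f)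
      then show ?thesis using inv_into_f_eq[OF inj] roots_b by blast
    qed
    moreover have "inv' p \<in> periodic_perms (int n)"
    proof -
      have "inv' p (j + int n) = inv' p j + int n" for j
      proof -
        have "p (inv' p j + int n) = j + int n" using per bp by (simp add: bij_is_surj surj_f_inv_f)
        then show ?thesis using bp by (metis bij_is_inj inv_f_f)
      qed
      then show ?thesis using bp by (simp add: periodic_perms_def bij_imp_bij_inv)
    qed
    ultimately show ?thesis unfolding realized_def by blast
  qed
  show "(\<lambda>j. j + 1) \<in> realized"
  proof -
    have "bij (\<lambda>j::int. j + 1)" by (rule bij_betw_byWitness[of _ "\<lambda>j. j - 1"]) auto
    moreover have "cis (2 * pi / N) * z j = z (j + 1)" for j using z_shift[of j 1] by simp
    ultimately show ?thesis
      unfolding realized_def periodic_perms_def using transport_succ by force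
  qed
qed

lemma z_period: "z (j + int n) = cis (2 * pi / d) * z j"
  using z_shift[of j "int n"] n pos by (simp add: field_simps)

lemma lift_to_periodic_perm:
  assumes bij: "bij_betw \<pi> (roots b) (roots b)"
    and comm: "\<And>x. x \<in> roots b \<Longrightarrow> \<pi> (cis (2 * pi / d) * x) = cis (2 * pi / d) * \<pi> x"
  shows "\<exists>p\<in>periodic_perms (int n). \<forall>j. \<pi> (z j) = z (p j)"
proof -
  let ?n = "int n"
  have zb: "z j \<in> roots b" for j by (simp add: roots_b)
  have "\<exists>i. \<pi> (z j) = z i" for j using bij_betwE[OF bij] zb roots_b by blast
  then obtain p0 where p0: "\<And>j. \<pi> (z j) = z (p0 j)" by metis
  \<comment> \<open>The lift is chosen on one period and extended so that it commutes with translation by \<open>n\<close>.\<close>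
  define p where "p j = p0 (j mod ?n) + ?n * (j div ?n)" for j
  have shift: "\<pi> (z (j + ?n * i)) = z (q + ?n * i)" if "\<pi> (z j) = z q" for j q i
  proof (induction i rule: int_induct[where k = 0])
    case (step1 i)
    have "\<pi> (z (j + ?n * (i + 1))) = cis (2 * pi / d) * \<pi> (z (j + ?n * i))"
      using comm[OF zb, of "j + ?n * i"] z_period[of "j + ?n * i"] by (simp add: algebra_simps)
    then show ?case using step1 z_period[of "q + ?n * i"] by (simp add: algebra_simps)
  next
    case (step2 i)
    have "cis (2 * pi / d) * \<pi> (z (j + ?n * (i - 1))) = \<pi> (z (j + ?n * i))"
      using comm[OF zb, of "j + ?n * (i - 1)"] z_period[of "j + ?n * (i - 1)"] by (simp add: algebra_simps)
    also have "\<dots> = cis (2 * pi / d) * z (q + ?n * (i - 1))"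
      using step2 z_period[of "q + ?n * (i - 1)"] by (simp add: algebra_simps)
    finally show ?case by simp
  qed (use that in simp)
  have p: "\<pi> (z j) = z (p j)" for j
    using shift[OF p0[of "j mod ?n"], of "j div ?n"] by (simp add: p_def)
  have per: "p (j + ?n) = p j + ?n" for j
    using pos by (simp add: p_def algebra_simps)
  have perN: "p (j + int N * i) = p j + int N * i" for j i
  proof -
    have "p (j + ?n * i) = p j + ?n * i" for i
      using pos by (simp add: p_def algebra_simps)
    from this[of "int d * i"] show ?thesis using n by (simp add: mult.assoc)
  qed
  have "inj p"
  proof (rule injI)
    fix j j' assume eq: "p j = p j'"
    then have "\<pi> (z j) = \<pi> (z j')" using p by simp
    then have "z j = z j'" using bij zb by (metis bij_betw_imp_inj_on inj_onD)
    then obtain i where i: "j = j' + int N * i" unfolding z_eq_iff dvd_def by (metis add.commute diff_add_cancel)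
    then have "int N * i = 0" using eq perN[of j' i] by simp
    then show "j = j'" using i by simp
  qed
  moreover have "surj p"
  proof -
    have "y \<in> range p" for y
    proof -
      have "z y \<in> \<pi> ` roots b" using bij zb by (simp add: bij_betw_def)
      then obtain j where "z y = z (p j)" using roots_b p by auto
      then obtain i where "y = p j + int N * i" unfolding z_eq_iff dvd_def by (metis add.commute diff_add_cancel)
      then have "y = p (j + int N * i)" using perN by simp
      then show ?thesis by blast
    qed
    then show ?thesis by auto
  qed
  ultimately show ?thesis using p per unfolding periodic_perms_def bij_def by blast
qed

text \<open>One swap of neighbouring necklaces therefore suffices to obtain every admissible permutation.\<close>

lemma transport_all:
  assumes swap: "2 \<le> n \<Longrightarrow> adjacent_swap (int n) (-1) \<in> realized"
    and bij: "bij_betw \<pi> (roots b) (roots b)"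
    and comm: "\<And>x. x \<in> roots b \<Longrightarrow> \<pi> (cis (2 * pi / d) * x) = cis (2 * pi / d) * \<pi> x"
  shows "transport S b b \<pi>"
proof -
  obtain p where p: "p \<in> periodic_perms (int n)" "\<And>j. \<pi> (z j) = z (p j)"
    using lift_to_periodic_perm[OF bij comm] by blast
  have "p \<in> realized" using periodic_perm_group.all_periodic_perms[OF realized_group[OF swap]] p by simp
  then obtain \<sigma> where "transport S b b \<sigma>" "\<And>j. \<sigma> (z j) = z (p j)" unfolding realized_def by blast
  then show ?thesis
    using p(2) by (intro transport_cong[of S b b \<sigma> \<pi>]) (auto simp: roots_b)
qed

end

section \<open>A family of trinomials acquiring double roots\<close>

definition sinc :: "real \<Rightarrow> real"
  where "sinc x = (if x = 0 then 1 else sin x / x)"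

lemma sin_eq_sinc: "sin x = x * sinc x"
  by (simp add: sinc_def)

lemma isCont_sinc: "isCont sinc x"
proof (cases "x = 0")
  case True
  have "((\<lambda>y. (sin y - sin 0) / (y - 0)) \<longlongrightarrow> cos 0) (at (0::real))"
    using DERIV_sin[of 0] unfolding has_field_derivative_iff .
  then have "((\<lambda>y. sin y / y) \<longlongrightarrow> 1) (at (0::real))" by simp
  then have "(sinc \<longlongrightarrow> 1) (at 0)"
    by (rule Lim_transform_eventually) (simp add: eventually_at_filter sinc_def)
  moreover have "sinc 0 = 1" by (simp add: sinc_def)
  ultimately show ?thesis using True by (simp add: isCont_def)
next
  case False
  have "\<forall>\<^sub>F y in nhds x. y \<noteq> 0" using False t1_space_nhds by blast
  then have "\<forall>\<^sub>F y in nhds x. sin y / y = sinc y" by eventually_elim (simp add: sinc_def)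
  moreover have "isCont (\<lambda>y. sin y / y) x" using False by (intro continuous_intros) auto
  ultimately show ?thesis using isCont_cong[of "\<lambda>y. sin y / y" sinc x] by simp
qed

lemma continuous_on_sinc: "continuous_on S f \<Longrightarrow> continuous_on S (\<lambda>x. sinc (f x))"
  using continuous_on_compose2[of UNIV sinc S f] isCont_sinc
  by (auto simp: continuous_on_eq_continuous_at)

lemma sinc_pos: "0 \<le> x \<Longrightarrow> x < pi \<Longrightarrow> 0 < sinc x"
  by (auto simp: sinc_def sin_gt_zero)

lemma sinc_strict_decreasing:
  assumes "0 < x" "x < y" "y \<le> pi"
  shows "sinc y < sinc x"
proof -
  have key: "t * cos t < sin t" if t: "0 < t" "t \<le> pi" for t
  proof -
    have "(\<lambda>t. sin t - t * cos t) 0 < (\<lambda>t. sin t - t * cos t) t"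
    proof (rule DERIV_pos_imp_increasing_open[OF t(1)])
      fix s assume "0 < s" "s < t"
      then have "((\<lambda>t. sin t - t * cos t) has_real_derivative s * sin s) (at s)" "0 < s * sin s"
        using t by (auto intro!: derivative_eq_intros mult_pos_pos sin_gt_zero)
      then show "\<exists>l. ((\<lambda>t. sin t - t * cos t) has_real_derivative l) (at s) \<and> 0 < l" by blast
    qed (intro continuous_intros)
    then show ?thesis by simp
  qed
  have "(\<lambda>t. sin t / t) y < (\<lambda>t. sin t / t) x"
  proof (rule DERIV_neg_imp_decreasing[OF assms(2)])
    fix t assume t: "x \<le> t" "t \<le> y"
    then have "((\<lambda>t. sin t / t) has_real_derivative (cos t * t - sin t * 1) / (t * t)) (at t)"
      using assms(1) by (intro derivative_eq_intros) auto
    moreover have "(cos t * t - sin t * 1) / (t * t) < 0"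
      using key[of t] t assms by (intro divide_neg_pos) (auto simp: mult.commute)
    ultimately show "\<exists>l. ((\<lambda>t. sin t / t) has_real_derivative l) (at t) \<and> l < 0" by blast
  qed
  then show ?thesis using assms by (simp add: sinc_def)
qed

lemma double_root_factor:
  fixes f :: "complex poly"
  assumes "poly f \<xi> = 0" "poly (pderiv f) \<xi> = 0" "poly (pderiv (pderiv f)) \<xi> \<noteq> 0"
  shows "\<exists>K. f = [:- \<xi>, 1:]\<^sup>2 * K \<and> poly K \<xi> \<noteq> 0"
proof -
  have lin: "pderiv [:- \<xi>, 1:] = 1" by (simp add: pderiv_pCons one_pCons)
  obtain g where g: "f = [:- \<xi>, 1:] * g" using assms(1) by (auto simp: poly_eq_0_iff_dvd dvd_def)
  have "poly (pderiv f) \<xi> = poly g \<xi>" unfolding g pderiv_mult lin by simp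
  then obtain K where K: "g = [:- \<xi>, 1:] * K" using assms(2) by (auto simp: poly_eq_0_iff_dvd dvd_def)
  have "poly (pderiv (pderiv f)) \<xi> = 2 * poly K \<xi>"
    unfolding g K pderiv_mult pderiv_add lin pderiv_1 by simp
  then have "poly K \<xi> \<noteq> 0" using assms(3) by simp
  moreover have "f = [:- \<xi>, 1:]\<^sup>2 * K" unfolding g K power2_eq_square by (simp only: mult.assoc)
  ultimately show ?thesis by blast
qed

locale trinomial = support +
  fixes m :: nat
  assumes m: "m \<in> A" "0 < m" "m < N"
begin

sublocale binomial A N d n "of_nat m" "of_nat N - of_nat m"
  by unfold_locales (use m in auto)

definition tri :: "real \<Rightarrow> complex poly"
  where "tri s = monom (of_nat m) N + monom (- of_real s * of_nat N) m + [:of_nat N - of_nat m:]"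

lemma poly_tri: "poly (tri s) x = of_nat m * x ^ N - of_real s * of_nat N * x ^ m + (of_nat N - of_nat m)"
  by (simp add: tri_def poly_monom)

lemma tri_0: "tri 0 = b"
  by (simp add: tri_def b_def)

lemma degree_tri: "degree (tri s) = N"
proof -
  have "degree (monom (- of_real s * of_nat N) m + [:of_nat N - of_nat m:] :: complex poly) < N"
    using m by (intro degree_add_less) (auto intro: le_less_trans[OF degree_monom_le])
  then show ?thesis
    unfolding tri_def add.assoc using m by (subst degree_add_eq_left) (auto simp: degree_monom_eq)
qed

lemma tri_poly_space: "tri s \<in> poly_space A"
  using A m by (auto simp: tri_def poly_space_def coeff_pCons split: nat.splits if_splits)

lemma multiple_root_tri:
  assumes "poly (tri s) x = 0" "poly (pderiv (tri s)) x = 0"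
  shows "x ^ N = 1" "of_real s * x ^ m = 1"
proof -
  have "of_nat m * of_nat N * x ^ (N - 1) = of_real s * of_nat N * of_nat m * x ^ (m - 1)"
    using assms(2) by (auto simp: tri_def pderiv_add pderiv_monom pderiv_pCons poly_monom)
  then have "x * x ^ (N - 1) = of_real s * (x * x ^ (m - 1))" using m N by auto
  then have xN: "x ^ N = of_real s * x ^ m" using m N by (simp flip: power_Suc)
  then have "(of_nat N - of_nat m) * (1 - of_real s * x ^ m) = 0"
    using assms(1) by (simp add: poly_tri algebra_simps)
  then show "of_real s * x ^ m = 1" using m by simp
  then show "x ^ N = 1" using xN by simp
qed

lemma tri_S:
  assumes "0 \<le> s" "s \<noteq> 1"
  shows "tri s \<in> S"
proof -
  have "poly (pderiv (tri s)) x \<noteq> 0" if "poly (tri s) x = 0" for x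
  proof
    assume "poly (pderiv (tri s)) x = 0"
    then have x: "x ^ N = 1" "of_real s * x ^ m = 1" using multiple_root_tri that by blast+
    have "norm x = 1" using arg_cong[OF x(1), of norm] N power_eq_imp_eq_base[of "norm x" N 1]
      by (simp add: norm_power)
    then show False using arg_cong[OF x(2), of norm] assms by (simp add: norm_mult norm_power)
  qed
  then show ?thesis using tri_poly_space degree_tri by (simp add: simple_polys_iff)
qed

text \<open>
  A root of \<open>tri s\<close> with argument \<open>\<phi>\<close> determines its absolute value and \<open>s\<close>, because two of the three
  terms can be made real by a rotation. As \<open>\<phi>\<close> decreases from \<open>\<pi> / N\<close> to \<open>0\<close>, this root moves from
  the root \<open>z 0\<close> of the binomial to the double root \<open>1\<close> of \<open>tri 1\<close>; the conjugate root does the same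
  from \<open>z (-1)\<close>.
\<close>

definition modulus :: "real \<Rightarrow> real"
  where "modulus \<phi> = root N (sinc (real m * \<phi>) / sinc ((real N - real m) * \<phi>))"

definition param :: "real \<Rightarrow> real"
  where "param \<phi> = sinc (real N * \<phi>) / (modulus \<phi> ^ m * sinc ((real N - real m) * \<phi>))"

definition arc :: "real \<Rightarrow> complex"
  where "arc \<phi> = of_real (modulus \<phi>) * cis \<phi>"

lemma angle_bounds:
  assumes "0 \<le> \<phi>" "\<phi> \<le> pi / N"
  shows "real m * \<phi> < pi" "(real N - real m) * \<phi> < pi" "real N * \<phi> \<le> pi"
proof -
  have N\<phi>: "real N * \<phi> \<le> pi" using assms(2) N by (simp add: field_simps)
  then show "real N * \<phi> \<le> pi" .
  show "real m * \<phi> < pi"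
  proof (cases "\<phi> = 0")
    case False
    then have "real m * \<phi> < real N * \<phi>" using assms(1) m by simp
    then show ?thesis using N\<phi> by simp
  qed simp
  show "(real N - real m) * \<phi> < pi"
  proof (cases "\<phi> = 0")
    case False
    then have "(real N - real m) * \<phi> < real N * \<phi>" using assms(1) m by (intro mult_strict_right_mono) auto
    then show ?thesis using N\<phi> by simp
  qed simp
qed

lemma sincs_pos:
  assumes "0 \<le> \<phi>" "\<phi> \<le> pi / N"
  shows "0 < sinc (real m * \<phi>)" "0 < sinc ((real N - real m) * \<phi>)"
  using angle_bounds[OF assms] assms(1) m by (auto intro!: sinc_pos)

lemma modulus_pos: "0 \<le> \<phi> \<Longrightarrow> \<phi> \<le> pi / N \<Longrightarrow> 0 < modulus \<phi>"
  unfolding modulus_def using sincs_pos N by (intro real_root_gt_zero divide_pos_pos) auto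

lemma modulus_power:
  "0 \<le> \<phi> \<Longrightarrow> \<phi> \<le> pi / N \<Longrightarrow> modulus \<phi> ^ N = sinc (real m * \<phi>) / sinc ((real N - real m) * \<phi>)"
  unfolding modulus_def using sincs_pos[of \<phi>] N by (intro real_root_pow_pos2) auto

text \<open>
  Multiplied by the common denominator and by \<open>\<phi>\<close>, the equation becomes the identity
  \<open>sin(m \<phi>) exp(i N \<phi>) - sin(N \<phi>) exp(i m \<phi>) + sin((N - m) \<phi>) = 0\<close>.
\<close>

lemma arc_root:
  assumes \<phi>: "0 \<le> \<phi>" "\<phi> \<le> pi / N"
  shows "poly (tri (param \<phi>)) (arc \<phi>) = 0"
proof -
  let ?P = "sinc (real m * \<phi>)" and ?Q = "sinc ((real N - real m) * \<phi>)" and ?T = "sinc (real N * \<phi>)"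
  have Q: "?Q \<noteq> 0" using sincs_pos[OF \<phi>] by simp
  have r: "modulus \<phi> \<noteq> 0" using modulus_pos[OF \<phi>] by simp
  have N_term: "arc \<phi> ^ N = of_real (?P / ?Q) * cis (real N * \<phi>)"
    unfolding arc_def power_mult_distrib Complex.DeMoivre of_real_power[symmetric] modulus_power[OF \<phi>] ..
  have "param \<phi> * modulus \<phi> ^ m = ?T / ?Q" using Q r by (simp add: param_def)
  then have m_term: "of_real (param \<phi>) * arc \<phi> ^ m = of_real (?T / ?Q) * cis (real m * \<phi>)"
    unfolding arc_def power_mult_distrib Complex.DeMoivre
    by (metis mult.assoc of_real_mult of_real_power)
  have "of_real ?Q * poly (tri (param \<phi>)) (arc \<phi>) =
      of_real ?Q * (of_nat m * arc \<phi> ^ N - of_nat N * (of_real (param \<phi>) * arc \<phi> ^ m) + (of_nat N - of_nat m))"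
    by (simp add: poly_tri algebra_simps)
  also have "\<dots> = of_real (real m * ?P) * cis (real N * \<phi>) - of_real (real N * ?T) * cis (real m * \<phi>) + of_real ((real N - real m) * ?Q)"
    unfolding N_term m_term using Q by (simp add: field_simps)
  also have "\<dots> = 0"
  proof (cases "\<phi> = 0")
    case False
    have "of_real \<phi> * (of_real (real m * ?P) * cis (real N * \<phi>) - of_real (real N * ?T) * cis (real m * \<phi>) + of_real ((real N - real m) * ?Q)) =
        of_real (sin (real m * \<phi>)) * cis (real N * \<phi>) - of_real (sin (real N * \<phi>)) * cis (real m * \<phi>) + of_real (sin ((real N - real m) * \<phi>))"
      unfolding sin_eq_sinc by (simp add: algebra_simps)
    also have "\<dots> = 0"
    proof -
      have "sin ((real N - real m) * \<phi>) = sin (real N * \<phi>) * cos (real m * \<phi>) - cos (real N * \<phi>) * sin (real m * \<phi>)"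
        by (simp add: left_diff_distrib sin_diff)
      then show ?thesis by (simp add: complex_eq_iff)
    qed
    finally show ?thesis using False by simp
  qed (simp add: sinc_def)
  finally show ?thesis using Q by simp
qed

lemma param_nonneg: "0 \<le> \<phi> \<Longrightarrow> \<phi> \<le> pi / N \<Longrightarrow> 0 \<le> param \<phi>"
proof -
  assume \<phi>: "0 \<le> \<phi>" "\<phi> \<le> pi / N"
  have "0 \<le> sinc (real N * \<phi>)"
    using angle_bounds(3)[OF \<phi>] \<phi>(1) by (auto simp: sinc_def intro!: sin_ge_zero divide_nonneg_nonneg)
  then show ?thesis
    unfolding param_def using modulus_pos[OF \<phi>] sincs_pos[OF \<phi>] by (intro divide_nonneg_pos mult_pos_pos) auto
qed

text \<open>
  Since \<open>sinc\<close> decreases, \<open>sinc(N \<phi>)\<close> is smaller than both \<open>sinc(m \<phi>)\<close> and \<open>sinc((N - m) \<phi>)\<close>; one or the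
  other comparison suffices, depending on whether the modulus is below \<open>1\<close>.
\<close>

lemma param_less_1:
  assumes "0 < \<phi>" "\<phi> \<le> pi / N"
  shows "param \<phi> < 1"
proof -
  let ?P = "sinc (real m * \<phi>)" and ?Q = "sinc ((real N - real m) * \<phi>)" and ?T = "sinc (real N * \<phi>)" and ?r = "modulus \<phi>"
  have \<phi>: "0 \<le> \<phi>" "\<phi> \<le> pi / N" using assms by auto
  have PQ: "0 < ?P" "0 < ?Q" using sincs_pos[OF \<phi>] by auto
  have r: "0 < ?r" by (rule modulus_pos[OF \<phi>])
  have TP: "?T < ?P" using angle_bounds(3)[OF \<phi>] assms m by (intro sinc_strict_decreasing) auto
  have "(real N - real m) * \<phi> < real N * \<phi>" using assms m by (intro mult_strict_right_mono) auto
  then have TQ: "?T < ?Q" using angle_bounds(3)[OF \<phi>] assms m by (intro sinc_strict_decreasing) auto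
  have "?T < ?r ^ m * ?Q"
  proof (cases "1 \<le> ?r")
    case True
    then have "1 * ?Q \<le> ?r ^ m * ?Q" using PQ by (intro mult_right_mono) auto
    then show ?thesis using TQ by simp
  next
    case False
    have "?r ^ (N - m) * (?r ^ m * ?Q) = ?r ^ N * ?Q" using m by (simp flip: power_add mult.assoc)
    also have "\<dots> = ?P" using modulus_power[OF \<phi>] PQ by simp
    finally have P: "?P = ?r ^ (N - m) * (?r ^ m * ?Q)" ..
    have "?r ^ (N - m) * (?r ^ m * ?Q) \<le> 1 * (?r ^ m * ?Q)"
      using False r PQ by (intro mult_right_mono power_le_one) auto
    then show ?thesis using TP P by simp
  qed
  then show ?thesis unfolding param_def using r PQ by simp
qed

lemma continuous_modulus: "continuous_on {0..pi / N} modulus"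
  unfolding modulus_def
proof (intro continuous_on_real_root continuous_on_divide continuous_on_sinc continuous_on_mult
    continuous_on_const continuous_on_id ballI)
  show "sinc ((real N - real m) * \<phi>) \<noteq> 0" if "\<phi> \<in> {0..pi / N}" for \<phi>
    using sincs_pos(2)[of \<phi>] that by auto
qed

lemma continuous_param: "continuous_on {0..pi / N} param"
  unfolding param_def
proof (intro continuous_on_divide continuous_on_sinc continuous_on_mult continuous_on_power
    continuous_modulus continuous_on_const continuous_on_id ballI)
  show "modulus \<phi> ^ m * sinc ((real N - real m) * \<phi>) \<noteq> 0" if "\<phi> \<in> {0..pi / N}" for \<phi>
    using sincs_pos(2)[of \<phi>] modulus_pos[of \<phi>] that by auto
qed

lemma continuous_arc: "continuous_on {0..pi / N} arc"
  unfolding arc_def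
  by (intro continuous_on_mult continuous_on_of_real continuous_modulus continuous_on_cis continuous_on_id)

lemma start_values: "param 0 = 1" "arc 0 = 1"
  using N by (auto simp: param_def arc_def modulus_def sinc_def)

lemma end_values: "param (pi / N) = 0" "arc (pi / N) = z 0" "cnj (arc (pi / N)) = z (- 1)"
proof -
  show "param (pi / N) = 0" using N by (simp add: param_def sinc_def)
  let ?a = "real m * (pi / N)"
  have eq: "(real N - real m) * (pi / N) = pi - ?a" using N by (simp add: field_simps)
  have ne: "?a \<noteq> 0" "pi - ?a \<noteq> 0" "sin ?a \<noteq> 0"
  proof -
    have "0 < ?a" "?a < pi" using m N by (auto simp: field_simps)
    then show "?a \<noteq> 0" "pi - ?a \<noteq> 0" "sin ?a \<noteq> 0" using sin_gt_zero[of ?a] m N by auto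
  qed
  have "sinc ?a / sinc ((real N - real m) * (pi / N)) = (pi - ?a) / ?a"
    unfolding eq sinc_def using ne by simp
  also have "\<dots> = (real N - real m) / real m" using m N by (simp add: field_simps)
  finally have r: "modulus (pi / N) = root N ((real N - real m) / real m)" by (simp add: modulus_def)
  then show "arc (pi / N) = z 0" by (simp add: arc_def z_def)
  then show "cnj (arc (pi / N)) = z (- 1)" by (simp add: z_def cis_cnj)
qed

lemma poly_tri_rotate: "\<eta> ^ N = 1 \<Longrightarrow> \<eta> ^ m = 1 \<Longrightarrow> poly (tri s) (\<eta> * x) = poly (tri s) x"
  by (simp add: poly_tri power_mult_distrib)

lemma poly_tri_cnj: "poly (tri s) (cnj x) = cnj (poly (tri s) x)"
  by (simp add: poly_tri)

lemma approach_double_roots: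
  assumes r: "0 < r" and e: "0 < e"
  shows "\<exists>s x1 \<gamma>. s < 1 \<and> real N * (1 - s) \<le> e \<and> norm (x1 - 1) < r \<and> x1 \<noteq> cnj x1 \<and>
    poly_path S \<gamma> \<and> \<gamma> 0 = b \<and> \<gamma> 1 = tri s \<and>
    (\<forall>\<eta>. \<eta> ^ N = 1 \<longrightarrow> \<eta> ^ m = 1 \<longrightarrow>
      follows \<gamma> (\<eta> * z 0) (\<eta> * x1) \<and> follows \<gamma> (\<eta> * z (- 1)) (\<eta> * cnj x1))"
proof -
  have piN: "0 < pi / N" using N by simp
  have z0: "0 \<in> {0..pi / N}" using piN by simp
  obtain \<delta>1 where \<delta>1: "0 < \<delta>1" "\<And>\<phi>. \<phi> \<in> {0..pi / N} \<Longrightarrow> dist \<phi> 0 < \<delta>1 \<Longrightarrow> dist (param \<phi>) (param 0) < e / N"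
    using continuous_param[unfolded continuous_on_iff, rule_format, OF z0, of "e / N"] e N by auto
  obtain \<delta>2 where \<delta>2: "0 < \<delta>2" "\<And>\<phi>. \<phi> \<in> {0..pi / N} \<Longrightarrow> dist \<phi> 0 < \<delta>2 \<Longrightarrow> dist (arc \<phi>) (arc 0) < r"
    using continuous_arc[unfolded continuous_on_iff, rule_format, OF z0, of r] r by auto
  define \<psi> where "\<psi> = min (pi / N) (min (\<delta>1 / 2) (\<delta>2 / 2))"
  have \<psi>: "0 < \<psi>" "\<psi> \<le> pi / N" "\<psi> < \<delta>1" "\<psi> < \<delta>2"
    using piN \<delta>1(1) \<delta>2(1) unfolding \<psi>_def by linarith+
  have \<psi>_in: "\<psi> \<in> {0..pi / N}" using \<psi> by simp
  define \<phi> where "\<phi> t = pi / N + t * (\<psi> - pi / N)" for t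
  have \<phi>_range: "\<psi> \<le> \<phi> t" "\<phi> t \<le> pi / N" if t: "t \<in> {0..1}" for t
  proof -
    have "1 * (\<psi> - pi / N) \<le> t * (\<psi> - pi / N)" using t \<psi>(2) by (intro mult_right_mono_neg) auto
    then show "\<psi> \<le> \<phi> t" by (simp add: \<phi>_def)
    show "\<phi> t \<le> pi / N" using t \<psi>(2) by (simp add: \<phi>_def mult_nonneg_nonpos)
  qed
  have cont_\<phi>: "continuous_on {0..1} \<phi>"
    unfolding \<phi>_def by (intro continuous_on_add continuous_on_mult continuous_on_const continuous_on_id)
  have \<phi>_image: "\<phi> ` {0..1} \<subseteq> {0..pi / N}" using \<phi>_range \<psi>(1) by force
  define \<gamma> where "\<gamma> t = tri (param (\<phi> t))" for t
  have cont_param: "continuous_on {0..1} (\<lambda>t. param (\<phi> t))"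
    by (rule continuous_on_compose2[OF continuous_param cont_\<phi> \<phi>_image])
  have cont_arc: "continuous_on {0..1} (\<lambda>t. arc (\<phi> t))"
    by (rule continuous_on_compose2[OF continuous_arc cont_\<phi> \<phi>_image])
  have "poly_path S \<gamma>"
    unfolding poly_path_def
  proof (intro conjI allI)
    fix i
    have "coeff (\<gamma> t) i = coeff (monom (of_nat m) N + [:of_nat N - of_nat m:]) i +
        (- of_real (param (\<phi> t)) * of_nat N) * (if i = m then 1 else 0)" for t
      by (simp add: \<gamma>_def tri_def)
    then show "path (\<lambda>t. coeff (\<gamma> t) i)"
      unfolding path_def
      by (simp only:) (intro continuous_on_add continuous_on_mult continuous_on_minus continuous_on_of_real
          continuous_on_const cont_param)
    show "\<gamma> ` {0..1} \<subseteq> S"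
    proof
      fix g assume "g \<in> \<gamma> ` {0..1}"
      then obtain t where t: "t \<in> {0..1}" "g = tri (param (\<phi> t))" by (auto simp: \<gamma>_def)
      have "0 < \<phi> t" "\<phi> t \<le> pi / N" using \<phi>_range[OF t(1)] \<psi>(1) by auto
      then show "g \<in> S" unfolding t(2) using param_less_1[of "\<phi> t"] param_nonneg[of "\<phi> t"] by (intro tri_S) auto
    qed
  qed
  moreover have "\<gamma> 0 = b" by (simp add: \<gamma>_def \<phi>_def end_values tri_0)
  moreover have "\<gamma> 1 = tri (param \<psi>)" by (simp add: \<gamma>_def \<phi>_def)
  moreover have "follows \<gamma> (\<eta> * z 0) (\<eta> * arc \<psi>) \<and> follows \<gamma> (\<eta> * z (- 1)) (\<eta> * cnj (arc \<psi>))"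
    if \<eta>: "\<eta> ^ N = 1" "\<eta> ^ m = 1" for \<eta>
  proof
    have root: "poly (\<gamma> t) (arc (\<phi> t)) = 0" if "t \<in> {0..1}" for t
      unfolding \<gamma>_def using \<phi>_range[OF that] \<psi>(1) by (intro arc_root) auto
    have ends: "\<phi> 0 = pi / N" "\<phi> 1 = \<psi>" by (simp_all add: \<phi>_def)
    show "follows \<gamma> (\<eta> * z 0) (\<eta> * arc \<psi>)"
      unfolding follows_def root_path_def
    proof (intro exI conjI ballI)
      show "path (\<lambda>t. \<eta> * arc (\<phi> t))"
        unfolding path_def by (intro continuous_on_mult continuous_on_const cont_arc)
      show "\<eta> * arc (\<phi> t) \<in> roots (\<gamma> t)" if "t \<in> {0..1}" for t
        using root[OF that] by (simp add: roots_def \<gamma>_def poly_tri_rotate[OF \<eta>])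
    qed (simp_all add: ends end_values)
    show "follows \<gamma> (\<eta> * z (- 1)) (\<eta> * cnj (arc \<psi>))"
      unfolding follows_def root_path_def
    proof (intro exI conjI ballI)
      show "path (\<lambda>t. \<eta> * cnj (arc (\<phi> t)))"
        unfolding path_def by (intro continuous_on_mult continuous_on_const continuous_on_cnj cont_arc)
      show "\<eta> * cnj (arc (\<phi> t)) \<in> roots (\<gamma> t)" if "t \<in> {0..1}" for t
        using root[OF that] by (simp add: roots_def \<gamma>_def poly_tri_rotate[OF \<eta>] poly_tri_cnj)
    qed (simp_all add: ends end_values(1,3))
  qed
  moreover have "real N * (1 - param \<psi>) \<le> e"
  proof -
    have "dist (param \<psi>) 1 < e / N" using \<delta>1(2)[OF \<psi>_in] \<psi> start_values by simp
    then have "1 - param \<psi> < e / N" by (simp add: dist_real_def)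
    then show ?thesis using N by (simp add: field_simps)
  qed
  moreover have "norm (arc \<psi> - 1) < r"
    using \<delta>2(2)[OF \<psi>_in] \<psi> start_values by (simp add: dist_norm)
  moreover have "arc \<psi> \<noteq> cnj (arc \<psi>)"
  proof -
    have "pi / N < pi" using m N by (simp add: field_simps)
    then have "0 < sin \<psi>" using \<psi> by (intro sin_gt_zero) auto
    then have "Im (arc \<psi>) \<noteq> 0" using modulus_pos[of \<psi>] \<psi> by (simp add: arc_def)
    then show ?thesis by (simp add: complex_eq_iff)
  qed
  moreover have "param \<psi> < 1" using param_less_1 \<psi> by blast
  ultimately show ?thesis by blast
qed

lemma at_common_root_of_unity:
  assumes "\<xi> ^ N = 1" "\<xi> ^ m = 1"
  shows "poly (tri 1) \<xi> = 0" "poly (pderiv (tri 1)) \<xi> = 0" "poly (pderiv (pderiv (tri 1))) \<xi> \<noteq> 0"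
proof -
  have \<xi>: "\<xi> \<noteq> 0" using assms(1) N by (auto simp: power_0_left)
  show "poly (tri 1) \<xi> = 0" using assms by (simp add: poly_tri)
  have 1: "x * poly (pderiv (monom c k)) x = of_nat k * c * x ^ k" for x c :: complex and k
    by (cases k) (simp_all add: pderiv_monom poly_monom)
  have 2: "x\<^sup>2 * poly (pderiv (pderiv (monom c k))) x = of_nat k * (of_nat k - 1) * c * x ^ k"
    for x c :: complex and k
    by (cases k; cases "k - 1") (simp_all add: pderiv_monom poly_monom power2_eq_square)
  have "\<xi> * poly (pderiv (tri 1)) \<xi> = 0"
    using assms by (simp add: tri_def pderiv_add distrib_left 1 pderiv_pCons)
  then show "poly (pderiv (tri 1)) \<xi> = 0" using \<xi> by simp
  have "\<xi>\<^sup>2 * poly (pderiv (pderiv (tri 1))) \<xi> = of_nat N * of_nat m * (of_nat N - of_nat m)"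
    using assms by (simp add: tri_def pderiv_add distrib_left 2 pderiv_pCons algebra_simps)
  also have "\<dots> \<noteq> 0" using m by simp
  finally show "poly (pderiv (pderiv (tri 1))) \<xi> \<noteq> 0" by auto
qed

text \<open>
  The loop at \<open>tri 1\<close> adds \<open>\<epsilon> exp(2 \<pi> i t) x^m\<close>, which would swap the two roots near every double
  root \<open>\<xi>\<close>. To prevent this unless \<open>\<xi>^d = 1\<close>, it also adds a multiple of the sum of \<open>1 - x^i\<close> over all
  \<open>i\<close> in \<open>A\<close>. This sum vanishes at \<open>\<xi>\<close> if \<open>\<xi>^d = 1\<close>; otherwise it has positive real part there, and
  a large multiple, switched on in the middle of the loop, keeps the total value in the right
  half-plane.
\<close>

lemma swap_realized: "adjacent_swap (int n) (- 1) \<in> realized"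
proof -
  define \<Xi> where "\<Xi> = {\<xi>::complex. \<xi> ^ N = 1 \<and> \<xi> ^ m = 1}"
  define \<Xi>\<^sub>0 where "\<Xi>\<^sub>0 = {\<xi> \<in> \<Xi>. \<forall>i\<in>A. \<xi> ^ i = 1}"
  define q2 :: "complex poly" where "q2 = (\<Sum>i\<in>A. [:1:] - monom 1 i)"
  have poly_q2: "poly q2 \<xi> = (\<Sum>i\<in>A. 1 - \<xi> ^ i)" for \<xi>
    by (simp add: q2_def poly_sum poly_monom)
  have \<Xi>_norm: "norm \<xi> = 1" if "\<xi> \<in> \<Xi>" for \<xi>
    using that N power_eq_imp_eq_base[of "norm \<xi>" N 1] by (auto simp: \<Xi>_def simp flip: norm_power)
  have term_nonneg: "0 \<le> Re (1 - \<xi> ^ i)" if "\<xi> \<in> \<Xi>" for \<xi> i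
    using complex_Re_le_cmod[of "\<xi> ^ i"] \<Xi>_norm[OF that] by (simp add: norm_power)
  have Re_q2: "0 < Re (poly q2 \<xi>)" if \<xi>: "\<xi> \<in> \<Xi> - \<Xi>\<^sub>0" for \<xi>
  proof -
    obtain i where i: "i \<in> A" "\<xi> ^ i \<noteq> 1" using \<xi> by (auto simp: \<Xi>\<^sub>0_def)
    have "Re (\<xi> ^ i) \<noteq> 1"
    proof
      assume re: "Re (\<xi> ^ i) = 1"
      have "(Re (\<xi> ^ i))\<^sup>2 + (Im (\<xi> ^ i))\<^sup>2 = 1"
        using \<Xi>_norm[of \<xi>] \<xi> by (simp add: norm_power flip: cmod_power2)
      then have "Im (\<xi> ^ i) = 0" using re by simp
      then show False using re i(2) by (simp add: complex_eq_iff)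
    qed
    then have "0 < Re (1 - \<xi> ^ i)" using term_nonneg[of \<xi> i] \<xi> by auto
    also have "Re (1 - \<xi> ^ i) \<le> (\<Sum>i\<in>A. Re (1 - \<xi> ^ i))"
      using term_nonneg[of \<xi>] \<xi> i(1) A(1) by (intro member_le_sum) auto
    finally show ?thesis by (simp add: poly_q2 Re_sum)
  qed
  have tri1: "tri 1 \<noteq> 0" using degree_tri[of 1] N by auto
  have "\<Xi> \<subseteq> roots (tri 1)" using at_common_root_of_unity(1) by (auto simp: \<Xi>_def roots_def)
  then have fin: "finite \<Xi>" using finite_roots[OF tri1] finite_subset by blast
  \<comment> \<open>Large enough to outweigh \<open>cos (2 \<pi> t) \<ge> -1\<close> at all double roots outside \<open>\<Xi>\<^sub>0\<close>.\<close>
  define L where "L = (\<Sum>\<xi>\<in>\<Xi> - \<Xi>\<^sub>0. 2 / Re (poly q2 \<xi>))"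
  have L0: "0 \<le> L" unfolding L_def using Re_q2 by (intro sum_nonneg) (auto intro: less_imp_le)
  have L2: "2 \<le> L * Re (poly q2 \<xi>)" if \<xi>: "\<xi> \<in> \<Xi> - \<Xi>\<^sub>0" for \<xi>
  proof -
    have "2 / Re (poly q2 \<xi>) \<le> L"
      unfolding L_def using fin Re_q2 \<xi> by (intro member_le_sum) (auto intro: less_imp_le)
    then show ?thesis using Re_q2[OF \<xi>] by (simp add: field_simps)
  qed
  define u :: "real \<Rightarrow> complex" where "u t = cis (2 * pi * t)" for t
  define v :: "real \<Rightarrow> complex" where "v t = of_real (L * ((1 - cos (2 * pi * t)) / 2))" for t
  have "\<exists>K. tri 1 = [:- \<xi>, 1:]\<^sup>2 * K \<and> poly K \<xi> \<noteq> 0" if "\<xi> \<in> \<Xi>" for \<xi>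
    using double_root_factor[of "tri 1" \<xi>] at_common_root_of_unity[of \<xi>] that unfolding \<Xi>_def by blast
  then obtain K where K: "\<And>\<xi>. \<xi> \<in> \<Xi> \<Longrightarrow> tri 1 = [:- \<xi>, 1:]\<^sup>2 * K \<xi> \<and> poly (K \<xi>) \<xi> \<noteq> 0" by metis
  have deg_q2: "degree q2 \<le> N"
    unfolding q2_def using A
    by (intro degree_sum_le degree_diff_le order_trans[OF degree_monom_le]) auto
  interpret L: double_root_loop "tri 1" "monom 1 m" q2 N K \<Xi> \<Xi>\<^sub>0 u v "1 + L" 1
  proof
    show "degree (monom 1 m :: complex poly) \<le> N" using m by (simp add: degree_monom_eq)
    show "poly (pderiv (tri 1)) y \<noteq> 0" if "y \<in> roots (tri 1)" "y \<notin> \<Xi>" for y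
      using multiple_root_tri[of 1 y] that by (auto simp: roots_def \<Xi>_def)
    show "continuous_on {0..1} u" "continuous_on {0..1} v"
      unfolding u_def v_def by (intro continuous_intros; simp)+
    show "norm (u t) \<le> 1 + L" for t using L0 by (simp add: u_def)
    show "norm (v t) \<le> 1 + L" for t
    proof -
      have "0 \<le> (1 - cos (2 * pi * t)) / 2" using cos_le_one[of "2 * pi * t"] by simp
      moreover have "(1 - cos (2 * pi * t)) / 2 \<le> 1" using cos_ge_minus_one[of "2 * pi * t"] by simp
      ultimately have "L * ((1 - cos (2 * pi * t)) / 2) \<le> L * 1" using L0 by (intro mult_left_mono)
      moreover have "0 \<le> L * ((1 - cos (2 * pi * t)) / 2)"
        using L0 cos_le_one[of "2 * pi * t"] by (intro mult_nonneg_nonneg) auto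
      ultimately show ?thesis unfolding v_def norm_of_real by linarith
    qed
    show "u t * poly (monom 1 m) \<xi> + v t * poly q2 \<xi> = cis (2 * pi * t)" if "\<xi> \<in> \<Xi>\<^sub>0" for \<xi> t
      using that by (simp add: u_def poly_monom poly_q2 \<Xi>\<^sub>0_def \<Xi>_def)
    show "1 \<le> Re (u t * poly (monom 1 m) \<xi> + v t * poly q2 \<xi>)" if \<xi>: "\<xi> \<in> \<Xi> - \<Xi>\<^sub>0" for \<xi> t
    proof -
      let ?w = "(1 - cos (2 * pi * t)) / 2"
      have "0 \<le> ?w" using cos_le_one[of "2 * pi * t"] by simp
      then have "?w * 2 \<le> ?w * (L * Re (poly q2 \<xi>))" using L2[OF \<xi>] by (intro mult_left_mono) auto
      moreover have "Re (u t * poly (monom 1 m) \<xi> + v t * poly q2 \<xi>) =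
          cos (2 * pi * t) + ?w * (L * Re (poly q2 \<xi>))"
        using \<xi> by (simp add: u_def v_def poly_monom \<Xi>_def)
      ultimately show ?thesis by simp
    qed
  qed (use N K deg_q2 L0 in \<open>auto simp: degree_tri \<Xi>\<^sub>0_def \<Xi>_def u_def v_def poly_monom\<close>)
  obtain r \<epsilon>\<^sub>0 where ok: "L.radius_ok r \<epsilon>\<^sub>0" using L.radius_exists by blast
  have r: "0 < r" "0 < \<epsilon>\<^sub>0" using ok by (auto simp: L.radius_ok_def)
  obtain s x1 \<gamma> where s: "s < 1" "real N * (1 - s) \<le> \<epsilon>\<^sub>0" and x1: "norm (x1 - 1) < r" "x1 \<noteq> cnj x1"
    and \<gamma>: "poly_path S \<gamma>" "\<gamma> 0 = b" "\<gamma> 1 = tri s"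
    and fol: "\<And>\<eta>. \<eta> ^ N = 1 \<Longrightarrow> \<eta> ^ m = 1 \<Longrightarrow>
      follows \<gamma> (\<eta> * z 0) (\<eta> * x1) \<and> follows \<gamma> (\<eta> * z (- 1)) (\<eta> * cnj x1)"
    using approach_double_roots[OF r] by blast
  define \<epsilon> where "\<epsilon> = real N * (1 - s)"
  have \<epsilon>: "0 < \<epsilon>" "\<epsilon> \<le> \<epsilon>\<^sub>0" using s N by (auto simp: \<epsilon>_def)
  note loop_facts = ok \<epsilon>
  have loop0: "L.loop \<epsilon> 0 = tri s"
    unfolding L.loop_def by (rule poly_eqI) (simp add: u_def v_def tri_def \<epsilon>_def algebra_simps)
  have loop1: "L.loop \<epsilon> 1 = tri s" using L.loop_closed[OF loop_facts] loop0 by simp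
  have q2_space: "q2 \<in> poly_space A"
    unfolding poly_space_def
  proof (intro CollectI allI impI)
    fix j assume "coeff q2 j \<noteq> 0"
    then obtain i where "i \<in> A" "coeff ([:1:] - monom 1 i :: complex poly) j \<noteq> 0"
      unfolding q2_def coeff_sum by (meson sum.neutral)
    then show "j \<in> A" using A(2) by (auto simp: coeff_pCons split: nat.splits if_splits)
  qed
  have "L.loop \<epsilon> t \<in> poly_space A" for t
  proof -
    have "coeff (L.loop \<epsilon> t) i = 0" if "i \<notin> A" for i
    proof -
      have "coeff (tri 1) i = 0" "coeff q2 i = 0" "i \<noteq> m"
        using tri_poly_space[of 1] q2_space m(1) that unfolding poly_space_def by blast+
      then show ?thesis by (simp add: L.loop_def)
    qed
    then show ?thesis unfolding poly_space_def by blast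
  qed
  then have loop_path: "poly_path S (L.loop \<epsilon>)"
    using L.loop_path[OF loop_facts] by (auto simp: poly_path_def)
  obtain \<sigma>1 where \<sigma>1: "transport S b (tri s) \<sigma>1" "\<And>x. x \<in> roots b \<Longrightarrow> follows \<gamma> x (\<sigma>1 x)"
    using transport_along[OF \<gamma>(1) S_simple N] \<gamma> by auto
  obtain \<sigma>2 where \<sigma>2: "transport S (tri s) (tri s) \<sigma>2" "\<And>x. x \<in> roots (tri s) \<Longrightarrow> follows (L.loop \<epsilon>) x (\<sigma>2 x)"
    using transport_along[OF loop_path S_simple N] loop0 loop1 by auto
  have bij1: "bij_betw \<sigma>1 (roots b) (roots (tri s))" by (rule transport_bij[OF \<sigma>1(1) S_simple N])
  define \<tau> where "\<tau> = inv_into (roots b) \<sigma>1"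
  have \<tau>: "\<tau> (\<sigma>1 x) = x" if "x \<in> roots b" for x
    unfolding \<tau>_def using bij1 that by (rule bij_betw_inv_into_left)
  have tr: "transport S b b (\<tau> \<circ> (\<sigma>2 \<circ> \<sigma>1))"
    using transport_comp[OF transport_comp[OF \<sigma>1(1) \<sigma>2(1)] transport_inverse[OF \<sigma>1(1) S_simple N]] \<tau> by simp
  have zb: "z j \<in> roots b" for j by (simp add: roots_b)
  have \<gamma>_simple: "poly_path (simple_polys N) \<gamma>" using \<gamma>(1) S_simple by (rule poly_path_mono)
  have \<sigma>1_eq: "\<sigma>1 (\<eta> * z 0) = \<eta> * x1" "\<sigma>1 (\<eta> * z (- 1)) = \<eta> * cnj x1"
    and in_b: "\<eta> * z 0 \<in> roots b" "\<eta> * z (- 1) \<in> roots b"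
    and near: "\<eta> * x1 \<in> roots (L.loop \<epsilon> 0) \<inter> ball \<eta> r" "\<eta> * cnj x1 \<in> roots (L.loop \<epsilon> 0) \<inter> ball \<eta> r"
    and distinct: "\<eta> * x1 \<noteq> \<eta> * cnj x1" if \<eta>: "\<eta> \<in> \<Xi>" for \<eta>
  proof -
    have f: "follows \<gamma> (\<eta> * z 0) (\<eta> * x1)" "follows \<gamma> (\<eta> * z (- 1)) (\<eta> * cnj x1)"
      using fol \<eta> by (auto simp: \<Xi>_def)
    show in_b: "\<eta> * z 0 \<in> roots b" "\<eta> * z (- 1) \<in> roots b"
      using follows_in_roots(1)[OF f(1)] follows_in_roots(1)[OF f(2)] \<gamma>(2) by auto
    show "\<sigma>1 (\<eta> * z 0) = \<eta> * x1" "\<sigma>1 (\<eta> * z (- 1)) = \<eta> * cnj x1"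
      using follows_unique[OF \<gamma>_simple N \<sigma>1(2)[OF in_b(1)] f(1)]
        follows_unique[OF \<gamma>_simple N \<sigma>1(2)[OF in_b(2)] f(2)] by auto
    have "dist \<eta> (\<eta> * x) = norm (x - 1)" for x
    proof -
      have "dist \<eta> (\<eta> * x) = norm (\<eta> * (x - 1))" by (simp add: dist_norm norm_minus_commute right_diff_distrib)
      then show ?thesis using \<Xi>_norm[OF \<eta>] by (simp add: norm_mult)
    qed
    moreover have "norm (cnj x1 - 1) = norm (x1 - 1)"
      by (metis complex_cnj_diff complex_cnj_one complex_mod_cnj)
    ultimately show "\<eta> * x1 \<in> roots (L.loop \<epsilon> 0) \<inter> ball \<eta> r" "\<eta> * cnj x1 \<in> roots (L.loop \<epsilon> 0) \<inter> ball \<eta> r"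
      using x1(1) follows_in_roots(2)[OF f(1)] follows_in_roots(2)[OF f(2)] \<gamma>(3) loop0 by auto
    have "\<eta> \<noteq> 0" using \<Xi>_norm[OF \<eta>] by auto
    then show "\<eta> * x1 \<noteq> \<eta> * cnj x1" using x1(2) by simp
  qed
  have only_two: "y = \<eta> * x1 \<or> y = \<eta> * cnj x1"
    if "\<eta> \<in> \<Xi>" "y \<in> roots (L.loop \<epsilon> 0) \<inter> ball \<eta> r" for y \<eta>
    using L.at_most_two[OF loop_facts that(1) near(1)[OF that(1)] that(2) near(2)[OF that(1)]]
      distinct[OF that(1)] by blast
  have swaps: "\<sigma>2 (\<eta> * x1) = \<eta> * cnj x1" "\<sigma>2 (\<eta> * cnj x1) = \<eta> * x1" if \<eta>: "\<eta> \<in> \<Xi>\<^sub>0" for \<eta>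
  proof -
    have \<eta>': "\<eta> \<in> \<Xi>" using \<eta> by (simp add: \<Xi>\<^sub>0_def)
    have *: "\<sigma>2 y \<noteq> y \<and> (\<sigma>2 y = \<eta> * x1 \<or> \<sigma>2 y = \<eta> * cnj x1)"
      if y: "y \<in> roots (L.loop \<epsilon> 0) \<inter> ball \<eta> r" for y
    proof -
      have f: "follows (L.loop \<epsilon>) y (\<sigma>2 y)" using \<sigma>2(2)[of y] y loop0 by simp
      have "y \<in> ball \<eta> r" using y by simp
      note swap = L.loop_swaps_turning[OF loop_facts f \<eta> this]
      have "\<sigma>2 y \<in> roots (L.loop \<epsilon> 0)" using follows_in_roots(2)[OF f] loop0 loop1 by simp
      then show ?thesis using swap only_two[OF \<eta>'] by blast
    qed
    show "\<sigma>2 (\<eta> * x1) = \<eta> * cnj x1" using *[OF near(1)[OF \<eta>']] by blast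
    show "\<sigma>2 (\<eta> * cnj x1) = \<eta> * x1" using *[OF near(2)[OF \<eta>']] by blast
  qed
  define \<eta> where "\<eta> i = cis (2 * pi * of_int (int n * i) / N)" for i
  have \<eta>_shift: "\<eta> i * z j = z (j + int n * i)" for i j
    by (simp only: \<eta>_def z_shift)
  have \<eta>0: "\<eta> i \<in> \<Xi>\<^sub>0" for i
  proof -
    have "\<eta> i ^ j = 1" if "j \<in> A" for j
    proof -
      have "d dvd j" using that d Gcd_dvd by blast
      then have "int N dvd int j * (int n * i)" using n by (auto simp: dvd_def)
      then have "cis (2 * pi * of_int (int j * (int n * i)) / N) = 1" by (simp only: cis_turn_eq_1_iff[OF N])
      then show ?thesis by (simp add: \<eta>_def Complex.DeMoivre mult_ac)
    qed
    then show ?thesis using A(3) m(1) by (simp add: \<Xi>\<^sub>0_def \<Xi>_def)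
  qed
  have \<eta>\<Xi>: "\<eta> i \<in> \<Xi>" for i using \<eta>0 by (auto simp: \<Xi>\<^sub>0_def)
  \<comment> \<open>If \<open>w = exp(2 \<pi> i k / N)\<close> satisfies \<open>w^i = 1\<close> for all exponents \<open>i\<close>, then \<open>N\<close> divides \<open>k d\<close>.\<close>
  have \<eta>_all: "\<exists>i. w = \<eta> i" if w: "w \<in> \<Xi>\<^sub>0" for w
  proof -
    have "w ^ N = 1" using w by (simp add: \<Xi>\<^sub>0_def \<Xi>_def)
    then obtain k where k: "w = cis (2 * pi * of_nat k / N)" using root_of_unity_cases[OF N] by blast
    have "N dvd k * i" if "i \<in> A" for i
    proof -
      have "cis (2 * pi * of_int (int (k * i)) / N) = w ^ i"
        by (simp add: k Complex.DeMoivre mult_ac)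
      also have "\<dots> = 1" using w that by (simp add: \<Xi>\<^sub>0_def)
      finally show ?thesis unfolding cis_turn_eq_1_iff[OF N] by (simp only: int_dvd_int_iff)
    qed
    then have "N dvd Gcd ((*) k ` A)" by (intro Gcd_greatest) auto
    then have "n * d dvd k * d" using n d by (simp add: Gcd_mult)
    then have "n dvd k" using pos by simp
    then obtain i where "k = n * i" by (auto simp: dvd_def)
    then have "w = \<eta> (int i)" by (simp add: k \<eta>_def)
    then show ?thesis by blast
  qed
  have "(\<tau> \<circ> (\<sigma>2 \<circ> \<sigma>1)) (z j) = z (adjacent_swap (int n) (- 1) j)" for j
  proof -
    consider i where "j = - 1 + int n * i" | i where "j = 0 + int n * i" "j mod int n \<noteq> (- 1) mod int n"
      | "j mod int n \<noteq> 0" "j mod int n \<noteq> (- 1) mod int n"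
    proof -
      have "\<exists>i. j = c + int n * i" if "j mod int n = c mod int n" for c
        using that by (metis mod_eq_dvd_iff dvd_def add.commute diff_add_cancel)
      then show ?thesis using that by (metis mod_0)
    qed
    then show ?thesis
    proof cases
      case (1 i)
      have "(\<tau> \<circ> (\<sigma>2 \<circ> \<sigma>1)) (\<eta> i * z (- 1)) = \<tau> (\<sigma>1 (\<eta> i * z 0))"
        using \<sigma>1_eq[OF \<eta>\<Xi>] swaps[OF \<eta>0] by simp
      also have "\<dots> = \<eta> i * z 0" by (rule \<tau>[OF in_b(1)[OF \<eta>\<Xi>]])
      finally have img: "(\<tau> \<circ> (\<sigma>2 \<circ> \<sigma>1)) (z (- 1 + int n * i)) = z (0 + int n * i)" unfolding \<eta>_shift .
      have mod: "j mod int n = (- 1) mod int n" unfolding 1 by (rule mod_mult_self2)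
      have swap: "adjacent_swap (int n) (- 1) j = j + 1" unfolding adjacent_swap_def mod by simp
      show ?thesis unfolding swap using img unfolding 1 by simp
    next
      case (2 i)
      have "(\<tau> \<circ> (\<sigma>2 \<circ> \<sigma>1)) (\<eta> i * z 0) = \<tau> (\<sigma>1 (\<eta> i * z (- 1)))"
        using \<sigma>1_eq[OF \<eta>\<Xi>] swaps[OF \<eta>0] by simp
      also have "\<dots> = \<eta> i * z (- 1)" by (rule \<tau>[OF in_b(2)[OF \<eta>\<Xi>]])
      finally have img: "(\<tau> \<circ> (\<sigma>2 \<circ> \<sigma>1)) (z (0 + int n * i)) = z (- 1 + int n * i)" unfolding \<eta>_shift .
      have "j mod int n = 0" using 2(1) by simp
      then have swap: "adjacent_swap (int n) (- 1) j = j - 1" using 2(2) by (simp add: adjacent_swap_def)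
      show ?thesis unfolding swap using img unfolding 2(1) by simp
    next
      case 3
      define y where "y = \<sigma>1 (z j)"
      have y: "y \<in> roots (tri s)" using bij_betwE[OF bij1] zb by (simp add: y_def)
      have f: "follows (L.loop \<epsilon>) y (\<sigma>2 y)" by (rule \<sigma>2(2)[OF y])
      obtain w where w: "w \<in> roots (tri 1)" "y \<in> ball w r"
        using L.loop_near[OF loop_facts, of 0 y] y loop0 by auto
      have "w \<notin> \<Xi>\<^sub>0"
      proof
        assume "w \<in> \<Xi>\<^sub>0"
        then obtain i where i: "w = \<eta> i" using \<eta>_all by blast
        have "y = \<sigma>1 (\<eta> i * z 0) \<or> y = \<sigma>1 (\<eta> i * z (- 1))"
          using only_two[OF \<eta>\<Xi>, of y i] y w loop0 i \<sigma>1_eq[OF \<eta>\<Xi>] by auto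
        then have "z j = z (0 + int n * i) \<or> z j = z (- 1 + int n * i)"
          unfolding \<eta>_shift y_def using bij1 zb by (metis bij_betw_imp_inj_on inj_onD)
        then have "int N dvd j - (0 + int n * i) \<or> int N dvd j - (- 1 + int n * i)"
          by (simp only: z_eq_iff)
        moreover have "int n dvd int N" by (simp add: n)
        ultimately have "int n dvd j - (0 + int n * i) \<or> int n dvd j - (- 1 + int n * i)"
          using dvd_trans by blast
        then have "j mod int n = (0 + int n * i) mod int n \<or> j mod int n = (- 1 + int n * i) mod int n"
          by (simp only: mod_eq_dvd_iff)
        then have "j mod int n = 0 mod int n \<or> j mod int n = (- 1) mod int n"
          by (simp only: mod_mult_self2)
        then show False using 3 by simp
      qed
      then have "\<sigma>2 y = y"
        using L.loop_fixes_straight[OF loop_facts f _ w(2)] L.loop_fixes_simple[OF loop_facts f _ w(2)] w(1) by blast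
      then have "(\<tau> \<circ> (\<sigma>2 \<circ> \<sigma>1)) (z j) = z j" using \<tau>[OF zb] by (simp add: y_def)
      then show ?thesis using 3 by (simp add: adjacent_swap_def)
    qed
  qed
  moreover have "2 \<le> int n"
  proof -
    have "d dvd m" using m(1) d Gcd_dvd by blast
    then have "d \<le> m" using m(2) by (rule dvd_imp_le)
    then have "n \<noteq> 1" using m(3) n by auto
    then show ?thesis using pos by simp
  qed
  ultimately show ?thesis
    unfolding realized_def using tr adjacent_swap_periodic by blast
qed

end

section \<open>Permutations of necklaces as a wreath product\<close>

text \<open>
  \<open>Z\<close> is the disjoint union of \<open>n\<close> orbits of multiplication by \<open>\<zeta>\<close>, each of length \<open>d\<close>, and
  \<open>x 1, ..., x n\<close> represent the orbits.
\<close>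

locale rotation_orbits =
  fixes Z :: "complex set" and \<zeta> :: complex and d n :: nat and x :: "nat \<Rightarrow> complex"
  assumes d: "0 < d" and root_of_unity: "\<zeta> ^ d = 1"
    and orbits: "bij_betw (\<lambda>(s, i). \<zeta> powi i * x s) ({1..n} \<times> {0..<int d}) Z"
begin

definition pt :: "nat \<Rightarrow> int \<Rightarrow> complex"
  where "pt s i = \<zeta> powi i * x s"

lemma zeta_nonzero: "\<zeta> \<noteq> 0"
  using root_of_unity d by (cases d) auto

lemma pt_mod: "pt s (i mod int d) = pt s i"
proof -
  have "\<zeta> powi i = \<zeta> powi (int d * (i div int d) + i mod int d)" by simp
  also have "\<dots> = (\<zeta> powi int d) powi (i div int d) * \<zeta> powi (i mod int d)"
    using zeta_nonzero by (subst power_int_add) (auto simp: power_int_mult)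
  also have "\<dots> = \<zeta> powi (i mod int d)" using root_of_unity by simp
  finally show ?thesis by (simp add: pt_def)
qed

lemma mod_range: "i mod int d \<in> {0..<int d}"
  using d by simp

lemma bij_pt: "bij_betw (\<lambda>(s, i). pt s i) ({1..n} \<times> {0..<int d}) Z"
  using orbits by (simp add: pt_def)

lemma pt_in: "s \<in> {1..n} \<Longrightarrow> pt s i \<in> Z"
  using bij_betw_imp_surj_on[OF bij_pt] mod_range[of i] pt_mod[of s i]
  by (metis (no_types, lifting) SigmaI case_prod_conv image_eqI)

lemma pt_eq_iff:
  assumes "s \<in> {1..n}" "t \<in> {1..n}"
  shows "pt s i = pt t j \<longleftrightarrow> s = t \<and> i mod int d = j mod int d"
proof
  assume "pt s i = pt t j"
  then have eq: "pt s (i mod int d) = pt t (j mod int d)" by (simp add: pt_mod)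
  have "(s, i mod int d) = (t, j mod int d)"
    by (rule inj_onD[OF bij_betw_imp_inj_on[OF bij_pt]]) (use eq assms mod_range in auto)
  then show "s = t \<and> i mod int d = j mod int d" by simp
next
  assume "s = t \<and> i mod int d = j mod int d"
  then show "pt s i = pt t j" by (metis pt_mod)
qed

lemma Z_cases:
  assumes "z \<in> Z"
  obtains s i where "s \<in> {1..n}" "i \<in> {0..<int d}" "z = pt s i"
  using assms bij_betw_imp_surj_on[OF bij_pt] by auto

lemma mult_pt: "\<zeta> * pt s i = pt s (i + 1)"
  using zeta_nonzero by (simp add: pt_def power_int_add)

definition coords :: "complex \<Rightarrow> nat \<times> int"
  where "coords = inv_into ({1..n} \<times> {0..<int d}) (\<lambda>(s, i). pt s i)"

lemma coords_pt: "s \<in> {1..n} \<Longrightarrow> coords (pt s i) = (s, i mod int d)"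
  using inv_into_f_f[OF bij_betw_imp_inj_on[OF bij_pt], of "(s, i mod int d)"] mod_range[of i]
  by (simp add: coords_def pt_mod)

definition commuting_perms :: "(complex \<Rightarrow> complex) set"
  where "commuting_perms = {\<sigma>. \<sigma> permutes Z \<and> (\<forall>z\<in>Z. \<sigma> (\<zeta> * z) = \<zeta> * \<sigma> z)}"

text \<open>
  The rotation \<open>u\<close> is indexed by the target orbit \<open>g s\<close>; this makes the action compatible with the
  multiplication of the wreath product, in which the rotations of the first factor are applied
  after those of the second factor have been permuted by \<open>g\<close>.
\<close>

definition act :: "(nat \<Rightarrow> int) \<times> (nat \<Rightarrow> nat) \<Rightarrow> complex \<Rightarrow> complex"
  where "act = (\<lambda>(u, g) z. if z \<in> Z
    then case coords z of (s, i) \<Rightarrow> pt (g s) (i + u (g s)) else z)"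

lemma act_pt:
  assumes "s \<in> {1..n}"
  shows "act (u, g) (pt s i) = pt (g s) (i + u (g s))"
proof -
  have "act (u, g) (pt s i) = pt (g s) (i mod int d + u (g s))"
    using assms by (simp add: act_def pt_in coords_pt)
  also have "\<dots> = pt (g s) (i + u (g s))"
    by (metis pt_mod mod_add_left_eq)
  finally show ?thesis .
qed

lemma act_outside: "z \<notin> Z \<Longrightarrow> act w z = z"
  by (simp add: act_def split: prod.splits)

abbreviation "W \<equiv> wreath_product (integer_mod_group d) {1..n} (sym_group n)"

lemma carrier_W: "carrier W = (\<Pi>\<^sub>E s\<in>{1..n}. {0..<int d}) \<times> {g. g permutes {1..n}}"
  using d by (simp add: wreath_product_def semidirect_product_def integer_mod_group_def sym_group_def)

lemma carrier_WE:
  assumes "w \<in> carrier W"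
  obtains u g where "w = (u, g)" "u \<in> (\<Pi>\<^sub>E s\<in>{1..n}. {0..<int d})" "g permutes {1..n}"
  using assms unfolding carrier_W by blast

lemma mult_W:
  "(u, g) \<otimes>\<^bsub>W\<^esub> (v, h) =
    (\<lambda>t\<in>{1..n}. (u t + (\<lambda>s\<in>{1..n}. v (inv' g s)) t) mod int d, g \<circ> h)"
  using d by (simp add: wreath_product_def semidirect_product_def integer_mod_group_def sym_group_def)

lemma mult_W_closed:
  assumes "w \<in> carrier W" "w' \<in> carrier W"
  shows "w \<otimes>\<^bsub>W\<^esub> w' \<in> carrier W"
proof -
  obtain u g v h where w: "w = (u, g)" "w' = (v, h)" "g permutes {1..n}" "h permutes {1..n}"
    using assms by (metis carrier_WE)
  have "(\<lambda>t\<in>{1..n}. (u t + (\<lambda>s\<in>{1..n}. v (inv' g s)) t) mod int d) \<in> (\<Pi>\<^sub>E s\<in>{1..n}. {0..<int d})"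
    using d by auto
  then show ?thesis
    unfolding carrier_W w(1,2) mult_W using permutes_compose[OF w(4,3)] by blast
qed

lemma act_commuting:
  assumes "w \<in> carrier W"
  shows "act w \<in> commuting_perms"
proof -
  obtain u g where w: "w = (u, g)" and g: "g permutes {1..n}"
    using assms by (metis carrier_WE)
  have g_in: "g s \<in> {1..n}" if "s \<in> {1..n}" for s using permutes_in_image[OF g] that by simp
  have into: "act w ` Z \<subseteq> Z"
    using g_in by (auto simp: w act_pt pt_in elim!: Z_cases)
  have "inj_on (act w) Z"
  proof (rule inj_onI)
    fix z z' assume "z \<in> Z" "z' \<in> Z" and eq: "act w z = act w z'"
    obtain s i where s: "s \<in> {1..n}" "z = pt s i" using \<open>z \<in> Z\<close> by (rule Z_cases)
    obtain t j where t: "t \<in> {1..n}" "z' = pt t j" using \<open>z' \<in> Z\<close> by (rule Z_cases)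
    have "g s = g t \<and> (i + u (g s)) mod int d = (j + u (g t)) mod int d"
    proof -
      have "pt (g s) (i + u (g s)) = pt (g t) (j + u (g t))"
        using eq unfolding w s(2) t(2) act_pt[OF s(1)] act_pt[OF t(1)] .
      then show ?thesis unfolding pt_eq_iff[OF g_in[OF s(1)] g_in[OF t(1)]] .
    qed
    moreover from this have "s = t" using permutes_inj[OF g] by (simp add: inj_eq)
    ultimately have "(i + u (g s) - u (g s)) mod int d = (j + u (g s) - u (g s)) mod int d"
      by (metis mod_diff_left_eq)
    then show "z = z'" using s t \<open>s = t\<close> by (simp add: pt_eq_iff)
  qed
  moreover have "finite Z" using bij_betw_finite[OF bij_pt] by simp
  ultimately have "bij_betw (act w) Z Z" using into by (simp add: bij_betw_def endo_inj_surj)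
  then have "act w permutes Z" by (intro bij_imp_permutes act_outside)
  moreover have "act w (\<zeta> * z) = \<zeta> * act w z" if "z \<in> Z" for z
    using that by (auto simp: w act_pt mult_pt algebra_simps elim!: Z_cases)
  ultimately show ?thesis by (simp add: commuting_perms_def)
qed

lemma act_mult:
  assumes "w \<in> carrier W" "w' \<in> carrier W"
  shows "act (w \<otimes>\<^bsub>W\<^esub> w') = act w \<circ> act w'"
proof
  obtain u g where w: "w = (u, g)" and g: "g permutes {1..n}"
    using assms(1) by (metis carrier_WE)
  obtain v h where w': "w' = (v, h)" and h: "h permutes {1..n}"
    using assms(2) by (metis carrier_WE)
  fix z
  show "act (w \<otimes>\<^bsub>W\<^esub> w') z = (act w \<circ> act w') z"
  proof (cases "z \<in> Z")
    case True
    then obtain s i where s: "s \<in> {1..n}" "z = pt s i" by (rule Z_cases)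
    have hs: "h s \<in> {1..n}" "g (h s) \<in> {1..n}"
      using permutes_in_image[OF g] permutes_in_image[OF h] s(1) by auto
    have "act (w \<otimes>\<^bsub>W\<^esub> w') z = pt (g (h s)) (i + (u (g (h s)) + v (h s)) mod int d)"
      unfolding w w' mult_W s(2) act_pt[OF s(1)] using hs permutes_inverses(2)[OF g] by simp
    also have "\<dots> = pt (g (h s)) (i + v (h s) + u (g (h s)))"
      by (metis pt_mod mod_add_right_eq add.commute add.left_commute)
    also have "\<dots> = (act w \<circ> act w') z"
      using s(1) hs by (simp add: s(2) w w' act_pt del: atLeastAtMost_iff)
    finally show ?thesis .
  qed (simp add: act_outside)
qed

lemma act_inj: "inj_on act (carrier W)"
proof (rule inj_onI)
  fix w w' assume "w \<in> carrier W" "w' \<in> carrier W" and eq: "act w = act w'"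
  then obtain u g v h where w: "w = (u, g)" "w' = (v, h)"
    and g: "g permutes {1..n}" and h: "h permutes {1..n}"
    and u: "u \<in> (\<Pi>\<^sub>E s\<in>{1..n}. {0..<int d})" and v: "v \<in> (\<Pi>\<^sub>E s\<in>{1..n}. {0..<int d})"
    by (metis carrier_WE)
  have key: "g s = h s \<and> u (g s) = v (g s)" if s: "s \<in> {1..n}" for s
  proof -
    have in_range: "g s \<in> {1..n}" "h s \<in> {1..n}"
      using permutes_in_image[OF g] permutes_in_image[OF h] s by auto
    have "pt (g s) (0 + u (g s)) = pt (h s) (0 + v (h s))"
      using fun_cong[OF eq, of "pt s 0"] s by (simp only: w act_pt)
    then have *: "g s = h s \<and> u (g s) mod int d = v (h s) mod int d"
      unfolding pt_eq_iff[OF in_range] add_0_left .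
    have "u (g s) \<in> {0..<int d}" "v (h s) \<in> {0..<int d}" using u v in_range by blast+
    then have "u (g s) mod int d = u (g s)" "v (h s) mod int d = v (h s)" by simp_all
    then show ?thesis using * by metis
  qed
  have "g = h" using key permutes_not_in[OF g] permutes_not_in[OF h] by (metis ext)
  moreover have "u t = v t" for t
  proof (cases "t \<in> {1..n}")
    case True
    then obtain s where "s \<in> {1..n}" "t = g s" using permutes_image[OF g] by blast
    then show ?thesis using key by metis
  next
    case False
    then show ?thesis using u v by (metis PiE_arb)
  qed
  ultimately show "w = w'" using w by auto
qed

lemma act_surj:
  assumes "\<sigma> \<in> commuting_perms"
  shows "\<sigma> \<in> act ` carrier W"
proof -
  have \<sigma>: "\<sigma> permutes Z" and comm: "\<And>z. z \<in> Z \<Longrightarrow> \<sigma> (\<zeta> * z) = \<zeta> * \<sigma> z"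
    using assms by (auto simp: commuting_perms_def)
  have "\<exists>t i. t \<in> {1..n} \<and> i \<in> {0..<int d} \<and> \<sigma> (pt s 0) = pt t i" if "s \<in> {1..n}" for s
    using pt_in[OF that] permutes_in_image[OF \<sigma>] by (metis Z_cases)
  then obtain g0 c where g0: "\<And>s. s \<in> {1..n} \<Longrightarrow> g0 s \<in> {1..n} \<and> c s \<in> {0..<int d} \<and>
      \<sigma> (pt s 0) = pt (g0 s) (c s)" by metis
  have nat_pt: "\<sigma> (pt s (int i)) = pt (g0 s) (int i + c s)" if "s \<in> {1..n}" for s i
  proof (induction i)
    case (Suc i)
    have "\<sigma> (pt s (int (Suc i))) = \<sigma> (\<zeta> * pt s (int i))"
      by (simp only: mult_pt) (simp add: add.commute)
    also have "\<dots> = \<zeta> * pt (g0 s) (int i + c s)" using comm[OF pt_in[OF that]] Suc by simp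
    finally show ?case by (simp add: mult_pt algebra_simps)
  qed (use g0[OF that] in simp)
  have \<sigma>_pt: "\<sigma> (pt s i) = pt (g0 s) (i + c s)" if "s \<in> {1..n}" for s i
  proof -
    have "int (nat (i mod int d)) = i mod int d" using d by simp
    then have "\<sigma> (pt s i) = \<sigma> (pt s (int (nat (i mod int d))))" by (simp only: pt_mod)
    also have "\<dots> = pt (g0 s) (i mod int d + c s)" using nat_pt[OF that, of "nat (i mod int d)"]
      by (simp only: \<open>int (nat (i mod int d)) = i mod int d\<close>)
    also have "\<dots> = pt (g0 s) (i + c s)" by (metis pt_mod mod_add_left_eq)
    finally show ?thesis .
  qed
  define g where "g s = (if s \<in> {1..n} then g0 s else s)" for s
  have "inj_on g0 {1..n}"
  proof (rule inj_onI)
    fix s t assume s: "s \<in> {1..n}" and t: "t \<in> {1..n}" and eq: "g0 s = g0 t"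
    have "\<sigma> (pt s (- c s)) = \<sigma> (pt t (- c t))" using \<sigma>_pt s t eq by simp
    then have "pt s (- c s) = pt t (- c t)" using permutes_inj[OF \<sigma>] by (simp add: inj_eq)
    then show "s = t" using pt_eq_iff s t by blast
  qed
  moreover have "g0 ` {1..n} \<subseteq> {1..n}" using g0 by blast
  ultimately have "bij_betw g0 {1..n} {1..n}" by (simp add: bij_betw_def endo_inj_surj)
  moreover have "g s = g0 s" if "s \<in> {1..n}" for s using that by (simp add: g_def)
  ultimately have "bij_betw g {1..n} {1..n}" using bij_betw_cong by metis
  then have g: "g permutes {1..n}" by (intro bij_imp_permutes) (auto simp: g_def)
  define u where "u = (\<lambda>t\<in>{1..n}. c (inv' g t))"
  have inv_g: "inv' g t \<in> {1..n}" if "t \<in> {1..n}" for t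
    using permutes_in_image[OF permutes_inv[OF g]] that by simp
  have "u \<in> (\<Pi>\<^sub>E s\<in>{1..n}. {0..<int d})"
    unfolding u_def restrict_PiE_iff using g0 inv_g by blast
  then have "(u, g) \<in> carrier W" unfolding carrier_W using g by blast
  moreover have "\<sigma> = act (u, g)"
  proof
    fix z
    show "\<sigma> z = act (u, g) z"
    proof (cases "z \<in> Z")
      case True
      then obtain s i where s: "s \<in> {1..n}" "z = pt s i" by (rule Z_cases)
      have "g s = g0 s" "g s \<in> {1..n}" using s(1) g0 by (auto simp: g_def)
      moreover have "u (g s) = c s"
        using \<open>g s \<in> {1..n}\<close> permutes_inverses(2)[OF g] by (simp add: u_def)
      ultimately show ?thesis using \<sigma>_pt[OF s(1)] act_pt[OF s(1)] s(2) by simp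
    next
      case False
      then show ?thesis using permutes_not_in[OF \<sigma>] by (simp add: act_outside)
    qed
  qed
  ultimately show ?thesis by blast
qed

lemma commuting_perms_iso_wreath:
  "\<lparr>carrier = commuting_perms, monoid.mult = (\<circ>), one = id\<rparr> \<cong> W"
proof -
  let ?G = "\<lparr>carrier = commuting_perms, monoid.mult = (\<circ>), one = id\<rparr>"
  have bij: "bij_betw act (carrier W) (carrier ?G)"
    using act_inj act_commuting act_surj by (auto simp: bij_betw_def)
  let ?\<psi> = "inv_into (carrier W) act"
  have bij': "bij_betw ?\<psi> (carrier ?G) (carrier W)" using bij by (rule bij_betw_inv_into)
  have "?\<psi> \<in> hom ?G W"
  proof (rule homI)
    fix \<sigma> \<tau> assume *: "\<sigma> \<in> carrier ?G" "\<tau> \<in> carrier ?G"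
    then have in_W: "?\<psi> \<sigma> \<in> carrier W" "?\<psi> \<tau> \<in> carrier W" using bij' bij_betwE by blast+
    have "act (?\<psi> \<sigma> \<otimes>\<^bsub>W\<^esub> ?\<psi> \<tau>) = \<sigma> \<circ> \<tau>"
      using act_mult[OF in_W] bij_betw_inv_into_right[OF bij] * by simp
    then show "?\<psi> (\<sigma> \<otimes>\<^bsub>?G\<^esub> \<tau>) = ?\<psi> \<sigma> \<otimes>\<^bsub>W\<^esub> ?\<psi> \<tau>"
      using inv_into_f_f[OF act_inj mult_W_closed[OF in_W]] by simp
  qed (use bij' bij_betwE in blast)
  then show ?thesis using bij' by (auto simp: is_iso_def iso_def)
qed

end

section \<open>Necklaces and the monodromy group\<close>

lemma exp_eq_cis: "exp (2 * of_real pi * \<i> / of_nat d) = cis (2 * pi / d)"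
proof -
  have "\<i> * of_real (2 * pi / d) = 2 * of_real pi * \<i> / of_nat d" by simp
  then show ?thesis unfolding cis_conv_exp by (simp only:)
qed

lemma equal_powers_cases:
  fixes x y :: complex
  assumes d: "0 < d" and eq: "x ^ d = y ^ d"
  obtains i where "i < d" "x = cis (2 * pi / d) ^ i * y"
proof (cases "y = 0")
  case True
  then have "x = 0" using eq d by (simp add: power_0_left)
  then show ?thesis using that[of 0] d True by simp
next
  case False
  then have "(x / y) ^ d = 1" using eq by (simp add: power_divide)
  then obtain i where i: "i < d" "x / y = cis (2 * pi * of_nat i / of_nat d)"
    using root_of_unity_cases[OF d] by blast
  then have "x / y = cis (2 * pi / d) ^ i" by (simp add: Complex.DeMoivre mult_ac)
  then show ?thesis using that[of i] i(1) False by (simp add: field_simps)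
qed

context support
begin

abbreviation \<zeta> :: complex
  where "\<zeta> \<equiv> cis (2 * pi / d)"

lemma zeta_power_d: "\<zeta> ^ d = 1"
  using pos by (simp add: Complex.DeMoivre)

lemma zeta_power_roots:
  assumes "f \<in> S" "x \<in> roots f"
  shows "\<zeta> ^ i * x \<in> roots f"
  using assms by (induction i) (auto simp: mult.assoc intro: rotation_roots)

text \<open>Two elements of a necklace differ by a power of \<open>\<zeta>\<close>, so commuting with \<open>\<zeta>\<close> is enough.\<close>

lemma preserves_necklaces_iff:
  assumes f: "f \<in> S" and \<sigma>: "\<sigma> permutes roots f"
  shows "preserves_necklaces d f \<sigma> \<longleftrightarrow> (\<forall>x\<in>roots f. \<sigma> (\<zeta> * x) = \<zeta> * \<sigma> x)"
proof
  assume comm: "\<forall>x\<in>roots f. \<sigma> (\<zeta> * x) = \<zeta> * \<sigma> x"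
  have pow: "\<sigma> (\<zeta> ^ i * x) = \<zeta> ^ i * \<sigma> x" if "x \<in> roots f" for i x
    using that zeta_power_roots[OF f that] comm by (induction i) (auto simp: mult.assoc)
  have "\<sigma> ` M \<in> necklaces d f" if M: "M \<in> necklaces d f" for M
  proof (cases "M = {}")
    case False
    obtain g y where g: "f = pcompose g (monom 1 d)" "y \<in> roots g" "M = {x. x ^ d = y}"
      using M by (auto simp: necklaces_def)
    have f_g: "poly f x = poly g (x ^ d)" for x
      by (simp add: g(1) poly_pcompose poly_monom)
    obtain x0 where x0: "x0 ^ d = y" using False g(3) by auto
    have x0f: "x0 \<in> roots f" using g(2) x0 f_g by (simp add: roots_def)
    have "\<sigma> ` M = {x. x ^ d = \<sigma> x0 ^ d}"
    proof (intro equalityI subsetI)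
      fix x assume "x \<in> \<sigma> ` M"
      then obtain w where w: "w ^ d = x0 ^ d" "x = \<sigma> w" using g(3) x0 by auto
      then obtain i where "w = \<zeta> ^ i * x0" using equal_powers_cases[OF pos(1)] by metis
      then have "x = \<zeta> ^ i * \<sigma> x0" using pow[OF x0f] w(2) by simp
      then show "x \<in> {x. x ^ d = \<sigma> x0 ^ d}"
        using zeta_power_d by (simp add: power_mult_distrib) (metis mult.commute power_mult power_one)
    next
      fix x assume "x \<in> {x. x ^ d = \<sigma> x0 ^ d}"
      then obtain i where "x = \<zeta> ^ i * \<sigma> x0" using equal_powers_cases[OF pos(1)] by (metis mem_Collect_eq)
      then have "x = \<sigma> (\<zeta> ^ i * x0)" using pow[OF x0f] by simp
      moreover have "(\<zeta> ^ i * x0) ^ d = y"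
        using zeta_power_d x0 by (simp add: power_mult_distrib) (metis mult.commute power_mult power_one)
      ultimately show "x \<in> \<sigma> ` M" using g(3) by auto
    qed
    moreover have "\<sigma> x0 ^ d \<in> roots g"
      using x0f permutes_in_image[OF \<sigma>] f_g by (simp add: roots_def)
    ultimately show ?thesis using g(1) unfolding necklaces_def by blast
  qed (use M in simp)
  then show "preserves_necklaces d f \<sigma>"
    using comm by (simp add: preserves_necklaces_def exp_eq_cis)
qed (simp add: preserves_necklaces_def exp_eq_cis)

text \<open>For \<open>d > 1\<close> the exponent \<open>1\<close> is missing, so a root at \<open>0\<close> would be a multiple root.\<close>

lemma root_zero:
  assumes f: "f \<in> S" and "0 \<in> roots f"
  shows "d = 1"
proof (rule ccontr)
  assume "d \<noteq> 1"
  have "1 \<notin> A"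
  proof
    assume "1 \<in> A"
    then have "d dvd 1" using d Gcd_dvd by blast
    then show False using \<open>d \<noteq> 1\<close> by simp
  qed
  then have "coeff f 1 = 0" using f by (auto simp: poly_space_def)
  then have "poly (pderiv f) 0 = 0" by (simp add: poly_0_coeff_0 coeff_pderiv)
  then show False using f assms(2) by (auto simp: simple_polys_iff roots_def)
qed

lemma necklace_representatives:
  assumes f: "f \<in> S"
  shows "\<exists>x. rotation_orbits (roots f) \<zeta> d n x"
proof -
  let ?Z = "roots f"
  define P where "P = (\<lambda>x. x ^ d) ` ?Z"
  define rep where "rep y = (SOME x. x \<in> ?Z \<and> x ^ d = y)" for y
  have rep: "rep y \<in> ?Z" "rep y ^ d = y" if "y \<in> P" for y
    using that someI_ex[of "\<lambda>x. x \<in> ?Z \<and> x ^ d = y"] by (auto simp: P_def rep_def)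
  let ?F = "\<lambda>(y, i::int). \<zeta> powi i * rep y"
  have zd: "(\<zeta> powi i) ^ d = 1" for i
  proof -
    have "of_nat d * (of_int i * (2 * pi / d)) = 2 * pi * of_int i" using pos by simp
    then have "(\<zeta> powi i) ^ d = cis (2 * pi * of_int i)"
      by (simp only: cis_power_int Complex.DeMoivre)
    then show ?thesis by simp
  qed
  have bij: "bij_betw ?F (P \<times> {0..<int d}) ?Z"
  proof (rule bij_betw_imageI)
    show "inj_on ?F (P \<times> {0..<int d})"
    proof (rule inj_onI, clarsimp)
      fix y i y' j assume y: "y \<in> P" and y': "y' \<in> P" and i: "0 \<le> i" "i < int d" and j: "0 \<le> j" "j < int d"
        and eq: "\<zeta> powi i * rep y = \<zeta> powi j * rep y'"
      have "(\<zeta> powi i * rep y) ^ d = (\<zeta> powi j * rep y') ^ d" using eq by simp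
      then have yy: "y = y'" using zd rep(2)[OF y] rep(2)[OF y'] by (simp add: power_mult_distrib)
      moreover have "i = j"
      proof (cases "rep y = 0")
        case True
        then have "d = 1" using rep(1)[OF y] root_zero[OF f] by simp
        then show ?thesis using i j by simp
      next
        case False
        then have "\<zeta> powi i = \<zeta> powi j" using eq yy by simp
        then have "\<zeta> powi (i - j) = 1" by (simp add: power_int_diff)
        then have "cis (2 * pi * of_int (i - j) / d) = 1" by (simp add: cis_power_int mult_ac)
        then have "int d dvd i - j" by (simp only: cis_turn_eq_1_iff[OF pos(1)])
        then have "i mod int d = j mod int d" by (simp only: mod_eq_dvd_iff)
        then show ?thesis using i j by simp
      qed
      ultimately show "y = y' \<and> i = j" by simp
    qed
    show "?F ` (P \<times> {0..<int d}) = ?Z"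
    proof (intro equalityI subsetI)
      fix x assume "x \<in> ?F ` (P \<times> {0..<int d})"
      then obtain y i where y: "y \<in> P" "0 \<le> i" "x = \<zeta> powi i * rep y" by auto
      then have "x = \<zeta> ^ nat i * rep y" by (simp add: power_int_def)
      then show "x \<in> ?Z" using zeta_power_roots[OF f rep(1)[OF y(1)]] by simp
    next
      fix x assume x: "x \<in> ?Z"
      then have P: "x ^ d \<in> P" by (simp add: P_def)
      obtain i where i: "i < d" "x = \<zeta> ^ i * rep (x ^ d)"
        using equal_powers_cases[OF pos(1), of x "rep (x ^ d)"] rep(2)[OF P] by metis
      then have "x = ?F (x ^ d, int i)" by simp
      moreover have "(x ^ d, int i) \<in> P \<times> {0..<int d}" using P i(1) by simp
      ultimately show "x \<in> ?F ` (P \<times> {0..<int d})" by (rule image_eqI)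
    qed
  qed
  have "card ?Z = card P * d" using bij_betw_same_card[OF bij] by (simp add: card_cartesian_product)
  then have "card P = n" using card_roots_simple[of f N] f n pos by auto
  moreover have "finite P"
    unfolding P_def using f simple_polys_nonzero by (intro finite_imageI finite_roots) auto
  ultimately obtain h where h: "bij_betw h {1..n} P"
    using ex_bij_betw_nat_finite_1 by metis
  have "bij_betw (map_prod h id) ({1..n} \<times> {0..<int d}) (P \<times> {0..<int d})"
    by (intro bij_betw_map_prod h bij_betw_id)
  from bij_betw_trans[OF this bij]
  have "bij_betw (\<lambda>(s, i). \<zeta> powi i * rep (h s)) ({1..n} \<times> {0..<int d}) ?Z"
    by (rule back_subst[of "\<lambda>F. bij_betw F _ _"]) (auto simp: fun_eq_iff)
  then show ?thesis
    using pos zeta_power_d by (intro exI[of _ "\<lambda>s. rep (h s)"]) (simp add: rotation_orbits_def)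
qed

text \<open>
  If there is more than one necklace, then \<open>d < N\<close>, so \<open>A\<close> contains an exponent strictly between \<open>0\<close>
  and \<open>N\<close>, and the trinomials provide a swap.
\<close>

lemma base_exists:
  "\<exists>g\<in>S. \<forall>\<pi>. bij_betw \<pi> (roots g) (roots g) \<longrightarrow>
     (\<forall>x\<in>roots g. \<pi> (\<zeta> * x) = \<zeta> * \<pi> x) \<longrightarrow> transport S g g \<pi>"
proof (cases "n = 1")
  case True
  interpret binomial A N d n 1 1 by unfold_locales auto
  have "2 \<le> n \<Longrightarrow> adjacent_swap (int n) (- 1) \<in> realized" using True by simp
  from transport_all[OF this] show ?thesis using b_S by blast
next
  case False
  have "A \<noteq> {0, N}"
  proof
    assume "A = {0, N}"
    then have "d = N" using d by simp
    then show False using False n N by simp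
  qed
  then obtain m where m: "m \<in> A" "m \<noteq> 0" "m \<noteq> N" using A by blast
  have "m \<le> N" using m A by auto
  interpret trinomial A N d n m by unfold_locales (use m \<open>m \<le> N\<close> in auto)
  show ?thesis using transport_all swap_realized b_S by blast
qed

text \<open>
  Since any two polynomials in \<open>S\<close> are connected by a path, the base point does not matter: transport
  along the path commutes with \<open>\<zeta>\<close> and conjugates one group of permutations into the other.
\<close>

lemma transport_iff_commutes:
  assumes f: "f \<in> S" and \<sigma>: "\<sigma> permutes roots f"
  shows "transport S f f \<sigma> \<longleftrightarrow> (\<forall>x\<in>roots f. \<sigma> (\<zeta> * x) = \<zeta> * \<sigma> x)"
proof
  assume comm: "\<forall>x\<in>roots f. \<sigma> (\<zeta> * x) = \<zeta> * \<sigma> x"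
  obtain g where g: "g \<in> S" and all: "\<And>\<pi>. bij_betw \<pi> (roots g) (roots g) \<Longrightarrow>
      (\<And>x. x \<in> roots g \<Longrightarrow> \<pi> (\<zeta> * x) = \<zeta> * \<pi> x) \<Longrightarrow> transport S g g \<pi>"
    using base_exists by blast
  obtain \<theta> where \<theta>: "transport S f g \<theta>"
    using transport_exists[OF A(1,2,4) N f g] by blast
  have bij: "bij_betw \<theta> (roots f) (roots g)" by (rule transport_bij[OF \<theta> S_simple N])
  define \<theta>' where "\<theta>' = inv_into (roots f) \<theta>"
  have left: "\<theta>' (\<theta> x) = x" if "x \<in> roots f" for x
    unfolding \<theta>'_def using bij that by (rule bij_betw_inv_into_left)
  have bij': "bij_betw \<theta>' (roots g) (roots f)" unfolding \<theta>'_def using bij by (rule bij_betw_inv_into)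
  have \<theta>': "transport S g f \<theta>'" using transport_inverse[OF \<theta> S_simple N] left by blast
  have "transport S g g (\<theta> \<circ> (\<sigma> \<circ> \<theta>'))"
  proof (rule all)
    show "bij_betw (\<theta> \<circ> (\<sigma> \<circ> \<theta>')) (roots g) (roots g)"
      using bij bij' permutes_imp_bij[OF \<sigma>] by (blast intro: bij_betw_trans)
    fix x assume x: "x \<in> roots g"
    have x1: "\<theta>' x \<in> roots f" using bij_betwE[OF bij'] x by blast
    then have x2: "\<sigma> (\<theta>' x) \<in> roots f" using permutes_in_image[OF \<sigma>] by simp
    show "(\<theta> \<circ> (\<sigma> \<circ> \<theta>')) (\<zeta> * x) = \<zeta> * (\<theta> \<circ> (\<sigma> \<circ> \<theta>')) x"
      using transport_rotation[OF \<theta>' x] comm x1 transport_rotation[OF \<theta> x2] by simp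
  qed
  from transport_comp[OF transport_comp[OF \<theta> this] \<theta>']
  show "transport S f f \<sigma>"
    by (rule transport_cong) (use left permutes_in_image[OF \<sigma>] in simp)
qed (use transport_rotation in blast)

end

theorem theorem1p5:
  fixes a :: "nat \<Rightarrow> nat" and k d :: nat and A :: "nat set" and f :: "complex poly"
  assumes "k \<ge> 1"
    and "a 0 = 0"
    and "strict_mono_on {0..k} a"
    and "A = a ` {0..k}"
    and "d = Gcd (a ` {1..k})"
    and "f \<in> poly_space A - discriminant A"
  shows "monodromy_group A f \<cong>
           wreath_product (integer_mod_group d) {1..a k div d} (sym_group (a k div d))
         \<and> carrier (monodromy_group A f) =
           {\<sigma>. \<sigma> permutes roots f \<and> preserves_necklaces d f \<sigma>}"
proof -
  have less: "a i < a j" if "i < j" "j \<le> k" for i j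
    using assms(3) that by (auto simp: strict_mono_on_def)
  have A: "finite A" "0 \<in> A" "a k \<in> A"
    using assms(2,4) by (auto intro: image_eqI[of _ _ 0])
  have max: "Max A = a k"
  proof (rule Max_eqI[OF A(1) _ A(3)])
    fix y assume "y \<in> A"
    then obtain i where "i \<le> k" "y = a i" using assms(4) by auto
    then show "y \<le> a k" using less[of i k] by (cases "i = k") auto
  qed
  have N: "0 < a k" using less[of 0 k] assms(1,2) by simp
  have "{0..k} = insert 0 {1..k}" using assms(1) by auto
  then have d: "d = Gcd A" using assms(2,4,5) by simp
  then have "d dvd a k" using A(3) Gcd_dvd by blast
  then have n: "a k = a k div d * d" by simp
  interpret support A "a k" d "a k div d"
    by unfold_locales (use A max N d n in auto)
  have S: "poly_space A - discriminant A = S"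
    using compl_discriminant[of A] A max N by auto
  then have f: "f \<in> S" using assms(6) by simp
  have carrier: "carrier (monodromy_group A f) = {\<sigma>. \<sigma> permutes roots f \<and> preserves_necklaces d f \<sigma>}"
    unfolding monodromy_carrier S
    using transport_iff_commutes[OF f] preserves_necklaces_iff[OF f] by blast
  obtain x where "rotation_orbits (roots f) \<zeta> d (a k div d) x"
    using necklace_representatives[OF f] by blast
  then interpret R: rotation_orbits "roots f" \<zeta> d "a k div d" x .
  have "carrier (monodromy_group A f) = R.commuting_perms"
    unfolding carrier R.commuting_perms_def using preserves_necklaces_iff[OF f] by blast
  then have "monodromy_group A f = \<lparr>carrier = R.commuting_perms, monoid.mult = (\<circ>), one = id\<rparr>"
    by (simp add: monodromy_group_def)
  then show ?thesis using R.commuting_perms_iso_wreath carrier by simp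
qed

end
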